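(* Let $H$ be a primitive substitution in $\mathbb{R}^2$, let $\tau\in X_H$ be a substitution tiling of $H$, and let $Y\subseteq\mathbb{R}^2$ be a separated net that corresponds to $\tau$. Then $Y$ is biLipschitz to $\mathbb{Z}^2$, i.e. there exist a bijection $\Phi:Y\to\mathbb{Z}^2$ and a constant $C\ge 1$ such that for all $y,y'\in Y$, $$\frac{1}{C}\,\|y-y'\|\le\|\Phi(y)-\Phi(y')\|\le C\,\|y-y'\|.$$
   Context: Separated net: a set $Y\subseteq\mathbb{R}^d$ is a separated net (Delone set) if there are constants $R,r>0$ such that every ball of radius $R$ intersects $Y$ and every ball of radius $r$ contains at most one point of $Y$. $\|\cdot\|$ is any norm on $\mathbb{R}^d$. Tilings: a tile is a subset of $\mathbb{R}^d$ homeomorphic to a closed $d$-dimensional ball. A tiling of $U\subseteq\mathbb{R}^d$ is a countable collection of tiles with pairwise disjoint interiors whose union is $U$. Two tiles (or patches) are translation equivalent if one is a translate of the other; representatives of the classes of tiles are called prototiles. A patch is a tiling of a bounded set $U$, and $U$ is called its support $\mathrm{supp}(P)$. Substitution: let $\xi>1$ and let $\mathcal{T}=\{S_1,\dots,S_k\}$ be a finite set of $d$-dimensional prototiles (pairwise not translation equivalent). A substitution $H$ in $\mathbb{R}^d$ with inflation constant $\xi$ assigns to each $S_i$ a patch $H(S_i)$ with $\mathrm{supp}(H(S_i))=S_i$, all of whose tiles are translates of the scaled prototiles $\xi^{-1}S_1,\dots,\xi^{-1}S_k$. $H$ is extended to translates (and scalings) of prototiles, and to patches and tilings, by applying it separately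 to every tile; $\xi H$ means applying $H$ and then dilating by $\xi$, so $\xi H$ maps patches of translates of prototiles to patches of translates of prototiles. Substitution tilings: $X_H$ is the set of all tilings of $\mathbb{R}^d$ by translates of prototiles of $\mathcal{T}$ such that every patch of the tiling is, up to translation, a sub-patch of $(\xi H)^m(S_i)$ for some $m\in\mathbb{N}$ and $i\in\{1,\dots,k\}$. Elements of $X_H$ are called substitution tilings of $H$. Primitivity: let $B_H=(b_{ij})$ be the $k\times k$ matrix where $b_{ij}$ is the number of tiles in $\xi H(S_j)$ translation equivalent to $S_i$. $H$ is primitive if some power $B_H^m$ has all entries positive. Net corresponding to a tiling: a separated net $Y$ corresponds to a tiling $\tau$ of $\mathbb{R}^d$ if it is obtained by placing one point in each tile of $\tau$, i.e. there is a bijection $T\mapsto y_T$ from the tiles of $\tau$ onto $Y$ with $y_T\in T$ for every tile $T$. *)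

theory Defs
  imports "HOL-Analysis.Analysis"
begin

definition is_norm :: "('a::real_vector \<Rightarrow> real) \<Rightarrow> bool" where
  "is_norm N \<longleftrightarrow>
     (\<forall>x. 0 \<le> N x) \<and>
     (\<forall>x. N x = 0 \<longleftrightarrow> x = 0) \<and>
     (\<forall>c x. N (c *\<^sub>R x) = \<bar>c\<bar> * N x) \<and>
     (\<forall>x y. N (x + y) \<le> N x + N y)"

definition norm_ball :: "('a::real_vector \<Rightarrow> real) \<Rightarrow> 'a \<Rightarrow> real \<Rightarrow> 'a set" where
  "norm_ball N c \<rho> = {x. N (x - c) \<le> \<rho>}"

definition separated_net :: "('a::real_vector \<Rightarrow> real) \<Rightarrow> 'a set \<Rightarrow> bool" where
  "separated_net N Y \<longleftrightarrow>
     (\<exists>R>0. \<forall>c. norm_ball N c R \<inter> Y \<noteq> {}) \<and>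
     (\<exists>r>0. \<forall>c. \<forall>y \<in> norm_ball N c r \<inter> Y. \<forall>y' \<in> norm_ball N c r \<inter> Y. y = y')"

definition biLipschitz_equivalent ::
    "('a::real_vector \<Rightarrow> real) \<Rightarrow> 'a set \<Rightarrow> 'a set \<Rightarrow> bool" where
  "biLipschitz_equivalent N Y Z \<longleftrightarrow>
     (\<exists>\<Phi> C. bij_betw \<Phi> Y Z \<and> C \<ge> 1 \<and>
        (\<forall>y\<in>Y. \<forall>y'\<in>Y.
           1 / C * N (y - y') \<le> N (\<Phi> y - \<Phi> y') \<and>
           N (\<Phi> y - \<Phi> y') \<le> C * N (y - y')))"

definition integer_lattice :: "(real ^ 'n) set" where
  "integer_lattice = {z. \<forall>i. z $ i \<in> \<int>}"


definition tile :: "'a::euclidean_space set \<Rightarrow> bool" where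
  "tile T \<longleftrightarrow> T homeomorphic cball (0::'a) 1"

definition tiling_of :: "'a::euclidean_space set set \<Rightarrow> 'a set \<Rightarrow> bool" where
  "tiling_of P U \<longleftrightarrow>
     countable P \<and> (\<forall>T\<in>P. tile T) \<and>
     (\<forall>T\<in>P. \<forall>T'\<in>P. T \<noteq> T' \<longrightarrow> interior T \<inter> interior T' = {}) \<and>
     \<Union>P = U"

definition patch :: "'a::euclidean_space set set \<Rightarrow> bool" where
  "patch P \<longleftrightarrow> (\<exists>U. bounded U \<and> tiling_of P U)"

definition translate :: "'a::real_vector \<Rightarrow> 'a set \<Rightarrow> 'a set" where
  "translate x T = (+) x ` T"

definition translate_patch :: "'a::real_vector \<Rightarrow> 'a set set \<Rightarrow> 'a set set" where
  "translate_patch x P = translate x ` P"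

definition dilate :: "real \<Rightarrow> 'a::real_vector set \<Rightarrow> 'a set" where
  "dilate c T = (*\<^sub>R) c ` T"

definition dilate_patch :: "real \<Rightarrow> 'a::real_vector set set \<Rightarrow> 'a set set" where
  "dilate_patch c P = dilate c ` P"

definition translation_equivalent :: "'a::real_vector set \<Rightarrow> 'a set \<Rightarrow> bool" where
  "translation_equivalent T T' \<longleftrightarrow> (\<exists>x. T' = translate x T)"


text \<open>The prototiles form a family \<open>S\<close> indexed by an arbitrary finite type, and \<open>H i\<close> is the
  patch assigned to the prototile \<open>S i\<close>.\<close>

definition substitution ::
    "real \<Rightarrow> ('k::finite \<Rightarrow> 'a::euclidean_space set) \<Rightarrow> ('k \<Rightarrow> 'a set set) \<Rightarrow> bool" where
  "substitution \<xi> S H \<longleftrightarrow>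
     \<xi> > 1 \<and>
     (\<forall>i. tile (S i)) \<and>
     (\<forall>i j. i \<noteq> j \<longrightarrow> \<not> translation_equivalent (S i) (S j)) \<and>
     (\<forall>i. patch (H i) \<and> tiling_of (H i) (S i) \<and>
          (\<forall>T\<in>H i. \<exists>j x. T = translate x (dilate (inverse \<xi>) (S j))))"

text \<open>The extension of \<open>H\<close> to a collection \<open>P\<close> of translates of prototiles: each tile
  \<open>translate x (S i)\<close> of \<open>P\<close> is replaced by \<open>translate_patch x (H i)\<close>.  Under \<open>substitution\<close> the
  pair \<open>(x, i)\<close> is determined by the tile, because tiles are bounded and nonempty and distinct
  prototiles are not translates of each other.  Iterating \<open>\<xi>H\<close> never applies \<open>H\<close> to a
  properly scaled prototile, so the extension to scaled tiles is not needed.\<close>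

definition extend_subst ::
    "('k \<Rightarrow> 'a::real_vector set) \<Rightarrow> ('k \<Rightarrow> 'a set set) \<Rightarrow> 'a set set \<Rightarrow> 'a set set" where
  "extend_subst S H P = \<Union> {translate_patch x (H i) | x i. translate x (S i) \<in> P}"

definition inflate_subst ::
    "real \<Rightarrow> ('k \<Rightarrow> 'a::real_vector set) \<Rightarrow> ('k \<Rightarrow> 'a set set) \<Rightarrow> 'a set set \<Rightarrow> 'a set set" where
  "inflate_subst \<xi> S H P = dilate_patch \<xi> (extend_subst S H P)"

definition substitution_tilings ::
    "real \<Rightarrow> ('k \<Rightarrow> 'a::euclidean_space set) \<Rightarrow> ('k \<Rightarrow> 'a set set) \<Rightarrow> 'a set set set" where
  "substitution_tilings \<xi> S H =
     {\<tau>. tiling_of \<tau> UNIV \<and>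
         (\<forall>T\<in>\<tau>. \<exists>i. translation_equivalent (S i) T) \<and>
         (\<forall>P. P \<subseteq> \<tau> \<and> patch P \<longrightarrow>
            (\<exists>x m i. translate_patch x P \<subseteq> (inflate_subst \<xi> S H ^^ m) {S i}))}"

definition subst_matrix ::
    "real \<Rightarrow> ('k::finite \<Rightarrow> 'a::real_vector set) \<Rightarrow> ('k \<Rightarrow> 'a set set) \<Rightarrow> nat ^ 'k ^ 'k" where
  "subst_matrix \<xi> S H =
     (\<chi> i j. card {T \<in> inflate_subst \<xi> S H {S j}. translation_equivalent (S i) T})"

text \<open>The library's \<open>^\<close> on this type is the entrywise power, hence the iterated matrix
  product here.\<close>

definition matrix_power :: "nat ^ 'k ^ 'k \<Rightarrow> nat \<Rightarrow> nat ^ 'k ^ 'k" where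
  "matrix_power B m = (((**) B) ^^ m) (mat 1)"

definition primitive_subst ::
    "real \<Rightarrow> ('k::finite \<Rightarrow> 'a::real_vector set) \<Rightarrow> ('k \<Rightarrow> 'a set set) \<Rightarrow> bool" where
  "primitive_subst \<xi> S H \<longleftrightarrow>
     (\<exists>m\<ge>1. \<forall>i j. matrix_power (subst_matrix \<xi> S H) m $ i $ j > 0)"

definition net_corresponds :: "'a set \<Rightarrow> 'a set set \<Rightarrow> bool" where
  "net_corresponds Y \<tau> \<longleftrightarrow> (\<exists>y. bij_betw y \<tau> Y \<and> (\<forall>T\<in>\<tau>. y T \<in> T))"

end

(*
  Counting points by supertiles of level about half the logarithmic size of a box shows that the number
  of points of Y in a box of side L is rho * area * (1 + O(L^(-epsilon))): primitivity makes the number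
  of tiles in a level-l supertile proportional to its area up to an exponentially small relative error,
  and only the supertiles along the boundary of the box are counted wrongly. Tile boundaries are null
  sets, since otherwise the total area would not be preserved under subdivision.

  Since these relative errors are summable over dyadic scales, the Burago-Kleiner construction applies.
  Going down from a large square, each dyadic box is halved, and an explicit piecewise affine
  biLipschitz map that fixes the boundary of the box gives both halves an area proportional to their
  number of points. The Lipschitz constants of these maps multiply to a bounded number. The composition
  F sends every small cell to a set of area proportional to the number of its points, so Hall's theorem
  matches each point y with a lattice point at bounded distance from F(y). Separation turns this
  quasi-isometry into a biLipschitz map, and a diagonal argument passes to the whole plane.
*)
theory Submission
  imports Defs "HOL-Complex_Analysis.Great_Picard"
begin

text \<open>Every scale must cost a single factor \<open>1 + 36 * e k\<close>. This is why the
  redistributing maps fix the boundary of their box: the maps of the two halves can then be glued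
  with no increase of the Lipschitz constant. A map that fixes the boundary can change the areas of
  the halves only by bending the segment between them, so it cannot be affine on each half; what is
  needed is a piecewise affine map whose Jacobian is constant on each half, because a constant
  Jacobian keeps the proportions already achieved inside that half. After equalization the area per
  point is the area of a cell of a scaled lattice, so Hall's condition becomes a comparison of
  areas; the scale depends on the box but stays between two positive bounds. Two obstacles come from
  the tiles. Their frontiers might a priori have positive area, so interior areas and full areas are
  kept apart until they are shown to agree. And a substitution tiling is known only through its
  finite patches, each of which has a translate inside some iterated prototile, so every box is
  counted inside such an iterate.\<close>

section \<open>Matchings\<close>

text \<open>Induction after Halmos and Vaughan. A proper nonempty tight set \<open>E\<close> is
  matched within its own neighbourhood and the rest of \<open>A\<close> outside it, where the
  condition survives because \<open>E\<close> uses up exactly its neighbours. Without a tight set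
  every proper nonempty subset has a neighbour to spare, so any one edge may be fixed and
  removed.\<close>

lemma hall_marriage:
  assumes "finite A" and "\<And>a. a \<in> A \<Longrightarrow> finite (N a)"
    and "\<And>E. E \<subseteq> A \<Longrightarrow> card E \<le> card (\<Union>a\<in>E. N a)"
  shows "\<exists>f. inj_on f A \<and> (\<forall>a\<in>A. f a \<in> N a)"
  using assms
proof (induction "card A" arbitrary: A N rule: less_induct)
  case less
  show ?case
  proof (cases "\<exists>E. E \<subset> A \<and> E \<noteq> {} \<and> card (\<Union>a\<in>E. N a) = card E")
    case True
    then obtain E where E: "E \<subset> A" "E \<noteq> {}" "card (\<Union>a\<in>E. N a) = card E" by blast
    have fE: "finite E" using E less.prems(1) finite_subset by blast
    have "card E < card A" using E less.prems(1) psubset_card_mono by blast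
    then have "\<exists>f. inj_on f E \<and> (\<forall>a\<in>E. f a \<in> N a)"
      using E less.prems by (intro less.hyps) (auto simp: fE)
    then obtain f where f: "inj_on f E" "\<forall>a\<in>E. f a \<in> N a" by blast
    let ?U = "\<Union>a\<in>E. N a"
    have "card (A - E) < card A"
      using E fE less.prems(1) by (metis card_Diff_subset card_gt_0_iff diff_less psubset_imp_subset subset_empty)
    moreover have "card D \<le> card (\<Union>a\<in>D. N a - ?U)" if D: "D \<subseteq> A - E" for D
    proof -
      have fD: "finite D" using D less.prems(1) finite_subset by blast
      have "card E + card D = card (E \<union> D)"
        using D fD fE by (subst card_Un_disjoint) auto
      also have "\<dots> \<le> card (\<Union>a\<in>E \<union> D. N a)" using D E by (intro less.prems) auto
      also have "(\<Union>a\<in>E \<union> D. N a) = ?U \<union> (\<Union>a\<in>D. N a - ?U)" by auto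
      also have "card \<dots> \<le> card ?U + card (\<Union>a\<in>D. N a - ?U)" by (rule card_Un_le)
      finally show ?thesis using E by simp
    qed
    ultimately have "\<exists>h. inj_on h (A - E) \<and> (\<forall>a\<in>A - E. h a \<in> N a - ?U)"
      using less.prems by (intro less.hyps) auto
    then obtain h where h: "inj_on h (A - E)" "\<forall>a\<in>A - E. h a \<in> N a - ?U" by blast
    let ?k = "\<lambda>a. if a \<in> E then f a else h a"
    have "inj_on ?k A"
    proof (rule inj_onI)
      fix a b assume ab: "a \<in> A" "b \<in> A" "?k a = ?k b"
      show "a = b"
      proof (cases "a \<in> E"; cases "b \<in> E")
        assume "a \<in> E" "b \<in> E" then show ?thesis using ab f(1) by (auto dest: inj_onD)
      next
        assume *: "a \<in> E" "b \<notin> E"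
        then have "f a \<in> ?U" "h b \<notin> ?U" using ab(2) f(2) h(2) by auto
        then show ?thesis using ab(3) * by simp
      next
        assume *: "a \<notin> E" "b \<in> E"
        then have "f b \<in> ?U" "h a \<notin> ?U" using ab(1) f(2) h(2) by auto
        then show ?thesis using ab(3) * by simp
      next
        assume "a \<notin> E" "b \<notin> E" then show ?thesis using ab h(1) by (auto dest: inj_onD)
      qed
    qed
    moreover have "\<forall>a\<in>A. ?k a \<in> N a" using f h by auto
    ultimately show ?thesis by blast
  next
    case False
    show ?thesis
    proof (cases "A = {}")
      case True then show ?thesis by simp
    next
      case nonempty: False
      then obtain a where a: "a \<in> A" by blast
      have "card {a} \<le> card (\<Union>x\<in>{a}. N x)" using a by (intro less.prems) auto
      then have "N a \<noteq> {}" by auto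
      then obtain b where b: "b \<in> N a" by blast
      have "card (A - {a}) < card A" using a less.prems(1) by (intro psubset_card_mono) auto
      moreover have "card D \<le> card (\<Union>x\<in>D. N x - {b})" if D: "D \<subseteq> A - {a}" for D
      proof (cases "D = {}")
        case nD: False
        have "D \<subset> A" using D a by auto
        then have "card D \<noteq> card (\<Union>x\<in>D. N x)" using False nD by metis
        moreover have "card D \<le> card (\<Union>x\<in>D. N x)" using D by (intro less.prems) auto
        moreover have "(\<Union>x\<in>D. N x - {b}) = (\<Union>x\<in>D. N x) - {b}" by auto
        moreover have "card (\<Union>x\<in>D. N x) \<le> Suc (card ((\<Union>x\<in>D. N x) - {b}))"
          by (simp add: card_Diff_singleton_if, arith)
        ultimately show ?thesis by simp
      qed simp
      ultimately have "\<exists>h. inj_on h (A - {a}) \<and> (\<forall>x\<in>A - {a}. h x \<in> N x - {b})"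
        using less.prems by (intro less.hyps) auto
      then obtain h where h: "inj_on h (A - {a})" "\<forall>x\<in>A - {a}. h x \<in> N x - {b}" by blast
      have "inj_on (h(a := b)) A"
        using h by (auto simp: inj_on_def)
      moreover have "\<forall>x\<in>A. (h(a := b)) x \<in> N x" using h b by auto
      ultimately show ?thesis by blast
    qed
  qed
qed

text \<open>Two one-sided matchings merge into one that serves all of \<open>A\<close> and all of
  \<open>B\<close>, by the alternating-path argument of the Schroeder-Bernstein theorem.\<close>

lemma mendelsohn_dulmage:
  assumes f: "inj_on f A" "\<And>a. a \<in> A \<Longrightarrow> E a (f a)"
    and g: "inj_on g B" "\<And>b. b \<in> B \<Longrightarrow> g b \<in> A \<and> E (g b) b"
  shows "\<exists>h. inj_on h A \<and> (\<forall>a\<in>A. E a (h a)) \<and> B \<subseteq> h ` A"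
proof -
  \<comment> \<open>The least fixed point collects the elements of \<open>A\<close> reached by
    alternating paths that start outside the image of \<open>B\<close> under \<open>g\<close>. They
    keep \<open>f\<close>; the others follow \<open>g\<close> backwards.\<close>
  define \<Gamma> where "\<Gamma> = (\<lambda>X. (A - g ` B) \<union> g ` (B \<inter> f ` (X \<inter> A)))"
  define X where "X = lfp \<Gamma>"
  have X: "X = (A - g ` B) \<union> g ` (B \<inter> f ` (X \<inter> A))"
    unfolding X_def by (subst lfp_unfold) (auto simp: \<Gamma>_def mono_def)
  have XA: "X \<subseteq> A" using X g(2) by blast
  let ?g' = "inv_into B g"
  let ?h = "\<lambda>a. if a \<in> X then f a else ?g' a"
  have g': "?g' a \<in> B" "g (?g' a) = a" if "a \<in> A - X" for a
  proof -
    have "a \<in> g ` B" using that X by blast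
    then show "?g' a \<in> B" "g (?g' a) = a" by (auto simp: inv_into_into f_inv_into_f)
  qed
  have clash: "f x \<noteq> ?g' a" if "x \<in> X" "a \<in> A - X" for x a
  proof
    assume eq: "f x = ?g' a"
    have "a = g (f x)" "f x \<in> B" using g'[OF that(2)] eq by auto
    then have "a \<in> X" using that(1) X XA by blast
    then show False using that by blast
  qed
  have "inj_on ?h A"
  proof (rule inj_onI)
    fix a b assume ab: "a \<in> A" "b \<in> A" "?h a = ?h b"
    show "a = b"
    proof (cases "a \<in> X"; cases "b \<in> X")
      assume "a \<in> X" "b \<in> X" then show ?thesis using ab f(1) by (auto dest: inj_onD)
    next
      assume "a \<in> X" "b \<notin> X" then show ?thesis using ab clash[of a b] by auto
    next
      assume "a \<notin> X" "b \<in> X" then show ?thesis using ab clash[of b a] by auto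
    next
      assume *: "a \<notin> X" "b \<notin> X"
      then have "?g' a = ?g' b" using ab(3) by simp
      then have "g (?g' a) = g (?g' b)" by simp
      then show ?thesis using g'(2)[of a] g'(2)[of b] ab(1,2) * by simp
    qed
  qed
  moreover have "\<forall>a\<in>A. E a (?h a)"
  proof
    fix a assume a: "a \<in> A"
    show "E a (?h a)" using f(2)[OF a] g' [of a] g(2)[of "?g' a"] a by auto
  qed
  moreover have "B \<subseteq> ?h ` A"
  proof
    fix b assume b: "b \<in> B"
    show "b \<in> ?h ` A"
    proof (cases "g b \<in> X")
      case False
      then have "b = ?h (g b)" using b g(1) by simp
      then show ?thesis using g(2)[OF b] by (intro image_eqI[where f = ?h]) auto
    next
      case True
      then have "g b \<in> g ` (B \<inter> f ` (X \<inter> A))" using b X by blast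
      then obtain b' where "b' \<in> B" "b' \<in> f ` (X \<inter> A)" "g b = g b'" by blast
      then have "b \<in> f ` (X \<inter> A)" using b inj_onD[OF g(1), of b b'] by simp
      then obtain x where "x \<in> X" "x \<in> A" "b = f x" by blast
      then show ?thesis by (intro image_eqI[where f = ?h and x = x]) auto
    qed
  qed
  ultimately show ?thesis by blast
qed

section \<open>BiLipschitz maps and half-open boxes\<close>

abbreviation leb :: "'a::euclidean_space set \<Rightarrow> real" where "leb \<equiv> measure lebesgue"

text \<open>With the inverse \<open>G\<close> as an argument, images under \<open>F\<close> are
  preimages under \<open>G\<close>, so images of Borel sets are Borel. One constant bounds both
  directions and multiplies under composition.\<close>

definition bilip :: "real \<Rightarrow> ('a::metric_space \<Rightarrow> 'a) \<Rightarrow> ('a \<Rightarrow> 'a) \<Rightarrow> bool" where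
  "bilip L F G \<longleftrightarrow> L-lipschitz_on UNIV F \<and> L-lipschitz_on UNIV G \<and> (\<forall>z. F (G z) = z) \<and> (\<forall>z. G (F z) = z)"

text \<open>Half-open, so that bisection is an exact partition and the point counts of the halves
  add up.\<close>

definition hbox :: "real ^ 'n \<Rightarrow> real ^ 'n \<Rightarrow> (real ^ 'n) set" where
  "hbox a b = {z. \<forall>i. a $ i \<le> z $ i \<and> z $ i < b $ i}"

text \<open>In the type \<open>2\<close> the axis other than \<open>i\<close> is always
  \<open>i + 1\<close>, which lets one argument serve both cutting directions.\<close>

lemma two_axes: "(i::2) + 1 \<noteq> i" "i + 1 + 1 = i" "j = i \<or> j = i + 1"
proof -
  have "\<forall>i::2. i + 1 \<noteq> i \<and> i + 1 + 1 = i \<and> (\<forall>j. j = i \<or> j = i + 1)"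
    unfolding forall_2 by simp
  then show "(i::2) + 1 \<noteq> i" "i + 1 + 1 = i" "j = i \<or> j = i + 1" by blast+
qed

lemma all_axes: "(\<forall>j. P j) \<longleftrightarrow> P (i::2) \<and> P (i + 1)"
  using two_axes(3)[of _ i] by metis

lemma sum_axes: "(\<Sum>j\<in>UNIV. f j) = f (i::2) + (f (i + 1) :: real)"
proof -
  have "(UNIV :: 2 set) = {i, i + 1}" using two_axes(3)[of _ i] by auto
  then have "sum f UNIV = sum f {i, i + 1}" by (rule arg_cong)
  also have "\<dots> = f i + f (i + 1)" using two_axes(1)[of i] by (subst sum.insert) auto
  finally show ?thesis .
qed

lemma norm_le_axes: "norm (x::real^2) \<le> \<bar>x $ i\<bar> + \<bar>x $ (i + 1)\<bar>"
  using norm_le_l1_cart[of x] by (simp add: sum_axes[of _ i])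

lemma bilip_mono: "bilip L F G \<Longrightarrow> L \<le> M \<Longrightarrow> bilip M F G"
  unfolding bilip_def by (meson lipschitz_on_mono order_refl)

lemma bilip_compose:
  assumes "bilip L F G" "bilip M F' G'"
  shows "bilip (L * M) (F \<circ> F') (G' \<circ> G)"
proof -
  have "(L * M)-lipschitz_on UNIV (F \<circ> F')" "(M * L)-lipschitz_on UNIV (G' \<circ> G)"
    using assms unfolding bilip_def comp_def
    by (metis lipschitz_on_compose2 lipschitz_on_subset subset_UNIV)+
  then show ?thesis using assms unfolding bilip_def by (simp add: mult.commute)
qed

lemma bilip_vimage: "bilip L F G \<Longrightarrow> F ` A = G -` A"
  unfolding bilip_def by (auto simp: image_iff) metis

lemma bilip_inj: "bilip L F G \<Longrightarrow> inj F"
  unfolding bilip_def by (metis injI)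

lemma bilip_borel:
  assumes "bilip L F G" "A \<in> sets borel"
  shows "F ` A \<in> sets borel"
proof -
  have "continuous_on UNIV G" using assms(1) lipschitz_on_continuous_on unfolding bilip_def by blast
  then have "G \<in> borel_measurable borel" by (rule borel_measurable_continuous_onI)
  from measurable_sets[OF this assms(2)] show ?thesis
    using bilip_vimage[OF assms(1)] by simp
qed

lemma bilip_bounded:
  fixes F :: "'a::heine_borel \<Rightarrow> 'a"
  assumes "bilip L F G" "bounded A"
  shows "bounded (F ` A)"
proof -
  have "L-lipschitz_on A F" using assms(1) lipschitz_on_subset unfolding bilip_def by blast
  from bounded_uniformly_continuous_image[OF lipschitz_on_uniformly_continuous[OF this] assms(2)]
  show ?thesis .
qed

lemma lmeasurable_borel: "A \<in> sets borel \<Longrightarrow> bounded A \<Longrightarrow> A \<in> lmeasurable"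
  for A :: "'a::euclidean_space set"
  by (simp add: bounded_set_imp_lmeasurable)

lemma hbox_borel [simp]: "hbox a b \<in> sets borel"
  unfolding hbox_def by measurable

lemma hbox_sub_cbox: "hbox a b \<subseteq> cbox a b"
  by (auto simp: hbox_def mem_box_cart less_imp_le)

lemma box_sub_hbox: "box a b \<subseteq> hbox a b"
  by (auto simp: hbox_def mem_box_cart less_imp_le)

lemma bounded_hbox [simp]: "bounded (hbox a b)"
  using hbox_sub_cbox bounded_cbox bounded_subset by blast

lemma measure_hbox: "leb (hbox a b) = leb (cbox a b)"
proof (rule antisym)
  have l: "hbox a b \<in> lmeasurable" by (intro lmeasurable_borel) auto
  show "leb (hbox a b) \<le> leb (cbox a b)"
    by (intro measure_mono_fmeasurable hbox_sub_cbox) (use l in auto)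
  have "leb (cbox a b) = leb (box a b)"
    by (simp add: measure_lborel_box_eq measure_lborel_cbox_eq)
  also have "\<dots> \<le> leb (hbox a b)"
    by (intro measure_mono_fmeasurable box_sub_hbox) (use l in auto)
  finally show "leb (cbox a b) \<le> leb (hbox a b)" .
qed

lemma hbox_translate: "(+) c ` hbox a b = hbox (c + a) (c + b :: real^'n)"
proof
  show "hbox (c + a) (c + b) \<subseteq> (+) c ` hbox a b"
  proof
    fix x assume "x \<in> hbox (c + a) (c + b)"
    then have "x - c \<in> hbox a b" by (auto simp: hbox_def algebra_simps)
    then show "x \<in> (+) c ` hbox a b" by (intro image_eqI[of _ _ "x - c"]) auto
  qed
qed (auto simp: hbox_def)

lemma measure_hbox2:
  fixes a b :: "real^2"
  assumes "a $ i \<le> b $ i" "a $ (i + 1) \<le> b $ (i + 1)"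
  shows "leb (hbox a b) = (b $ i - a $ i) * (b $ (i + 1) - a $ (i + 1))"
proof -
  have "cbox a b \<noteq> {}" using assms by (simp add: interval_ne_empty_cart all_axes[of _ i])
  then have "measure lborel (cbox a b) = (\<Prod>j\<in>UNIV. b $ j - a $ j)" by (rule content_cbox_cart)
  moreover have "(UNIV :: 2 set) = {i, i + 1}" using two_axes(3)[of _ i] by auto
  then have "(\<Prod>j\<in>UNIV. b $ j - a $ j) = (\<Prod>j\<in>{i, i + 1}. b $ j - a $ j)" by (rule arg_cong)
  also have "\<dots> = (b $ i - a $ i) * (b $ (i + 1) - a $ (i + 1))"
    using two_axes(1)[of i] by (subst prod.insert) auto
  ultimately show ?thesis by (simp add: measure_hbox)
qed

text \<open>Only the values on \<open>S\<close> matter, so a piecewise affine map can be treated one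
  piece at a time.\<close>

lemma affine_image_measure:
  fixes g :: "real^2 \<Rightarrow> real^2"
  assumes S: "S \<in> lmeasurable"
    and g: "\<And>z. z \<in> S \<Longrightarrow> g z $ i = \<alpha> * z $ i + \<beta> * z $ (i + 1) + c"
      "\<And>z. z \<in> S \<Longrightarrow> g z $ (i + 1) = \<gamma> * z $ i + \<eta> * z $ (i + 1) + d"
  shows "leb (g ` S) = \<bar>\<alpha> * \<eta> - \<beta> * \<gamma>\<bar> * leb S"
proof -
  define l where "l = (\<lambda>z::real^2. (\<chi> j. if j = i then \<alpha> * z $ i + \<beta> * z $ (i + 1)
                                          else \<gamma> * z $ i + \<eta> * z $ (i + 1)) :: real^2)"
  define e where "e = ((\<chi> j. if j = i then c else d) :: real^2)"
  have lin: "linear l"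
    by (rule linearI) (auto simp: l_def vec_eq_iff algebra_simps)
  have "g z = e + l z" if "z \<in> S" for z
    unfolding vec_eq_iff all_axes[of _ i] using g[OF that] two_axes(1)[of i] by (simp add: e_def l_def)
  then have "g ` S = (+) e ` (l ` S)" by (auto simp: image_image)
  then have "leb (g ` S) = \<bar>det (matrix l)\<bar> * leb S"
    using measure_translation[of e "l ` S"] measure_linear_image[OF lin S] by simp
  moreover have "det (matrix l) = \<alpha> * \<eta> - \<beta> * \<gamma>"
  proof -
    consider "i = 1" | "i = 2" using exhaust_2 by blast
    then show ?thesis
      by cases (auto simp: det_2 matrix_def l_def axis_def)
  qed
  ultimately show ?thesis by simp
qed

text \<open>Injectivity keeps the images of the two pieces disjoint, so a common area factor passes
  from the pieces to \<open>A\<close>.\<close>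

lemma measure_image_split:
  fixes g :: "real^'n \<Rightarrow> real^'n"
  assumes bl: "bilip L g g'" and A: "A \<in> sets borel" "bounded A" and P: "P \<in> sets borel"
    and 1: "leb (g ` (A \<inter> P)) = d * leb (A \<inter> P)"
    and 2: "leb (g ` (A - P)) = d * leb (A - P)"
  shows "leb (g ` A) = d * leb A"
proof -
  have add: "leb (U \<union> V) = leb U + leb V"
    if "U \<in> lmeasurable" "V \<in> lmeasurable" "U \<inter> V = {}" for U V :: "(real^'n) set"
    using that by (intro measure_Un_AE) (auto simp: disjoint_iff AE_I2)
  have lm: "A \<inter> P \<in> lmeasurable" "A - P \<in> lmeasurable"
    using A P by (auto intro!: lmeasurable_borel bounded_subset[OF A(2)])
  have lg: "g ` (A \<inter> P) \<in> lmeasurable" "g ` (A - P) \<in> lmeasurable"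
    using A P bounded_subset[OF A(2), of "A \<inter> P"] bounded_subset[OF A(2), of "A - P"]
    by (auto intro!: lmeasurable_borel bilip_borel[OF bl] bilip_bounded[OF bl])
  have "leb (g ` (A \<inter> P) \<union> g ` (A - P)) = d * leb (A \<inter> P) + d * leb (A - P)"
  proof -
    have "g ` (A \<inter> P) \<inter> g ` (A - P) = g ` ((A \<inter> P) \<inter> (A - P))"
      using bilip_inj[OF bl] by (rule image_Int[symmetric])
    also have "\<dots> = {}" by blast
    finally show ?thesis using 1 2 add[OF lg] by simp
  qed
  also have "\<dots> = d * leb (A \<inter> P \<union> (A - P))"
    by (subst add[OF lm]) (auto simp: algebra_simps)
  also have "A \<inter> P \<union> (A - P) = A" by auto
  also have "g ` (A \<inter> P) \<union> g ` (A - P) = g ` A" by auto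
  finally show ?thesis .
qed

text \<open>The equation \<open>x + v x = y\<close> is solved by the fixed point of the contraction
  sending \<open>x\<close> to \<open>y - v x\<close>. The inverse has Lipschitz constant
  \<open>1 / (1 - c)\<close>, and this is at most \<open>1 + 2 * c\<close> precisely because
  \<open>c\<close> does not exceed 1/2.\<close>

lemma bilip_id_plus_contraction:
  fixes v :: "'a::banach \<Rightarrow> 'a"
  assumes v: "c-lipschitz_on UNIV v" and c: "0 \<le> c" "c \<le> 1/2"
  shows "\<exists>G. bilip (1 + 2 * c) (\<lambda>z. z + v z) G"
proof -
  let ?F = "\<lambda>z. z + v z"
  have dv: "norm (v x - v y) \<le> c * norm (x - y)" for x y
    using lipschitz_onD[OF v, of x y] by (simp add: dist_norm)
  have low: "(1 - c) * norm (x - y) \<le> norm (?F x - ?F y)" for x y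
  proof -
    have "norm (x - y) \<le> norm (?F x - ?F y) + norm (v x - v y)"
      using norm_triangle_ineq4[of "?F x - ?F y" "v x - v y"] by (simp add: algebra_simps)
    then show ?thesis using dv[of x y] by (simp add: algebra_simps)
  qed
  have inj: "inj ?F"
  proof (rule injI)
    fix x y assume "?F x = ?F y"
    then have "(1 - c) * norm (x - y) \<le> 0" using low[of x y] by simp
    then show "x = y" using c by (simp add: mult_le_0_iff)
  qed
  have surj: "surj ?F"
    unfolding surj_def
  proof
    fix y
    have "\<exists>!x. y - v x = x"
    proof (rule banach_fix_type[where c = c])
      show "\<forall>x z. dist (y - v x) (y - v z) \<le> c * dist x z"
        using dv by (simp add: dist_norm norm_minus_commute)
    qed (use c in auto)
    then obtain x where "y - v x = x" by blast
    then have "y = ?F x" by (simp add: algebra_simps)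
    then show "\<exists>x. y = ?F x" by blast
  qed
  have "bilip (1 + 2 * c) ?F (inv ?F)"
    unfolding bilip_def
  proof (intro conjI allI)
    show "(1 + 2 * c)-lipschitz_on UNIV ?F"
      by (rule lipschitz_on_mono[OF lipschitz_on_add[OF lipschitz_on_id v]]) (use c in auto)
    show "(1 + 2 * c)-lipschitz_on UNIV (inv ?F)"
    proof (rule lipschitz_onI)
      fix x y
      let ?d = "norm (inv ?F x - inv ?F y)"
      have "(1 - c) * ?d \<le> norm (x - y)"
        using low[of "inv ?F x" "inv ?F y"] surj_f_inv_f[OF surj] by metis
      moreover have "?d \<le> (1 + 2 * c) * ((1 - c) * ?d)"
      proof -
        have "1 \<le> (1 + 2 * c) * (1 - c)"
          using mult_left_mono[OF c(2) c(1)] by (simp add: algebra_simps)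
        then show ?thesis using mult_right_mono[of 1 "(1 + 2 * c) * (1 - c)" ?d] by (simp add: mult.assoc)
      qed
      moreover have "(1 + 2 * c) * ((1 - c) * ?d) \<le> (1 + 2 * c) * norm (x - y)"
        using calculation(1) c by (intro mult_left_mono) auto
      ultimately show "dist (inv ?F x) (inv ?F y) \<le> (1 + 2 * c) * dist x y"
        by (simp add: dist_norm)
    qed (use c in auto)
    show "?F (inv ?F z) = z" "inv ?F (?F z) = z" for z
      using surj_f_inv_f[OF surj, of z] inv_f_f[OF inj, of z] by simp_all
  qed
  then show ?thesis by blast
qed

section \<open>A map redistributing area between two halves of a box\<close>

text \<open>The explicit piecewise affine map of the square \<open>[-1, 1]\<^sup>2\<close> behind \<open>half_map\<close>: it fixes
  everything outside the open square and has Jacobian \<open>1 + \<sigma>\<close> on the left half and \<open>1 - \<sigma>\<close> on the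
  right half. Each quarter is cut into four triangles by joining its corners to one inner point;
  the quarter's area forces the centre to move by \<open>2 * \<sigma>\<close>, and \<open>fold_const\<close> places the inner point
  so that all four triangles are dilated by the same factor.\<close>

definition pyr :: "real \<Rightarrow> real \<Rightarrow> real" where
  "pyr s t = max 0 (min (1 - \<bar>s\<bar>) (1 - \<bar>t\<bar>))"

definition fold_const :: "real \<Rightarrow> real \<Rightarrow> real" where
  "fold_const \<sigma> s = (if s < 0 then 1 / (1 + 2 * \<sigma>) else 1 / (1 - 2 * \<sigma>))"

definition fold_min :: "real \<Rightarrow> real \<Rightarrow> real \<Rightarrow> real" where
  "fold_min \<sigma> s t = min (pyr s t) (fold_const \<sigma> s * min (abs s) (abs t))"

definition shift1 :: "real \<Rightarrow> real \<Rightarrow> real \<Rightarrow> real" where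
  "shift1 \<sigma> s t = 2 * pyr s t - fold_min \<sigma> s t"

definition shift2 :: "real \<Rightarrow> real \<Rightarrow> real \<Rightarrow> real" where
  "shift2 \<sigma> s t = sgn s * sgn t * fold_min \<sigma> s t"

section \<open>Lipschitz bounds for the model map\<close>

lemma min_diff: "\<bar>min a b - min c d\<bar> \<le> \<bar>a - c\<bar> + \<bar>b - (d::real)\<bar>"
  by linarith

lemma pyr_diff: "\<bar>pyr s t - pyr s' t'\<bar> \<le> \<bar>s - s'\<bar> + \<bar>t - t'\<bar>"
proof -
  have max0: "\<bar>max 0 a - max 0 b\<bar> \<le> \<bar>a - b\<bar>" for a b :: real by linarith
  have "\<bar>pyr s t - pyr s' t'\<bar> \<le> \<bar>min (1 - \<bar>s\<bar>) (1 - \<bar>t\<bar>) - min (1 - \<bar>s'\<bar>) (1 - \<bar>t'\<bar>)\<bar>"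
    unfolding pyr_def by (rule max0)
  also have "\<dots> \<le> \<bar>1 - \<bar>s\<bar> - (1 - \<bar>s'\<bar>)\<bar> + \<bar>1 - \<bar>t\<bar> - (1 - \<bar>t'\<bar>)\<bar>"
    by (rule min_diff)
  also have "\<dots> \<le> \<bar>s - s'\<bar> + \<bar>t - t'\<bar>" by (intro add_mono) linarith+
  finally show ?thesis .
qed

lemma min_diff_le: "\<bar>a - c\<bar> \<le> x \<Longrightarrow> \<bar>b - d\<bar> \<le> x \<Longrightarrow> \<bar>min a b - min c d\<bar> \<le> (x::real)"
  by linarith

text \<open>Meant for two arguments on opposite sides of an axis, whose distances \<open>p\<close>
  and \<open>q\<close> to it add up to \<open>x\<close>: each value is controlled by its own
  distance.\<close>

lemma abs_diff_le_sum:
  fixes a b f g p q x y :: real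
  assumes "\<bar>a\<bar> \<le> f" "\<bar>b\<bar> \<le> g" "f \<le> 2 * p" "g \<le> 2 * q" "x = p + q" "0 \<le> y"
  shows "\<bar>a - b\<bar> \<le> 2 * (x + y)"
proof -
  have "\<bar>a - b\<bar> \<le> \<bar>a\<bar> + \<bar>b\<bar>" by (rule abs_triangle_ineq4)
  also have "\<dots> \<le> f + g" by (rule add_mono[OF assms(1,2)])
  finally show ?thesis using assms(3-6) by simp
qed

lemma sgn_eq_or_abs_diff: "sgn s = sgn s' \<or> \<bar>s - s'\<bar> = \<bar>s\<bar> + \<bar>s' :: real\<bar>"
  by (cases s "0::real" rule: linorder_cases; cases s' "0::real" rule: linorder_cases) auto

lemma fold_const_bounds:
  assumes "\<bar>\<sigma>\<bar> \<le> 1/4"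
  shows "0 < fold_const \<sigma> s" "fold_const \<sigma> s \<le> 2"
  using assms by (auto simp: fold_const_def divide_simps)

text \<open>\<open>fold_const\<close> jumps at \<open>s = 0\<close>, and the signs in
  \<open>shift2\<close> jump on both axes. Since \<open>fold_min\<close> vanishes there at a linear
  rate, the jumps spoil neither continuity nor the Lipschitz estimates.\<close>

lemma fold_min_bounds:
  assumes "\<bar>\<sigma>\<bar> \<le> 1/4"
  shows "0 \<le> fold_min \<sigma> s t" "fold_min \<sigma> s t \<le> 2 * \<bar>s\<bar>" "fold_min \<sigma> s t \<le> 2 * \<bar>t\<bar>"
proof -
  note k = fold_const_bounds[OF assms, of s]
  have "fold_const \<sigma> s * min (abs s) (abs t) \<le> 2 * min (abs s) (abs t)"
    using k by (intro mult_right_mono) auto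
  then show "fold_min \<sigma> s t \<le> 2 * \<bar>s\<bar>" "fold_min \<sigma> s t \<le> 2 * \<bar>t\<bar>"
    unfolding fold_min_def by linarith+
  show "0 \<le> fold_min \<sigma> s t" unfolding fold_min_def pyr_def using k by auto
qed

lemma fold_min_diff_same:
  assumes \<sigma>: "\<bar>\<sigma>\<bar> \<le> 1/4" and "(s < 0) = (s' < 0)"
  shows "\<bar>fold_min \<sigma> s t - fold_min \<sigma> s' t'\<bar> \<le> 2 * (\<bar>s - s'\<bar> + \<bar>t - t'\<bar>)"
proof -
  let ?k = "fold_const \<sigma> s"
  have k: "fold_const \<sigma> s' = ?k" using assms(2) by (simp add: fold_const_def)
  have md: "\<bar>min (abs s) (abs t) - min (abs s') (abs t')\<bar> \<le> \<bar>s - s'\<bar> + \<bar>t - t'\<bar>"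
    using min_diff[of "\<bar>s\<bar>" "\<bar>t\<bar>" "\<bar>s'\<bar>" "\<bar>t'\<bar>"] abs_triangle_ineq3[of s s'] abs_triangle_ineq3[of t t']
    by (rule order_trans[OF _ add_mono])
  have "?k * \<bar>min (abs s) (abs t) - min (abs s') (abs t')\<bar> \<le> 2 * (\<bar>s - s'\<bar> + \<bar>t - t'\<bar>)"
    by (rule mult_mono[OF fold_const_bounds(2)[OF \<sigma>] md]) (rule zero_le_numeral abs_ge_zero)+
  then have "\<bar>?k * min (abs s) (abs t) - ?k * min (abs s') (abs t')\<bar> \<le> 2 * (\<bar>s - s'\<bar> + \<bar>t - t'\<bar>)"
    by (simp only: abs_mult right_diff_distrib[symmetric] abs_of_pos[OF fold_const_bounds(1)[OF \<sigma>]])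
  moreover have "\<bar>pyr s t - pyr s' t'\<bar> \<le> 2 * (\<bar>s - s'\<bar> + \<bar>t - t'\<bar>)"
    by (rule order_trans[OF pyr_diff]) (simp add: add_nonneg_nonneg)
  ultimately show ?thesis unfolding fold_min_def k by (intro min_diff_le)
qed

lemma fold_min_diff:
  assumes \<sigma>: "\<bar>\<sigma>\<bar> \<le> 1/4"
  shows "\<bar>fold_min \<sigma> s t - fold_min \<sigma> s' t'\<bar> \<le> 2 * (\<bar>s - s'\<bar> + \<bar>t - t'\<bar>)"
proof (cases "(s < 0) = (s' < 0)")
  case True then show ?thesis by (rule fold_min_diff_same[OF \<sigma>])
next
  case False
  then have "\<bar>s - s'\<bar> = \<bar>s\<bar> + \<bar>s'\<bar>" by auto
  show ?thesis
    by (rule abs_diff_le_sum[OF _ _ fold_min_bounds(2)[OF \<sigma>, of s t] fold_min_bounds(2)[OF \<sigma>, of s' t']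
          \<open>\<bar>s - s'\<bar> = \<bar>s\<bar> + \<bar>s'\<bar>\<close> abs_ge_zero])
      (simp_all add: fold_min_bounds[OF \<sigma>])
qed

lemma shift1_diff:
  assumes "\<bar>\<sigma>\<bar> \<le> 1/4"
  shows "\<bar>shift1 \<sigma> s t - shift1 \<sigma> s' t'\<bar> \<le> 4 * (\<bar>s - s'\<bar> + \<bar>t - t'\<bar>)"
proof -
  have *: "\<bar>p - p'\<bar> \<le> x \<Longrightarrow> \<bar>f - f'\<bar> \<le> 2 * x \<Longrightarrow> \<bar>2 * p - f - (2 * p' - f')\<bar> \<le> 4 * x"
    for p p' f f' x :: real by linarith
  show ?thesis unfolding shift1_def by (rule *[OF pyr_diff fold_min_diff[OF assms]])
qed

lemma shift2_diff:
  assumes \<sigma>: "\<bar>\<sigma>\<bar> \<le> 1/4"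
  shows "\<bar>shift2 \<sigma> s t - shift2 \<sigma> s' t'\<bar> \<le> 2 * (\<bar>s - s'\<bar> + \<bar>t - t'\<bar>)"
proof -
  note b = fold_min_bounds[OF \<sigma>, of s t] fold_min_bounds[OF \<sigma>, of s' t']
  have a: "\<bar>shift2 \<sigma> s t\<bar> \<le> fold_min \<sigma> s t" "\<bar>shift2 \<sigma> s' t'\<bar> \<le> fold_min \<sigma> s' t'"
    using b(1,4) by (simp_all add: shift2_def abs_mult abs_sgn_eq fold_min_bounds(1)[OF \<sigma>])
  consider "sgn s = sgn s'" "sgn t = sgn t'" | "\<bar>s - s'\<bar> = \<bar>s\<bar> + \<bar>s'\<bar>" | "\<bar>t - t'\<bar> = \<bar>t\<bar> + \<bar>t'\<bar>"
    using sgn_eq_or_abs_diff by blast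
  then show ?thesis
  proof cases
    case 1
    have "\<bar>shift2 \<sigma> s t - shift2 \<sigma> s' t'\<bar> = \<bar>sgn s * sgn t\<bar> * \<bar>fold_min \<sigma> s t - fold_min \<sigma> s' t'\<bar>"
      by (simp only: shift2_def 1 right_diff_distrib[symmetric] abs_mult)
    also have "\<dots> \<le> \<bar>fold_min \<sigma> s t - fold_min \<sigma> s' t'\<bar>"
      using abs_sgn_eq_1
      by (cases "s = 0 \<or> t = 0") (auto simp: abs_mult abs_sgn_eq)
    also have "\<dots> \<le> 2 * (\<bar>s - s'\<bar> + \<bar>t - t'\<bar>)" by (rule fold_min_diff[OF \<sigma>])
    finally show ?thesis .
  next
    case 2
    show ?thesis by (rule abs_diff_le_sum[OF a b(2) b(5) 2 abs_ge_zero])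
  next
    case 3
    have "\<bar>shift2 \<sigma> s t - shift2 \<sigma> s' t'\<bar> \<le> 2 * (\<bar>t - t'\<bar> + \<bar>s - s'\<bar>)"
      by (rule abs_diff_le_sum[OF a b(3) b(6) 3 abs_ge_zero])
    then show ?thesis by (simp only: add.commute)
  qed
qed

text \<open>The model map carried to the box with centre \<open>m\<close> and half side lengths
  \<open>w\<close>, which is halved across axis \<open>i\<close>. A positive \<open>\<sigma>\<close>
  enlarges the lower half.\<close>

definition half_map :: "real \<Rightarrow> 2 \<Rightarrow> real^2 \<Rightarrow> real^2 \<Rightarrow> real^2 \<Rightarrow> real^2" where
  "half_map \<sigma> i m w z =
    (let s = (z $ i - m $ i) / w $ i; t = (z $ (i + 1) - m $ (i + 1)) / w $ (i + 1)
     in z + (\<chi> j. if j = i then \<sigma> * w $ i * shift1 \<sigma> s t else \<sigma> * w $ (i + 1) * shift2 \<sigma> s t))"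

text \<open>Undoing the rescaling costs a factor governed by the aspect ratio 2 of the box, whence
  the bound 3 in \<open>q1\<close> and \<open>q2\<close>. The two components of the displacement
  then have constants \<open>12 * e\<close> and \<open>6 * e\<close>. Their sum
  \<open>18 * e\<close> is at most 1/2 for \<open>e\<close> up to 1/40, and the two-sided estimate
  for a perturbation of the identity doubles it to \<open>36 * e\<close>.\<close>

lemma half_map_bilip:
  fixes m w :: "real^2"
  assumes \<sigma>: "\<bar>\<sigma>\<bar> \<le> e" "e \<le> 1/40" and w: "0 < w $ i" "0 < w $ (i + 1)"
    and r: "w $ i \<le> 2 * w $ (i + 1)" "w $ (i + 1) \<le> 2 * w $ i"
  shows "\<exists>G. bilip (1 + 36 * e) (half_map \<sigma> i m w) G"
proof -
  define S where "S = (\<lambda>z::real^2. (z $ i - m $ i) / w $ i)"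
  define T where "T = (\<lambda>z::real^2. (z $ (i + 1) - m $ (i + 1)) / w $ (i + 1))"
  define v where "v = (\<lambda>z. (\<chi> j. if j = i then \<sigma> * w $ i * shift1 \<sigma> (S z) (T z)
                                   else \<sigma> * w $ (i + 1) * shift2 \<sigma> (S z) (T z)) :: real^2)"
  have \<sigma>4: "\<bar>\<sigma>\<bar> \<le> 1/4" using \<sigma> by linarith
  have e0: "0 \<le> e" using \<sigma> by linarith
  have "(18 * e)-lipschitz_on UNIV v"
  proof (rule lipschitz_onI)
    fix x y :: "real^2"
    let ?n = "norm (x - y)"
    have xi: "\<bar>x $ i - y $ i\<bar> \<le> ?n" "\<bar>x $ (i + 1) - y $ (i + 1)\<bar> \<le> ?n"
      using component_le_norm_cart[of "x - y"] by (simp_all flip: vector_minus_component)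
    have dS: "\<bar>S x - S y\<bar> = \<bar>x $ i - y $ i\<bar> / w $ i"
      using w by (simp add: S_def diff_divide_distrib[symmetric])
    have dT: "\<bar>T x - T y\<bar> = \<bar>x $ (i + 1) - y $ (i + 1)\<bar> / w $ (i + 1)"
      using w by (simp add: T_def diff_divide_distrib[symmetric])
    have q1: "w $ i * (\<bar>S x - S y\<bar> + \<bar>T x - T y\<bar>) \<le> 3 * ?n"
    proof -
      have "w $ i * \<bar>T x - T y\<bar> \<le> 2 * w $ (i + 1) * \<bar>T x - T y\<bar>"
        using r by (intro mult_right_mono) auto
      then show ?thesis using xi w dS dT by (simp add: algebra_simps)
    qed
    have q2: "w $ (i + 1) * (\<bar>S x - S y\<bar> + \<bar>T x - T y\<bar>) \<le> 3 * ?n"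
    proof -
      have "w $ (i + 1) * \<bar>S x - S y\<bar> \<le> 2 * w $ i * \<bar>S x - S y\<bar>"
        using r by (intro mult_right_mono) auto
      then show ?thesis using xi w dS dT by (simp add: algebra_simps)
    qed
    have "\<bar>(v x - v y) $ i\<bar> = \<bar>\<sigma>\<bar> * (w $ i * \<bar>shift1 \<sigma> (S x) (T x) - shift1 \<sigma> (S y) (T y)\<bar>)"
      using w by (simp add: v_def right_diff_distrib[symmetric] abs_mult)
    also have "\<dots> \<le> e * (w $ i * (4 * (\<bar>S x - S y\<bar> + \<bar>T x - T y\<bar>)))"
      using w \<sigma> e0 by (intro mult_mono shift1_diff[OF \<sigma>4]) auto
    also have "\<dots> = 4 * (e * (w $ i * (\<bar>S x - S y\<bar> + \<bar>T x - T y\<bar>)))" by simp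
    also have "\<dots> \<le> 4 * (e * (3 * ?n))" using q1 e0 by (intro mult_left_mono) auto
    finally have 1: "\<bar>(v x - v y) $ i\<bar> \<le> 12 * e * ?n" by simp
    have "\<bar>(v x - v y) $ (i + 1)\<bar> = \<bar>\<sigma>\<bar> * (w $ (i + 1) * \<bar>shift2 \<sigma> (S x) (T x) - shift2 \<sigma> (S y) (T y)\<bar>)"
      using w two_axes(1)[of i] by (simp add: v_def right_diff_distrib[symmetric] abs_mult)
    also have "\<dots> \<le> e * (w $ (i + 1) * (2 * (\<bar>S x - S y\<bar> + \<bar>T x - T y\<bar>)))"
      using w \<sigma> e0 by (intro mult_mono shift2_diff[OF \<sigma>4]) auto
    also have "\<dots> = 2 * (e * (w $ (i + 1) * (\<bar>S x - S y\<bar> + \<bar>T x - T y\<bar>)))" by simp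
    also have "\<dots> \<le> 2 * (e * (3 * ?n))" using q2 e0 by (intro mult_left_mono) auto
    finally have 2: "\<bar>(v x - v y) $ (i + 1)\<bar> \<le> 6 * e * ?n" by simp
    show "dist (v x) (v y) \<le> 18 * e * dist x y"
      using 1 2 norm_le_axes[of "v x - v y" i] unfolding dist_norm by linarith
  qed (use e0 in simp)
  then have "\<exists>G. bilip (1 + 2 * (18 * e)) (\<lambda>z. z + v z) G"
    using \<sigma> e0 by (intro bilip_id_plus_contraction) auto
  moreover have "(\<lambda>z. z + v z) = half_map \<sigma> i m w"
    by (rule ext) (simp add: half_map_def v_def S_def T_def Let_def cong: if_cong)
  ultimately show ?thesis by simp
qed

lemma half_map_outside:
  assumes \<sigma>: "\<bar>\<sigma>\<bar> \<le> 1/4" and w: "0 < w $ i" "0 < w $ (i + 1)" and z: "z \<notin> box (m - w) (m + w)"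
  shows "half_map \<sigma> i m w z = z"
proof -
  define s where "s = (z $ i - m $ i) / w $ i"
  define t where "t = (z $ (i + 1) - m $ (i + 1)) / w $ (i + 1)"
  have "1 \<le> \<bar>s\<bar> \<or> 1 \<le> \<bar>t\<bar>"
    using z w unfolding mem_box_cart all_axes[of _ i] s_def t_def
    by (auto simp: abs_if divide_simps split: if_splits)
  then have "pyr s t = 0" by (auto simp: pyr_def)
  moreover from this have "fold_min \<sigma> s t = 0"
    using fold_const_bounds[OF \<sigma>, of s] by (simp add: fold_min_def)
  ultimately show ?thesis
    unfolding half_map_def s_def[symmetric] t_def[symmetric]
    by (simp add: shift1_def shift2_def vec_eq_iff)
qed

section \<open>The area factors of the two halves\<close>

text \<open>The side lengths cancel in the product of the off-diagonal entries, so the Jacobian may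
  be computed in the normalised coordinates \<open>s\<close> and \<open>t\<close>.\<close>

lemma half_map_leaf:
  fixes g :: "real^2 \<Rightarrow> real^2"
  assumes S: "S \<in> lmeasurable" and w: "0 < w $ i" "0 < w $ (i + 1)"
    and g: "\<And>z s t. z \<in> S \<Longrightarrow> s = (z $ i - m $ i) / w $ i \<Longrightarrow> t = (z $ (i + 1) - m $ (i + 1)) / w $ (i + 1) \<Longrightarrow>
         g z $ i = z $ i + w $ i * (\<alpha> * s + \<beta> * t + c) \<and>
         g z $ (i + 1) = z $ (i + 1) + w $ (i + 1) * (\<gamma> * s + \<eta> * t + d)"
    and det: "(1 + \<alpha>) * (1 + \<eta>) - \<beta> * \<gamma> = D" "0 \<le> D"
  shows "leb (g ` S) = D * leb S"
proof -
  let ?j = "i + 1"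
  have "leb (g ` S) =
      \<bar>(1 + \<alpha>) * (1 + \<eta>) - (\<beta> * w $ i / w $ ?j) * (\<gamma> * w $ ?j / w $ i)\<bar> * leb S"
  proof (rule affine_image_measure[OF S, where i = i])
    fix z assume z: "z \<in> S"
    note gz = g[OF z refl refl]
    show "g z $ i = (1 + \<alpha>) * z $ i + (\<beta> * w $ i / w $ ?j) * z $ ?j
        + w $ i * (c - \<alpha> * m $ i / w $ i - \<beta> * m $ ?j / w $ ?j)"
      unfolding gz[THEN conjunct1] gz[THEN conjunct2] using w by (simp add: field_simps)
    show "g z $ ?j = (\<gamma> * w $ ?j / w $ i) * z $ i + (1 + \<eta>) * z $ ?j
        + w $ ?j * (d - \<gamma> * m $ i / w $ i - \<eta> * m $ ?j / w $ ?j)"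
      unfolding gz[THEN conjunct1] gz[THEN conjunct2] using w by (simp add: field_simps)
  qed
  also have "(\<beta> * w $ i / w $ ?j) * (\<gamma> * w $ ?j / w $ i) = \<beta> * \<gamma>"
    using w by simp
  finally show ?thesis using det by simp
qed

text \<open>The signs \<open>\<epsilon>\<close> and \<open>\<delta>\<close> name a quarter of the
  box, so that one calculation serves all four. On the axes, where \<open>sgn\<close> is 0, the
  formula for \<open>shift2\<close> survives because \<open>fold_min\<close> vanishes.\<close>

lemma shift_values:
  assumes \<sigma>: "\<bar>\<sigma>\<bar> \<le> 1/4" and \<epsilon>: "\<epsilon> = 1 \<and> 0 \<le> s \<or> \<epsilon> = -1 \<and> s < 0" and \<delta>: "\<delta> = 1 \<or> \<delta> = (-1::real)" "0 \<le> \<delta> * t"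
    and st: "\<bar>s\<bar> \<le> 1" "\<bar>t\<bar> \<le> 1"
    and P: "P = min (1 - \<epsilon> * s) (1 - \<delta> * t)" and Q: "Q = 1 / (1 - 2 * \<epsilon> * \<sigma>) * min (\<epsilon> * s) (\<delta> * t)"
  shows "shift1 \<sigma> s t = 2 * P - min P Q" "shift2 \<sigma> s t = \<epsilon> * \<delta> * min P Q"
proof -
  have as: "\<bar>s\<bar> = \<epsilon> * s" "\<bar>t\<bar> = \<delta> * t" using \<epsilon> \<delta> by auto
  have p: "pyr s t = P" using st unfolding pyr_def P as by auto
  have k: "fold_const \<sigma> s = 1 / (1 - 2 * \<epsilon> * \<sigma>)" using \<epsilon> by (auto simp: fold_const_def)
  have f: "fold_min \<sigma> s t = min P Q" unfolding fold_min_def p k Q as ..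
  show "shift1 \<sigma> s t = 2 * P - min P Q" by (simp add: shift1_def p f)
  show "shift2 \<sigma> s t = \<epsilon> * \<delta> * min P Q"
  proof (cases "s = 0 \<or> t = 0")
    case True
    then have "fold_min \<sigma> s t = 0" using fold_min_bounds[OF \<sigma>, of s t] by auto
    then show ?thesis using f by (simp add: shift2_def)
  next
    case False
    then have "sgn s = \<epsilon>" "sgn t = \<delta>" using \<epsilon> \<delta> by (auto simp: sgn_if zero_le_mult_iff)
    then show ?thesis by (simp add: shift2_def f)
  qed
qed

lemma half_map_measure_quadrant:
  fixes m w :: "real^2"
  assumes \<sigma>: "\<bar>\<sigma>\<bar> \<le> 1/40" and w: "0 < w $ i" "0 < w $ (i + 1)"
    and bl: "bilip L (half_map \<sigma> i m w) G"
    and A: "A \<in> sets borel" "A \<subseteq> cbox (m - w) (m + w)"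
    and \<epsilon>: "\<epsilon> = 1 \<or> \<epsilon> = (-1::real)" and \<delta>: "\<delta> = 1 \<or> \<delta> = (-1::real)"
    and half: "\<And>z. z \<in> A \<Longrightarrow> if \<epsilon> = 1 then m $ i \<le> z $ i else z $ i < m $ i"
    and side: "\<And>z. z \<in> A \<Longrightarrow> 0 \<le> \<delta> * (z $ (i + 1) - m $ (i + 1))"
  shows "leb (half_map \<sigma> i m w ` A) = (1 - \<epsilon> * \<sigma>) * leb A"
proof -
  let ?g = "half_map \<sigma> i m w"
  define S where "S = (\<lambda>z::real^2. (z $ i - m $ i) / w $ i)"
  define T where "T = (\<lambda>z::real^2. (z $ (i + 1) - m $ (i + 1)) / w $ (i + 1))"
  define k where "k = 1 / (1 - 2 * \<epsilon> * \<sigma>)"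
  define P where "P = (\<lambda>z. min (1 - \<epsilon> * S z) (1 - \<delta> * T z))"
  define Q where "Q = (\<lambda>z. k * min (\<epsilon> * S z) (\<delta> * T z))"
  have cS: "continuous_on UNIV S" "continuous_on UNIV T"
    using w unfolding S_def T_def by (auto intro!: continuous_intros)
  have \<epsilon>2: "\<epsilon> * \<epsilon> = 1" and \<delta>2: "\<delta> * \<delta> = 1" using \<epsilon> \<delta> by auto
  have es: "\<bar>\<epsilon> * \<sigma>\<bar> \<le> 1/40" using \<sigma> \<epsilon> by (auto simp: abs_mult)
  have kk: "k * (1 - 2 * \<epsilon> * \<sigma>) = 1" using es unfolding k_def by (auto simp: mult.assoc)
  have bA: "bounded A" using A(2) bounded_cbox bounded_subset by blast
  have g: "?g z $ i = z $ i + w $ i * (\<sigma> * (2 * P z - min (P z) (Q z)))"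
          "?g z $ (i + 1) = z $ (i + 1) + w $ (i + 1) * (\<sigma> * (\<epsilon> * \<delta> * min (P z) (Q z)))"
    if z: "z \<in> A" for z
  proof -
    have 1: "\<epsilon> = 1 \<and> 0 \<le> S z \<or> \<epsilon> = -1 \<and> S z < 0"
      using half[OF z] \<epsilon> w by (auto simp: S_def divide_simps split: if_splits)
    have 2: "0 \<le> \<delta> * T z" using side[OF z] w unfolding T_def
      by (simp add: zero_le_divide_iff)
    have 3: "\<bar>S z\<bar> \<le> 1" "\<bar>T z\<bar> \<le> 1"
      using A(2) z w unfolding subset_iff mem_box_cart all_axes[of _ i] S_def T_def
      by (auto simp: abs_le_iff divide_simps algebra_simps)
    have 4: "\<bar>\<sigma>\<bar> \<le> 1/4" using \<sigma> by linarith
    have *: "shift1 \<sigma> (S z) (T z) = 2 * P z - min (P z) (Q z)" "shift2 \<sigma> (S z) (T z) = \<epsilon> * \<delta> * min (P z) (Q z)"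
      using shift_values[OF 4 1 \<delta> 2 3 refl refl] by (simp_all only: P_def Q_def k_def)
    show "?g z $ i = z $ i + w $ i * (\<sigma> * (2 * P z - min (P z) (Q z)))"
      using *(1) by (simp add: half_map_def S_def T_def Let_def)
    show "?g z $ (i + 1) = z $ (i + 1) + w $ (i + 1) * (\<sigma> * (\<epsilon> * \<delta> * min (P z) (Q z)))"
      using *(2) two_axes(1)[of i] by (simp add: half_map_def S_def T_def Let_def)
  qed
  have D0: "0 \<le> 1 - \<epsilon> * \<sigma>" using es by linarith
  have leaf: "leb (?g ` B) = (1 - \<epsilon> * \<sigma>) * leb B"
    if B: "B \<in> sets borel" "B \<subseteq> A"
      and v: "\<And>z. z \<in> B \<Longrightarrow> \<sigma> * (2 * P z - min (P z) (Q z)) = \<alpha> * S z + \<beta> * T z + c"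
        "\<And>z. z \<in> B \<Longrightarrow> \<sigma> * (\<epsilon> * \<delta> * min (P z) (Q z)) = \<gamma> * S z + \<eta> * T z + d"
      and det: "(1 + \<alpha>) * (1 + \<eta>) - \<beta> * \<gamma> = 1 - \<epsilon> * \<sigma>"
    for B \<alpha> \<beta> c \<gamma> \<eta> d
  proof (rule half_map_leaf[OF _ w _ det D0])
    show "B \<in> lmeasurable" using B bA by (intro lmeasurable_borel) (auto intro: bounded_subset)
    fix z s t assume "z \<in> B" "s = (z $ i - m $ i) / w $ i" "t = (z $ (i + 1) - m $ (i + 1)) / w $ (i + 1)"
    then show "?g z $ i = z $ i + w $ i * (\<alpha> * s + \<beta> * t + c) \<and>
         ?g z $ (i + 1) = z $ (i + 1) + w $ (i + 1) * (\<gamma> * s + \<eta> * t + d)"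
      using g[of z] v[of z] B(2) unfolding S_def T_def by auto
  qed
  \<comment> \<open>\<open>X\<close> cuts the quarter along its diagonal through the centre of the
    box, and \<open>W\<close> separates the triangles on the outer edges from those on the centre
    lines. The four combinations are the affine pieces.\<close>
  define X where "X = {z. \<delta> * T z \<le> \<epsilon> * S z}"
  define W where "W = {z. P z \<le> Q z}"
  have X: "X \<in> sets borel" unfolding X_def
    by (intro borel_closed closed_Collect_le continuous_intros cS)
  have W: "W \<in> sets borel" unfolding W_def P_def Q_def
    by (intro borel_closed closed_Collect_le continuous_intros cS)
  show ?thesis
  proof (rule measure_image_split[OF bl A(1) bA X])
    show "leb (?g ` (A \<inter> X)) = (1 - \<epsilon> * \<sigma>) * leb (A \<inter> X)"
    proof (rule measure_image_split[OF bl _ _ W])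
      show "leb (?g ` (A \<inter> X \<inter> W)) = (1 - \<epsilon> * \<sigma>) * leb (A \<inter> X \<inter> W)"
      proof (rule leaf[where \<alpha> = "- \<epsilon> * \<sigma>" and \<beta> = 0 and c = \<sigma> and \<gamma> = "- \<delta> * \<sigma>" and \<eta> = 0 and d = "\<epsilon> * \<delta> * \<sigma>"])
        fix z assume "z \<in> A \<inter> X \<inter> W"
        then have q: "min (P z) (Q z) = P z" "P z = 1 - \<epsilon> * S z" by (auto simp: X_def W_def P_def)
        show "\<sigma> * (2 * P z - min (P z) (Q z)) = - \<epsilon> * \<sigma> * S z + 0 * T z + \<sigma>"
          "\<sigma> * (\<epsilon> * \<delta> * min (P z) (Q z)) = - \<delta> * \<sigma> * S z + 0 * T z + \<epsilon> * \<delta> * \<sigma>"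
          unfolding q(1) unfolding q(2) using \<epsilon> by (auto simp: algebra_simps)
      qed (use A X W in auto)
      show "leb (?g ` (A \<inter> X - W)) = (1 - \<epsilon> * \<sigma>) * leb (A \<inter> X - W)"
      proof (rule leaf[where \<alpha> = "- 2 * \<epsilon> * \<sigma>" and \<beta> = "- \<sigma> * k * \<delta>" and c = "2 * \<sigma>" and \<gamma> = 0 and \<eta> = "\<sigma> * \<epsilon> * k" and d = 0])
        fix z assume "z \<in> A \<inter> X - W"
        then have q: "min (P z) (Q z) = k * \<delta> * T z" "P z = 1 - \<epsilon> * S z" by (auto simp: X_def W_def P_def Q_def)
        show "\<sigma> * (2 * P z - min (P z) (Q z)) = - 2 * \<epsilon> * \<sigma> * S z + - \<sigma> * k * \<delta> * T z + 2 * \<sigma>"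
          "\<sigma> * (\<epsilon> * \<delta> * min (P z) (Q z)) = 0 * S z + \<sigma> * \<epsilon> * k * T z + 0"
          unfolding q(1) unfolding q(2) using \<delta> by (auto simp: algebra_simps)
      next
        \<comment> \<open>The value of \<open>k\<close> is chosen so that this inner triangle gets
          the same factor as the outer ones.\<close>
        show "(1 + - 2 * \<epsilon> * \<sigma>) * (1 + \<sigma> * \<epsilon> * k) - - \<sigma> * k * \<delta> * 0 = 1 - \<epsilon> * \<sigma>"
          using kk by algebra
      qed (use A X W in auto)
    qed (use A X bA in \<open>auto intro: bounded_subset\<close>)
    show "leb (?g ` (A - X)) = (1 - \<epsilon> * \<sigma>) * leb (A - X)"
    proof (rule measure_image_split[OF bl _ _ W])
      show "leb (?g ` ((A - X) \<inter> W)) = (1 - \<epsilon> * \<sigma>) * leb ((A - X) \<inter> W)"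
      proof (rule leaf[where \<alpha> = 0 and \<beta> = "- \<sigma> * \<delta>" and c = \<sigma> and \<gamma> = 0 and \<eta> = "- \<epsilon> * \<sigma>" and d = "\<epsilon> * \<delta> * \<sigma>"])
        fix z assume "z \<in> (A - X) \<inter> W"
        then have q: "min (P z) (Q z) = P z" "P z = 1 - \<delta> * T z" by (auto simp: X_def W_def P_def)
        show "\<sigma> * (2 * P z - min (P z) (Q z)) = 0 * S z + - \<sigma> * \<delta> * T z + \<sigma>"
          "\<sigma> * (\<epsilon> * \<delta> * min (P z) (Q z)) = 0 * S z + - \<epsilon> * \<sigma> * T z + \<epsilon> * \<delta> * \<sigma>"
          unfolding q(1) unfolding q(2) using \<delta> by (auto simp: algebra_simps)
      qed (use A X W in auto)
      show "leb (?g ` (A - X - W)) = (1 - \<epsilon> * \<sigma>) * leb (A - X - W)"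
      proof (rule leaf[where \<alpha> = "- \<sigma> * k * \<epsilon>" and \<beta> = "- 2 * \<sigma> * \<delta>" and c = "2 * \<sigma>" and \<gamma> = "\<sigma> * \<delta> * k" and \<eta> = 0 and d = 0])
        fix z assume "z \<in> A - X - W"
        then have q: "min (P z) (Q z) = k * \<epsilon> * S z" "P z = 1 - \<delta> * T z" by (auto simp: X_def W_def P_def Q_def)
        show "\<sigma> * (2 * P z - min (P z) (Q z)) = - \<sigma> * k * \<epsilon> * S z + - 2 * \<sigma> * \<delta> * T z + 2 * \<sigma>"
          "\<sigma> * (\<epsilon> * \<delta> * min (P z) (Q z)) = \<sigma> * \<delta> * k * S z + 0 * T z + 0"
          unfolding q(1) unfolding q(2) using \<epsilon> by (auto simp: algebra_simps)
      next
        show "(1 + - \<sigma> * k * \<epsilon>) * (1 + 0) - - 2 * \<sigma> * \<delta> * (\<sigma> * \<delta> * k) = 1 - \<epsilon> * \<sigma>"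
          using kk \<epsilon>2 \<delta>2 by algebra
      qed (use A X W in auto)
    qed (use A X bA in \<open>auto intro: bounded_subset\<close>)
  qed
qed

lemma half_map_measure:
  fixes m w :: "real^2"
  assumes \<sigma>: "\<bar>\<sigma>\<bar> \<le> 1/40" and w: "0 < w $ i" "0 < w $ (i + 1)"
    and bl: "bilip L (half_map \<sigma> i m w) G"
    and A: "A \<in> sets borel" "A \<subseteq> cbox (m - w) (m + w)"
    and \<epsilon>: "\<epsilon> = 1 \<or> \<epsilon> = (-1::real)"
    and half: "\<And>z. z \<in> A \<Longrightarrow> if \<epsilon> = 1 then m $ i \<le> z $ i else z $ i < m $ i"
  shows "leb (half_map \<sigma> i m w ` A) = (1 - \<epsilon> * \<sigma>) * leb A"
proof (rule measure_image_split[OF bl A(1), where P = "{z. m $ (i + 1) \<le> z $ (i + 1)}"])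
  show bA: "bounded A" using A(2) bounded_cbox bounded_subset by blast
  show P: "{z::real^2. m $ (i + 1) \<le> z $ (i + 1)} \<in> sets borel"
    by (intro borel_closed closed_Collect_le continuous_intros)
  show "leb (half_map \<sigma> i m w ` (A \<inter> {z. m $ (i + 1) \<le> z $ (i + 1)})) =
      (1 - \<epsilon> * \<sigma>) * leb (A \<inter> {z. m $ (i + 1) \<le> z $ (i + 1)})"
    by (rule half_map_measure_quadrant[OF \<sigma> w bl _ _ \<epsilon>, where \<delta> = 1]) (use A P half in auto)
  show "leb (half_map \<sigma> i m w ` (A - {z. m $ (i + 1) \<le> z $ (i + 1)})) =
      (1 - \<epsilon> * \<sigma>) * leb (A - {z. m $ (i + 1) \<le> z $ (i + 1)})"
    by (rule half_map_measure_quadrant[OF \<sigma> w bl _ _ \<epsilon>, where \<delta> = "-1"]) (use A P half in auto)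
qed

section \<open>Equalizing the density of a point set\<close>

text \<open>A segment between the two sides crosses the hyperplane at a point where \<open>f\<close>
  and \<open>g\<close> agree, and its two parts add up to its length. Hence the constant does not
  grow, however many levels are glued.\<close>

lemma lipschitz_on_glue_halfspaces:
  fixes f g :: "real^'n \<Rightarrow> 'b::real_normed_vector"
  assumes f: "L-lipschitz_on UNIV f" and g: "L-lipschitz_on UNIV g"
    and eq: "\<And>z. z $ i = c \<Longrightarrow> f z = g z"
  shows "L-lipschitz_on UNIV (\<lambda>z. if z $ i \<le> c then f z else g z)"
proof (rule lipschitz_onI)
  let ?h = "\<lambda>z. if z $ i \<le> c then f z else g z"
  have cross: "dist (f p) (g r) \<le> L * dist p r" if "p $ i \<le> c" "c < r $ i" for p r
  proof -
    define u where "u = (c - p $ i) / (r $ i - p $ i)"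
    have u: "0 \<le> u" "u \<le> 1" using that by (auto simp: u_def divide_simps)
    define q where "q = p + u *\<^sub>R (r - p)"
    have "u * (r $ i - p $ i) = c - p $ i" using that by (simp add: u_def)
    then have "q $ i = c" by (simp add: q_def)
    then have "dist (f p) (g r) \<le> dist (f p) (f q) + dist (g q) (g r)"
      using eq[of q] by (metis dist_triangle)
    also have "\<dots> \<le> L * dist p q + L * dist q r"
      using lipschitz_onD[OF f] lipschitz_onD[OF g] by (intro add_mono) auto
    also have "\<dots> = L * (dist p q + dist q r)" by (simp add: algebra_simps)
    also have "dist p q = u * dist p r"
      using u by (simp add: q_def dist_norm norm_minus_commute)
    also have "q - r = (1 - u) *\<^sub>R (p - r)" by (simp add: q_def algebra_simps)
    then have "dist q r = (1 - u) * dist p r"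
      using u by (simp add: dist_norm)
    finally show ?thesis by (simp add: algebra_simps)
  qed
  show "dist (?h x) (?h y) \<le> L * dist x y" for x y
    using cross[of x y] cross[of y x] lipschitz_onD[OF f, of x y] lipschitz_onD[OF g, of x y]
    by (auto simp: dist_commute)
  show "0 \<le> L" using f lipschitz_on_nonneg by blast
qed

text \<open>If \<open>F z\<close> left \<open>U\<close>, it would be fixed by \<open>F\<close>, and
  injectivity would give \<open>F z = z\<close>.\<close>

lemma bilip_maps_support:
  assumes "bilip L F G" "\<And>z. z \<notin> U \<Longrightarrow> F z = z" "z \<in> U"
  shows "F z \<in> U"
  using assms unfolding bilip_def by metis

text \<open>Each map is the identity on the opposite closed half-space, so by injectivity it
  preserves its own open half-space. Therefore the inverses glue in the same way.\<close>

lemma bilip_glue_halfspaces: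
  fixes F1 :: "real^'n \<Rightarrow> real^'n"
  assumes 1: "bilip L F1 G1" "\<And>z. c \<le> z $ i \<Longrightarrow> F1 z = z"
    and 2: "bilip L F2 G2" "\<And>z. z $ i \<le> c \<Longrightarrow> F2 z = z"
  shows "\<exists>G. bilip L (\<lambda>z. if z $ i \<le> c then F1 z else F2 z) G"
proof -
  have G1: "G1 z = z" if "c \<le> z $ i" for z using 1(1) 1(2)[OF that] unfolding bilip_def by metis
  have G2: "G2 z = z" if "z $ i \<le> c" for z using 2(1) 2(2)[OF that] unfolding bilip_def by metis
  have side: "F1 z $ i < c" "G1 z $ i < c" if "z $ i < c" for z
  proof -
    have "F1 (F1 z) \<noteq> F1 z \<or> F1 z = z" "G1 (G1 z) \<noteq> G1 z \<or> G1 z = z"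
      using 1(1) unfolding bilip_def by metis+
    then show "F1 z $ i < c" "G1 z $ i < c" using 1(2)[of "F1 z"] G1[of "G1 z"] that by force+
  qed
  have side2: "c < F2 z $ i" "c < G2 z $ i" if "c < z $ i" for z
  proof -
    have "F2 (F2 z) \<noteq> F2 z \<or> F2 z = z" "G2 (G2 z) \<noteq> G2 z \<or> G2 z = z"
      using 2(1) unfolding bilip_def by metis+
    then show "c < F2 z $ i" "c < G2 z $ i" using 2(2)[of "F2 z"] G2[of "G2 z"] that by force+
  qed
  let ?F = "\<lambda>z. if z $ i \<le> c then F1 z else F2 z"
  let ?G = "\<lambda>z. if z $ i \<le> c then G1 z else G2 z"
  have "L-lipschitz_on UNIV ?F"
    using 1 2 unfolding bilip_def by (intro lipschitz_on_glue_halfspaces) auto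
  moreover have "L-lipschitz_on UNIV ?G"
    using 1 2 G1 G2 unfolding bilip_def by (intro lipschitz_on_glue_halfspaces) auto
  moreover have "?F (?G z) = z \<and> ?G (?F z) = z" for z
  proof (cases "z $ i" c rule: linorder_cases)
    case less
    then show ?thesis using side[of z] 1(1) unfolding bilip_def by auto
  next
    case equal
    then show ?thesis using 1(2)[of z] G1[of z] by auto
  next
    case greater
    then show ?thesis using side2[of z] 2(1) unfolding bilip_def by auto
  qed
  ultimately have "bilip L ?F ?G" unfolding bilip_def by blast
  then show ?thesis by blast
qed

section \<open>Dyadic boxes and the recursive construction\<close>

text \<open>Halving a box of level \<open>Suc k\<close> along its axis \<open>i\<close> gives two boxes of level \<open>k\<close> for the other
  axis, because \<open>i + 1\<close> is the other element of the two-element index type.\<close>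

definition dyadic_box :: "real \<Rightarrow> nat \<Rightarrow> 2 \<Rightarrow> real^2 \<Rightarrow> real^2 \<Rightarrow> bool" where
  "dyadic_box h k i a b \<longleftrightarrow>
     b $ i - a $ i = h * 2 ^ (Suc k div 2) \<and> b $ (i + 1) - a $ (i + 1) = h * 2 ^ (k div 2)"

definition pts :: "'a set \<Rightarrow> 'a set \<Rightarrow> real" where
  "pts Y A = real (card (Y \<inter> A))"

lemma bisect_box:
  fixes a b :: "real^2"
  assumes ab: "a $ i < b $ i" "a $ (i + 1) < b $ (i + 1)" and c: "c = (a $ i + b $ i) / 2"
    and b1: "b1 = (\<chi> j. if j = i then c else b $ j)" and a2: "a2 = (\<chi> j. if j = i then c else a $ j)"
  shows "hbox a b1 = hbox a b \<inter> {z. z $ i < c}" "hbox a2 b = hbox a b \<inter> {z. c \<le> z $ i}"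
    and "leb (hbox a b1) = leb (hbox a b) / 2"
    and "leb (hbox a2 b) = leb (hbox a b) / 2"
    and "finite (Y \<inter> hbox a b) \<Longrightarrow> pts Y (hbox a b) = pts Y (hbox a b1) + pts Y (hbox a2 b)"
    and "dyadic_box h (Suc k) i a b \<Longrightarrow> dyadic_box h k (i + 1) a b1 \<and> dyadic_box h k (i + 1) a2 b"
proof -
  note ax = two_axes(1)[of i]
  show sub: "hbox a b1 = hbox a b \<inter> {z. z $ i < c}" "hbox a2 b = hbox a b \<inter> {z. c \<le> z $ i}"
    using ab ax unfolding hbox_def all_axes[of _ i] by (auto simp: b1 a2 c)
  have comp: "b1 $ i = c" "b1 $ (i + 1) = b $ (i + 1)" "a2 $ i = c" "a2 $ (i + 1) = a $ (i + 1)"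
    using ax by (simp_all add: b1 a2)
  have cb: "a $ i \<le> c" "c \<le> b $ i" "c - a $ i = (b $ i - a $ i) / 2" "b $ i - c = (b $ i - a $ i) / 2"
    using ab by (simp_all add: c field_simps)
  show "leb (hbox a b1) = leb (hbox a b) / 2"
    "leb (hbox a2 b) = leb (hbox a b) / 2"
    using measure_hbox2[of a i b] measure_hbox2[of a i b1] measure_hbox2[of a2 i b] ab cb
    unfolding comp by simp_all
  show "pts Y (hbox a b) = pts Y (hbox a b1) + pts Y (hbox a2 b)" if fin: "finite (Y \<inter> hbox a b)"
  proof -
    have "Y \<inter> hbox a b = (Y \<inter> hbox a b1) \<union> (Y \<inter> hbox a2 b)"
      "(Y \<inter> hbox a b1) \<inter> (Y \<inter> hbox a2 b) = {}" unfolding sub by auto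
    then show ?thesis using fin unfolding pts_def by (simp add: card_Un_disjoint)
  qed
  show "dyadic_box h k (i + 1) a b1 \<and> dyadic_box h k (i + 1) a2 b" if "dyadic_box h (Suc k) i a b"
    using that ax unfolding dyadic_box_def two_axes(2) by (auto simp: b1 a2 c field_simps)
qed

text \<open>\<open>e k\<close> bounds the relative imbalance between the two level-\<open>k\<close>
  halves of a box of level \<open>Suc k\<close>. The counts are positive because they become
  denominators.\<close>

definition halves_balanced :: "(real^2) set \<Rightarrow> real \<Rightarrow> (nat \<Rightarrow> real) \<Rightarrow> bool" where
  "halves_balanced Y h e \<longleftrightarrow>
     (\<forall>a b. finite (Y \<inter> hbox a b)) \<and>
     (\<forall>k i a b. dyadic_box h k i a b \<longrightarrow> 0 < pts Y (hbox a b)) \<and>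
     (\<forall>k i a b. dyadic_box h (Suc k) i a b \<longrightarrow>
        \<bar>pts Y (hbox a b \<inter> {z. z $ i < (a $ i + b $ i) / 2}) -
         pts Y (hbox a b \<inter> {z. (a $ i + b $ i) / 2 \<le> z $ i})\<bar> \<le> e k * pts Y (hbox a b))"

text \<open>\<open>C\<close> is the partition into the cells at which halving stops. That each cell
  gets the same share of the area as of the points is stated without division.\<close>

definition equalizes :: "(real^2) set \<Rightarrow> real \<Rightarrow> (real^2 \<Rightarrow> real^2) \<Rightarrow> real^2 \<Rightarrow> real^2 \<Rightarrow> (real^2) set set \<Rightarrow> bool" where
  "equalizes Y d F a b C \<longleftrightarrow>
     (\<forall>z. z \<notin> box a b \<longrightarrow> F z = z) \<and> finite C \<and> \<Union>C = hbox a b \<and> disjoint C \<and>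
     (\<forall>c\<in>C. c \<in> sets borel \<and> (\<forall>x\<in>c. \<forall>y\<in>c. dist x y \<le> d) \<and>
        leb (F ` c) * pts Y (hbox a b) = pts Y c * leb (hbox a b))"

text \<open>The maps of the halves act first and keep their halves. The map of the whole box then
  multiplies all areas inside a half by one factor, so it corrects the shares of the halves and
  leaves the shares within each half unchanged. As the maps of the two halves are glued rather than
  composed, a level contributes one factor to the Lipschitz constant.\<close>

lemma equalizing_map_exists:
  assumes Y: "halves_balanced Y h e" and h: "0 < h" and e: "\<And>k. 0 \<le> e k" "\<And>k. e k \<le> 1/40"
    and "dyadic_box h k i a b"
  shows "\<exists>F G C. bilip (\<Prod>j<k. 1 + 36 * e j) F G \<and> equalizes Y (2 * h) F a b C"
  using assms(5)
proof (induction k arbitrary: i a b)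
  case 0
  have "bilip 1 (\<lambda>z. z) (\<lambda>z::real^2. z)" by (simp add: bilip_def lipschitz_on_id)
  moreover have "dist x y \<le> 2 * h" if "x \<in> hbox a b" "y \<in> hbox a b" for x y
  proof -
    have "\<bar>(x - y) $ j\<bar> \<le> h" for j
    proof -
      have "b $ j - a $ j = h" using 0 two_axes(3)[of j i] by (auto simp: dyadic_box_def)
      moreover have "a $ j \<le> x $ j" "x $ j < b $ j" "a $ j \<le> y $ j" "y $ j < b $ j"
        using that by (auto simp: hbox_def)
      ultimately show ?thesis by (simp add: abs_le_iff)
    qed
    from this[of i] this[of "i + 1"] show ?thesis
      using norm_le_axes[of "x - y" i] unfolding dist_norm by linarith
  qed
  ultimately have "bilip 1 (\<lambda>z. z) (\<lambda>z::real^2. z)" "equalizes Y (2 * h) (\<lambda>z. z) a b {hbox a b}"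
    by (auto simp: equalizes_def)
  then show ?case by (auto intro!: exI)
next
  case (Suc k)
  define c where "c = (a $ i + b $ i) / 2"
  define b1 where "b1 = (\<chi> j. if j = i then c else b $ j)"
  define a2 where "a2 = (\<chi> j. if j = i then c else a $ j)"
  have dims: "b $ i - a $ i = 2 * (h * 2 ^ (k div 2))" "b $ (i + 1) - a $ (i + 1) = h * 2 ^ (Suc k div 2)"
    using Suc.prems by (simp_all add: dyadic_box_def)
  have pos: "0 < b $ i - a $ i" "0 < b $ (i + 1) - a $ (i + 1)" using dims h by auto
  note ax = two_axes(1)[of i] two_axes(2)[of i]
  note bis = bisect_box[of a i b c b1 a2, OF _ _ c_def b1_def a2_def]
  have ab: "a $ i < b $ i" "a $ (i + 1) < b $ (i + 1)" using pos by simp_all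
  have d1: "dyadic_box h k (i + 1) a b1" and d2: "dyadic_box h k (i + 1) a2 b"
    using bis(6)[OF ab Suc.prems] by simp_all
  obtain F1 G1 C1 where F1: "bilip (\<Prod>j<k. 1 + 36 * e j) F1 G1" "equalizes Y (2 * h) F1 a b1 C1"
    using Suc.IH[OF d1] by blast
  obtain F2 G2 C2 where F2: "bilip (\<Prod>j<k. 1 + 36 * e j) F2 G2" "equalizes Y (2 * h) F2 a2 b C2"
    using Suc.IH[OF d2] by blast
  have id1: "F1 z = z" if "z \<notin> box a b1" for z using F1(2) that by (auto simp: equalizes_def)
  have id2: "F2 z = z" if "z \<notin> box a2 b" for z using F2(2) that by (auto simp: equalizes_def)
  note sub = bis(1,2)[OF ab] and ar = bis(3,4)[OF ab]
  have bsub: "box a b1 \<subseteq> box a b" "box a2 b \<subseteq> box a b"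
    using pos ax unfolding mem_box_cart subset_iff all_axes[of _ i] by (auto simp: b1_def a2_def c_def)
  have right1: "F1 z = z" if "c \<le> z $ i" for z
    using that by (intro id1) (auto simp: mem_box_cart b1_def intro!: exI[of _ i])
  have left2: "F2 z = z" if "z $ i \<le> c" for z
    using that by (intro id2) (auto simp: mem_box_cart a2_def intro!: exI[of _ i])
  define F' where "F' = (\<lambda>z. if z $ i \<le> c then F1 z else F2 z)"
  obtain G' where F': "bilip (\<Prod>j<k. 1 + 36 * e j) F' G'"
    using bilip_glue_halfspaces[OF F1(1) right1 F2(1) left2] unfolding F'_def by blast
  let ?n = "pts Y"
  have fin: "finite (Y \<inter> hbox a b)" using Y by (auto simp: halves_balanced_def)
  have npos: "0 < ?n (hbox a b)" "0 < ?n (hbox a b1)" "0 < ?n (hbox a2 b)"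
    using Y Suc.prems d1 d2 unfolding halves_balanced_def by blast+
  note nadd = bis(5)[OF ab fin]
  \<comment> \<open>With this value, \<open>1 + \<sigma>\<close> and \<open>1 - \<sigma>\<close> are
    twice the shares of the lower and the upper half in the number of points.\<close>
  define \<sigma> where "\<sigma> = (?n (hbox a b1) - ?n (hbox a2 b)) / ?n (hbox a b)"
  have "\<bar>?n (hbox a b1) - ?n (hbox a2 b)\<bar> \<le> e k * ?n (hbox a b)"
    using Y Suc.prems unfolding halves_balanced_def sub c_def by blast
  then have \<sigma>: "\<bar>\<sigma>\<bar> \<le> e k" using npos by (simp add: \<sigma>_def divide_simps)
  then have \<sigma>40: "\<bar>\<sigma>\<bar> \<le> 1/40" "\<bar>\<sigma>\<bar> \<le> 1/4" using e(2)[of k] by linarith+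
  define m where "m = (1/2) *\<^sub>R (a + b)"
  define w where "w = (1/2) *\<^sub>R (b - a)"
  have mw: "m - w = a" "m + w = b" unfolding m_def w_def by (auto simp: vec_eq_iff field_simps)
  have mi: "m $ i = c" by (simp add: m_def c_def)
  have w: "0 < w $ i" "0 < w $ (i + 1)" using pos by (simp_all add: w_def)
  have rat: "w $ i \<le> 2 * w $ (i + 1)" "w $ (i + 1) \<le> 2 * w $ i"
  proof -
    have "(2::real) ^ (k div 2) \<le> 2 ^ (Suc k div 2)" by (intro power_increasing) auto
    moreover have "(2::real) ^ (Suc k div 2) \<le> 2 ^ Suc (k div 2)" by (intro power_increasing) auto
    moreover have "(0::real) < 2 ^ (k div 2)" by simp
    ultimately have "(2::real) ^ (k div 2) \<le> 2 ^ (Suc k div 2)" "(2::real) ^ (Suc k div 2) \<le> 4 * 2 ^ (k div 2)"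
      unfolding power_Suc by linarith+
    then show "w $ i \<le> 2 * w $ (i + 1)" "w $ (i + 1) \<le> 2 * w $ i"
      using dims h by (simp_all add: w_def)
  qed
  let ?g = "half_map \<sigma> i m w"
  obtain Gg where g: "bilip (1 + 36 * e k) ?g Gg"
    using half_map_bilip[OF \<sigma> e(2) w rat] by blast
  have gid: "?g z = z" if "z \<notin> box a b" for z
    using half_map_outside[OF \<sigma>40(2) w, of z m] that unfolding mw by blast
  define F where "F = ?g \<circ> F'"
  have bF: "bilip (\<Prod>j<Suc k. 1 + 36 * e j) F (G' \<circ> Gg)"
    using bilip_compose[OF g F'] unfolding F_def by (simp add: mult.commute)
  have m1: "leb (F ` x) * ?n (hbox a b) = ?n x * leb (hbox a b)"
    if x: "x \<in> C1" for x
  proof -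
    have xs: "x \<subseteq> hbox a b1" "x \<in> sets borel"
        "leb (F1 ` x) * ?n (hbox a b1) = ?n x * leb (hbox a b1)"
      using F1(2) x by (auto simp: equalizes_def)
    have F1x: "F1 ` x \<subseteq> hbox a b1"
      using bilip_maps_support[OF F1(1), of "hbox a b1"] id1 box_sub_hbox[of a b1] xs(1) by blast
    have "F' ` x = F1 ` x" using xs(1) unfolding sub F'_def by force
    then have "F ` x = ?g ` (F1 ` x)" unfolding F_def image_comp[symmetric] by (rule arg_cong)
    also have "leb \<dots> = (1 - (-1) * \<sigma>) * leb (F1 ` x)"
    proof (rule half_map_measure[OF \<sigma>40(1) w g])
      show "F1 ` x \<in> sets borel" using bilip_borel[OF F1(1) xs(2)] .
      show "F1 ` x \<subseteq> cbox (m - w) (m + w)" using F1x hbox_sub_cbox[of a b] unfolding mw sub by blast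
    qed (use F1x in \<open>auto simp: sub mi\<close>)
    finally have "leb (F ` x) * ?n (hbox a b) = 2 * ?n (hbox a b1) * leb (F1 ` x)"
      using npos nadd by (simp add: \<sigma>_def field_simps)
    then show ?thesis using xs(3) ar by (simp add: field_simps)
  qed
  have m2: "leb (F ` x) * ?n (hbox a b) = ?n x * leb (hbox a b)"
    if x: "x \<in> C2" for x
  proof -
    have xs: "x \<subseteq> hbox a2 b" "x \<in> sets borel"
        "leb (F2 ` x) * ?n (hbox a2 b) = ?n x * leb (hbox a2 b)"
      using F2(2) x by (auto simp: equalizes_def)
    have F2x: "F2 ` x \<subseteq> hbox a2 b"
      using bilip_maps_support[OF F2(1), of "hbox a2 b"] id2 box_sub_hbox[of a2 b] xs(1) by blast
    \<comment> \<open>Points on the dividing line belong to the upper half box, whereas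
      \<open>F'\<close> treats them by \<open>F1\<close>; both maps fix that line.\<close>
    have "F' z = F2 z" if "z \<in> x" for z
    proof (cases "z $ i = c")
      case True
      then show ?thesis using right1[of z] left2[of z] by (simp add: F'_def)
    next
      case False
      then show ?thesis using xs(1) that unfolding sub F'_def by force
    qed
    then have "F ` x = ?g ` (F2 ` x)" by (auto simp: F_def image_image)
    also have "leb \<dots> = (1 - 1 * \<sigma>) * leb (F2 ` x)"
    proof (rule half_map_measure[OF \<sigma>40(1) w g])
      show "F2 ` x \<in> sets borel" using bilip_borel[OF F2(1) xs(2)] .
      show "F2 ` x \<subseteq> cbox (m - w) (m + w)" using F2x hbox_sub_cbox[of a b] unfolding mw sub by blast
    qed (use F2x in \<open>auto simp: sub mi\<close>)
    finally have "leb (F ` x) * ?n (hbox a b) = 2 * ?n (hbox a2 b) * leb (F2 ` x)"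
      using npos nadd by (simp add: \<sigma>_def field_simps)
    then show ?thesis using xs(3) ar by (simp add: field_simps)
  qed
  have "equalizes Y (2 * h) F a b (C1 \<union> C2)"
    unfolding equalizes_def
  proof (intro conjI ballI allI impI)
    fix z assume z: "z \<notin> box a b"
    then have "F' z = z" using id1[of z] id2[of z] bsub by (auto simp: F'_def)
    then show "F z = z" using gid[OF z] by (simp add: F_def)
  next
    show "finite (C1 \<union> C2)" using F1(2) F2(2) by (auto simp: equalizes_def)
    show "\<Union>(C1 \<union> C2) = hbox a b" using F1(2) F2(2) sub by (auto simp: equalizes_def)
    show "disjoint (C1 \<union> C2)"
      using F1(2) F2(2) sub by (intro disjoint_union) (auto simp: equalizes_def)
  qed (use F1(2) F2(2) m1 m2 in \<open>auto simp: equalizes_def\<close>)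
  then show ?case using bF by blast
qed

section \<open>Matching points with lattice points\<close>

definition lattice_cell :: "real \<Rightarrow> real^2 \<Rightarrow> (real^2) set" where
  "lattice_cell s z = {x. \<forall>i. s * z $ i \<le> x $ i \<and> x $ i < s * z $ i + s}"

lemma lattice_cell_hbox: "lattice_cell s z = hbox (s *\<^sub>R z) (\<chi> i. s * z $ i + s)"
  by (simp add: lattice_cell_def hbox_def)

lemma lattice_cell_measure:
  assumes "0 < s" shows "leb (lattice_cell s z) = s\<^sup>2" "lattice_cell s z \<in> lmeasurable"
proof -
  show "leb (lattice_cell s z) = s\<^sup>2"
    using assms unfolding lattice_cell_hbox
    by (subst measure_hbox2[where i = 1]) (auto simp: power2_eq_square)
  show "lattice_cell s z \<in> lmeasurable"
    unfolding lattice_cell_hbox by (intro lmeasurable_borel) auto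
qed

lemma lattice_cell_disjoint:
  assumes "0 < s" "z \<in> integer_lattice" "z' \<in> integer_lattice"
    "x \<in> lattice_cell s z" "x \<in> lattice_cell s z'"
  shows "z = z'"
  unfolding vec_eq_iff
proof
  fix i
  obtain p q where pq: "z $ i = of_int p" "z' $ i = of_int q"
  proof -
    have "z $ i \<in> \<int>" "z' $ i \<in> \<int>" using assms(2,3) by (simp_all add: integer_lattice_def)
    then show ?thesis using that by (auto elim!: Ints_cases)
  qed
  have x: "s * z $ i \<le> x $ i" "x $ i < s * z $ i + s" "s * z' $ i \<le> x $ i" "x $ i < s * z' $ i + s"
    using assms(4,5) by (simp_all add: lattice_cell_def)
  have "s * of_int p < s * (of_int q + 1)" "s * of_int q < s * (of_int p + 1)"
    using x unfolding pq by (simp_all add: algebra_simps)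
  then have "(of_int p :: real) < of_int q + 1" "(of_int q :: real) < of_int p + 1"
    using assms(1) by simp_all
  then have "p = q" by linarith
  then show "z $ i = z' $ i" using pq by simp
qed

lemma lattice_cell_cover:
  assumes "0 < s" shows "\<exists>z\<in>integer_lattice. x \<in> lattice_cell s z"
proof
  let ?z = "(\<chi> i. of_int \<lfloor>x $ i / s\<rfloor>) :: real^2"
  show "?z \<in> integer_lattice" by (simp add: integer_lattice_def)
  have "s * of_int \<lfloor>x $ i / s\<rfloor> \<le> x $ i \<and> x $ i < s * of_int \<lfloor>x $ i / s\<rfloor> + s" for i
  proof -
    have 1: "of_int \<lfloor>x $ i / s\<rfloor> \<le> x $ i / s" "x $ i / s < of_int \<lfloor>x $ i / s\<rfloor> + 1" by linarith+
    have "of_int \<lfloor>x $ i / s\<rfloor> * s \<le> x $ i" "x $ i < (of_int \<lfloor>x $ i / s\<rfloor> + 1) * s"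
      using 1[unfolded pos_le_divide_eq[OF assms] pos_divide_less_eq[OF assms]] .
    then show ?thesis by (simp add: algebra_simps)
  qed
  then show "x \<in> lattice_cell s ?z" by (simp add: lattice_cell_def)
qed

lemma lattice_cell_dist:
  assumes "0 < s" "x \<in> lattice_cell s z" shows "dist x (s *\<^sub>R z) \<le> 2 * s"
proof -
  have "\<bar>(x - s *\<^sub>R z) $ i\<bar> \<le> s" for i
  proof -
    have "s * z $ i \<le> x $ i" "x $ i < s * z $ i + s" using assms(2) by (simp_all add: lattice_cell_def)
    then show ?thesis by (simp add: abs_le_iff)
  qed
  from this[of 1] this[of "1 + 1"] show ?thesis
    using norm_le_axes[of "x - s *\<^sub>R z" 1] unfolding dist_norm by linarith
qed

lemma finite_integer_lattice_bounded: "finite {z \<in> (integer_lattice :: (real^2) set). norm z \<le> M}"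
proof (rule finite_subset)
  let ?I = "{p::int. \<bar>of_int p\<bar> \<le> M}"
  have "?I \<subseteq> {- \<lceil>M\<rceil>..\<lceil>M\<rceil>}"
    by (auto simp: abs_le_iff) linarith+
  then have "finite ?I" by (rule finite_subset) simp
  then show "finite ((\<lambda>(p, q). (\<chi> i. of_int (if i = 1 then p else q)) :: real^2) ` (?I \<times> ?I))" by simp
  show "{z \<in> (integer_lattice :: (real^2) set). norm z \<le> M} \<subseteq>
      (\<lambda>(p, q). (\<chi> i. of_int (if i = 1 then p else q)) :: real^2) ` (?I \<times> ?I)"
  proof clarify
    fix z :: "real^2" assume z: "z \<in> integer_lattice" "norm z \<le> M"
    obtain p q where "z $ 1 = of_int p" "z $ 2 = of_int q"
    proof -
      have "z $ 1 \<in> \<int>" "z $ 2 \<in> \<int>" using z(1) by (simp_all add: integer_lattice_def)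
      then show ?thesis using that by (auto elim!: Ints_cases)
    qed
    moreover from this have "\<bar>of_int p\<bar> \<le> M" "\<bar>of_int q\<bar> \<le> M"
      using component_le_norm_cart[of z 1] component_le_norm_cart[of z 2] z(2) by auto
    ultimately show "z \<in> (\<lambda>(p, q). (\<chi> i. of_int (if i = 1 then p else q))) ` (?I \<times> ?I)"
      by (intro image_eqI[where x = "(p, q)"]) (auto simp: vec_eq_iff forall_2)
  qed
qed

lemma finite_lattice_cells_meeting:
  assumes s: "0 < s" and U: "bounded U"
  shows "finite {z \<in> integer_lattice. lattice_cell s z \<inter> U \<noteq> {}}"
proof -
  obtain M where M: "\<And>x. x \<in> U \<Longrightarrow> norm x \<le> M" using U by (auto simp: bounded_iff)
  have "{z \<in> integer_lattice. lattice_cell s z \<inter> U \<noteq> {}} \<subseteq> {z \<in> integer_lattice. norm z \<le> (M + 2 * s) / s}"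
  proof (rule subsetI)
    fix z assume z: "z \<in> {z \<in> integer_lattice. lattice_cell s z \<inter> U \<noteq> {}}"
    then obtain x where x: "x \<in> lattice_cell s z" "x \<in> U" by blast
    have "norm (s *\<^sub>R z) \<le> norm x + dist x (s *\<^sub>R z)"
      unfolding dist_norm by (metis norm_minus_commute norm_triangle_sub)
    then have "s * norm z \<le> M + 2 * s"
      using M[OF x(2)] lattice_cell_dist[OF s x(1)] s by simp
    then have "norm z \<le> (M + 2 * s) / s" using s by (simp add: field_simps)
    then show "z \<in> {z \<in> integer_lattice. norm z \<le> (M + 2 * s) / s}" using z by blast
  qed
  then show ?thesis using finite_integer_lattice_bounded by (rule finite_subset)
qed

text \<open>The scale \<open>s\<close> makes a lattice cell as large as the area that the equalized
  box offers per point. A point \<open>y\<close> is joined to every lattice point whose cell meets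
  the image of the piece containing \<open>y\<close>, so Hall's condition compares areas. It holds
  from both sides, for all points of the box and for all cells inside the box, and the two matchings
  are merged. An edge is short because pieces and cells are small.\<close>

lemma matching_from_equalizing_map:
  assumes F: "bilip L F G" and eq: "equalizes Y d F a b C"
    and fin: "finite (Y \<inter> hbox a b)" and n: "0 < pts Y (hbox a b)" and \<mu>: "0 < leb (hbox a b)"
    and s: "s = sqrt (leb (hbox a b) / pts Y (hbox a b))"
  shows "\<exists>\<phi>. inj_on \<phi> (Y \<inter> hbox a b) \<and>
     (\<forall>y\<in>Y \<inter> hbox a b. \<phi> y \<in> integer_lattice \<and> dist (F y) (s *\<^sub>R \<phi> y) \<le> L * d + 2 * s) \<and>
     {z \<in> integer_lattice. lattice_cell s z \<subseteq> hbox a b} \<subseteq> \<phi> ` (Y \<inter> hbox a b)"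
proof -
  let ?B = "hbox a b" and ?Z = "integer_lattice :: (real^2) set" and ?cell = "lattice_cell s"
  let ?m = "leb" and ?n = "pts Y"
  have s0: "0 < s" and s2: "s\<^sup>2 * ?n ?B = ?m ?B" using n \<mu> by (simp_all add: s)
  have C: "finite C" "\<Union>C = ?B" "disjoint C" "\<And>c. c \<in> C \<Longrightarrow> c \<in> sets borel"
    "\<And>c x y. c \<in> C \<Longrightarrow> x \<in> c \<Longrightarrow> y \<in> c \<Longrightarrow> dist x y \<le> d"
    and meas: "\<And>c. c \<in> C \<Longrightarrow> ?m (F ` c) * ?n ?B = ?n c * ?m ?B"
    and out: "\<And>z. z \<notin> box a b \<Longrightarrow> F z = z"
    using eq by (auto simp: equalizes_def)
  have mc: "?m (F ` c) = ?n c * s\<^sup>2" if "c \<in> C" for c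
    using meas[OF that] n unfolding s2[symmetric] by simp
  define E where "E = (\<lambda>y z. \<exists>c\<in>C. y \<in> c \<and> ?cell z \<inter> F ` c \<noteq> {})"
  have bc: "bounded (F ` c)" "F ` c \<in> lmeasurable" if "c \<in> C" for c
  proof -
    have "bounded c" using C(2) that bounded_hbox[of a b] bounded_subset by blast
    then show "bounded (F ` c)" by (rule bilip_bounded[OF F])
    then show "F ` c \<in> lmeasurable" using bilip_borel[OF F C(4)[OF that]] by (intro lmeasurable_borel)
  qed
  have dC: "pairwise (\<lambda>i j. disjnt (F ` i) (F ` j)) C'" if "C' \<subseteq> C" for C'
  proof (rule pairwiseI)
    fix i j assume "i \<in> C'" "j \<in> C'" "i \<noteq> j"
    then have "i \<inter> j = {}" using C(3) that by (auto simp: disjoint_def)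
    then show "disjnt (F ` i) (F ` j)"
      using image_Int[OF bilip_inj[OF F], of i j] by (simp add: disjnt_def)
  qed
  have mUC: "?m (\<Union>c\<in>C'. F ` c) = (\<Sum>c\<in>C'. ?n c) * s\<^sup>2" if "C' \<subseteq> C" for C'
  proof -
    have "?m (\<Union>c\<in>C'. F ` c) = (\<Sum>c\<in>C'. ?m (F ` c))"
      using that bc(2) C(1) dC[OF that] finite_subset by (intro measure_UNION') auto
    also have "\<dots> = (\<Sum>c\<in>C'. ?n c * s\<^sup>2)" using that mc by (intro sum.cong) auto
    finally show ?thesis by (simp add: sum_distrib_right)
  qed
  have mUZ: "?m (\<Union>z\<in>D. ?cell z) = real (card D) * s\<^sup>2" if "D \<subseteq> ?Z" "finite D" for D
  proof -
    have "?m (\<Union>z\<in>D. ?cell z) = (\<Sum>z\<in>D. ?m (?cell z))"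
    proof (intro measure_UNION' that lattice_cell_measure s0 pairwiseI)
      fix z z' assume "z \<in> D" "z' \<in> D" "z \<noteq> z'"
      then show "disjnt (?cell z) (?cell z')"
        using lattice_cell_disjoint[OF s0] that(1) unfolding disjnt_def by blast
    qed
    then show ?thesis by (simp add: lattice_cell_measure s0)
  qed
  have finc: "finite (Y \<inter> c)" if "c \<in> C" for c
    using C(2) that by (intro finite_subset[OF _ fin]) auto
  have sumn: "(\<Sum>c\<in>C'. ?n c) = real (card (\<Union>c\<in>C'. Y \<inter> c))" if "C' \<subseteq> C" for C'
  proof -
    have "card (\<Union>c\<in>C'. Y \<inter> c) = (\<Sum>c\<in>C'. card (Y \<inter> c))"
    proof (rule card_UN_disjoint)
      show "finite C'" using C(1) that finite_subset by blast
      show "\<forall>i\<in>C'. finite (Y \<inter> i)" using finc that by blast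
      show "\<forall>i\<in>C'. \<forall>j\<in>C'. i \<noteq> j \<longrightarrow> Y \<inter> i \<inter> (Y \<inter> j) = {}"
        using C(3) that unfolding disjoint_def by blast
    qed
    then show ?thesis by (simp add: pts_def)
  qed
  have s20: "0 < s\<^sup>2" using s0 by simp
  have finN: "finite {z \<in> ?Z. E y z}" if "y \<in> Y \<inter> ?B" for y
  proof -
    have "finite (\<Union>c\<in>C. {z \<in> ?Z. ?cell z \<inter> F ` c \<noteq> {}})"
      using C(1) finite_lattice_cells_meeting[OF s0 bc(1)] by blast
    moreover have "{z \<in> ?Z. E y z} \<subseteq> (\<Union>c\<in>C. {z \<in> ?Z. ?cell z \<inter> F ` c \<noteq> {}})"
      by (auto simp: E_def)
    ultimately show ?thesis by (rule finite_subset[rotated])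
  qed
  have "\<exists>f. inj_on f (Y \<inter> ?B) \<and> (\<forall>y\<in>Y \<inter> ?B. f y \<in> {z \<in> ?Z. E y z})"
  proof (rule hall_marriage[OF fin finN])
    \<comment> \<open>The pieces meeting \<open>D\<close> contain at least \<open>card D\<close>
      points, so their images have area at least \<open>card D * s\<^sup>2\<close>; the cells of the
      neighbours of \<open>D\<close> cover these images.\<close>
    fix D assume D: "D \<subseteq> Y \<inter> ?B"
    define C' where "C' = {c \<in> C. c \<inter> D \<noteq> {}}"
    define N where "N = (\<Union>y\<in>D. {z \<in> ?Z. E y z})"
    have C': "C' \<subseteq> C" by (auto simp: C'_def)
    have finD: "finite D" using D fin finite_subset by blast
    have finN': "finite N" unfolding N_def using finD finN D by blast
    have "D \<subseteq> (\<Union>c\<in>C'. Y \<inter> c)" using D C(2) by (auto simp: C'_def) blast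
    then have "card D \<le> card (\<Union>c\<in>C'. Y \<inter> c)"
      using C' C(1) finc finite_subset by (intro card_mono) blast+
    then have "real (card D) * s\<^sup>2 \<le> ?m (\<Union>c\<in>C'. F ` c)"
      using s20 by (simp add: mUC[OF C'] sumn[OF C'])
    also have "\<dots> \<le> ?m (\<Union>z\<in>N. ?cell z)"
    proof (rule measure_mono_fmeasurable)
      show "(\<Union>z\<in>N. ?cell z) \<in> lmeasurable"
        using finN' lattice_cell_measure(2)[OF s0] by (intro fmeasurable.finite_UN) auto
      then show "(\<Union>c\<in>C'. F ` c) \<in> sets lebesgue"
        using C' C(1) bc(2) finite_subset[OF C' C(1)] by (intro sets.finite_UN) (auto dest: fmeasurableD)
      show "(\<Union>c\<in>C'. F ` c) \<subseteq> (\<Union>z\<in>N. ?cell z)"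
      proof clarify
        fix c x assume c: "c \<in> C'" and x: "x \<in> c"
        obtain y where y: "y \<in> D" "y \<in> c" using c by (auto simp: C'_def)
        obtain z where z: "z \<in> ?Z" "F x \<in> ?cell z" using lattice_cell_cover[OF s0] by blast
        then have "E y z" using c x y unfolding E_def C'_def by blast
        then show "F x \<in> (\<Union>z\<in>N. ?cell z)" using y z by (auto simp: N_def)
      qed
    qed
    also have "\<dots> = real (card N) * s\<^sup>2" using finN' by (intro mUZ) (auto simp: N_def)
    finally show "card D \<le> card N" using s20 by simp
  qed
  then obtain f where f: "inj_on f (Y \<inter> ?B)" "\<And>y. y \<in> Y \<inter> ?B \<Longrightarrow> f y \<in> ?Z \<and> E y (f y)" by blast
  let ?I = "{z \<in> ?Z. ?cell z \<subseteq> ?B}"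
  have ne: "?cell z \<noteq> {}" for z
    using s0 by (auto simp: lattice_cell_def intro!: exI[of _ "s *\<^sub>R z"])
  have finI: "finite ?I"
    using finite_lattice_cells_meeting[OF s0 bounded_hbox[of a b]] ne
    by (elim finite_subset[rotated]) blast
  have "\<exists>g. inj_on g ?I \<and> (\<forall>z\<in>?I. g z \<in> {y \<in> Y \<inter> ?B. E y z})"
  proof (rule hall_marriage[OF finI])
    fix z show "finite {y \<in> Y \<inter> ?B. E y z}" by (rule finite_subset[OF _ fin]) auto
  next
    \<comment> \<open>Conversely, the cells of \<open>D\<close> lie in the box, which
      \<open>F\<close> maps onto itself, so they are covered by images of pieces.\<close>
    fix D assume D: "D \<subseteq> ?I"
    define C' where "C' = {c \<in> C. \<exists>z\<in>D. ?cell z \<inter> F ` c \<noteq> {}}"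
    have C': "C' \<subseteq> C" by (auto simp: C'_def)
    have finD: "finite D" using D finI finite_subset by blast
    have "real (card D) * s\<^sup>2 = ?m (\<Union>z\<in>D. ?cell z)" using D finD by (subst mUZ) auto
    also have "\<dots> \<le> ?m (\<Union>c\<in>C'. F ` c)"
    proof (rule measure_mono_fmeasurable)
      show "(\<Union>c\<in>C'. F ` c) \<in> lmeasurable"
        using C' bc(2) finite_subset[OF C' C(1)] by (intro fmeasurable.finite_UN) auto
      show "(\<Union>z\<in>D. ?cell z) \<in> sets lebesgue"
        using finD lattice_cell_measure(2)[OF s0] by (intro sets.finite_UN) (auto dest: fmeasurableD)
      show "(\<Union>z\<in>D. ?cell z) \<subseteq> (\<Union>c\<in>C'. F ` c)"
      proof clarify
        fix z x assume z: "z \<in> D" "x \<in> ?cell z"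
        have GF: "F (G x) = x" using F by (simp add: bilip_def)
        have "x \<in> ?B" using D z by auto
        have "G x \<in> ?B"
        proof (rule ccontr)
          assume "G x \<notin> ?B"
          then have "F (G x) = G x" using box_sub_hbox[of a b] by (intro out) blast
          then show False using GF \<open>x \<in> ?B\<close> \<open>G x \<notin> ?B\<close> by simp
        qed
        then obtain c where c: "c \<in> C" "G x \<in> c" using C(2) by blast
        then have "x \<in> F ` c" using GF by (metis imageI)
        then show "x \<in> (\<Union>c\<in>C'. F ` c)" using z c(1) by (auto simp: C'_def)
      qed
    qed
    also have "\<dots> = real (card (\<Union>c\<in>C'. Y \<inter> c)) * s\<^sup>2" by (simp add: mUC[OF C'] sumn[OF C'])
    finally have "card D \<le> card (\<Union>c\<in>C'. Y \<inter> c)" using s20 by simp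
    also have "\<dots> \<le> card (\<Union>z\<in>D. {y \<in> Y \<inter> ?B. E y z})"
    proof (rule card_mono)
      show "finite (\<Union>z\<in>D. {y \<in> Y \<inter> ?B. E y z})" by (rule finite_subset[OF _ fin]) auto
      show "(\<Union>c\<in>C'. Y \<inter> c) \<subseteq> (\<Union>z\<in>D. {y \<in> Y \<inter> ?B. E y z})"
        using C(2) unfolding C'_def E_def by blast
    qed
    finally show "card D \<le> card (\<Union>z\<in>D. {y \<in> Y \<inter> ?B. E y z})" .
  qed
  then obtain g where g: "inj_on g ?I" "\<And>z. z \<in> ?I \<Longrightarrow> g z \<in> Y \<inter> ?B \<and> E (g z) z" by blast
  let ?R = "\<lambda>y z. z \<in> ?Z \<and> E y z"
  have "\<exists>h. inj_on h (Y \<inter> ?B) \<and> (\<forall>y\<in>Y \<inter> ?B. ?R y (h y)) \<and> ?I \<subseteq> h ` (Y \<inter> ?B)"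
    by (rule mendelsohn_dulmage[OF f(1) _ g(1)]) (use f(2) g(2) in auto)
  then obtain \<phi> where \<phi>: "inj_on \<phi> (Y \<inter> ?B)" "\<And>y. y \<in> Y \<inter> ?B \<Longrightarrow> ?R y (\<phi> y)" "?I \<subseteq> \<phi> ` (Y \<inter> ?B)"
    by blast
  have "dist (F y) (s *\<^sub>R \<phi> y) \<le> L * d + 2 * s" if y: "y \<in> Y \<inter> ?B" for y
  proof -
    obtain c x where c: "c \<in> C" "y \<in> c" "x \<in> c" "F x \<in> ?cell (\<phi> y)"
      using \<phi>(2)[OF y] unfolding E_def by blast
    have "dist (F y) (F x) \<le> L * dist y x" using F lipschitz_onD unfolding bilip_def by blast
    also have "\<dots> \<le> L * d"
      using C(5)[OF c(1-3)] F lipschitz_on_nonneg unfolding bilip_def by (intro mult_left_mono) blast+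
    finally show ?thesis
      using lattice_cell_dist[OF s0 c(4)] dist_triangle[of "F y" "s *\<^sub>R \<phi> y" "F x"] by linarith
  qed
  then show ?thesis using \<phi> by blast
qed

section \<open>From squares to the whole plane\<close>

lemma integer_lattice_diff: "z \<in> integer_lattice \<Longrightarrow> z' \<in> integer_lattice \<Longrightarrow> z - z' \<in> integer_lattice"
  by (simp add: integer_lattice_def)

lemma integer_lattice_add: "z \<in> integer_lattice \<Longrightarrow> z' \<in> integer_lattice \<Longrightarrow> z + z' \<in> integer_lattice"
  by (simp add: integer_lattice_def)

lemma integer_lattice_norm_ge_1:
  assumes "z \<in> integer_lattice" "z \<noteq> 0" shows "1 \<le> norm z"
proof -
  obtain i where i: "z $ i \<noteq> 0" using assms(2) by (auto simp: vec_eq_iff)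
  have "z $ i \<in> \<int>" using assms(1) by (simp add: integer_lattice_def)
  then have "1 \<le> \<bar>z $ i\<bar>" using i Ints_nonzero_abs_ge1 by blast
  then show ?thesis using component_le_norm_cart[of z i] by linarith
qed

lemma closed_integer_lattice: "closed (integer_lattice :: (real^'n) set)"
proof -
  have *: "integer_lattice = (\<Inter>i. (\<lambda>z::real^'n. z $ i) -` \<int>)" by (auto simp: integer_lattice_def)
  have "closed ((\<lambda>z::real^'n. z $ i) -` \<int>)" for i
    by (rule closed_vimage) (auto intro: continuous_intros)
  then show ?thesis unfolding * by (intro closed_INT ballI)
qed

definition lattice_bilipschitz :: "'a::metric_space set \<Rightarrow> bool" where
  "lattice_bilipschitz Y \<longleftrightarrow> (\<exists>\<Phi> K. bij_betw \<Phi> Y (integer_lattice :: (real^2) set) \<and> 0 < K \<and>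
    (\<forall>y\<in>Y. \<forall>y'\<in>Y. dist y y' \<le> K * dist (\<Phi> y) (\<Phi> y') \<and> dist (\<Phi> y) (\<Phi> y') \<le> K * dist y y'))"

text \<open>The normalisation at \<open>y0\<close> bounds the values at each fixed point uniformly
  in \<open>k\<close>, which yields a pointwise convergent subsequence. The two-sided estimate
  passes to the limit and makes it injective.\<close>

lemma bilipschitz_limit:
  fixes \<psi> :: "nat \<Rightarrow> 'a::metric_space \<Rightarrow> real^2"
  assumes Y: "countable Y" "y0 \<in> Y" and K: "0 < K"
    and fin: "\<And>\<rho>. finite (Y \<inter> cball y0 \<rho>)"
    and A: "\<And>y. y \<in> Y \<Longrightarrow> eventually (\<lambda>k. y \<in> A k) sequentially" "\<And>k. A k \<subseteq> Y"
    and \<psi>: "\<And>k y. y \<in> A k \<Longrightarrow> \<psi> k y \<in> integer_lattice" "\<And>k. \<psi> k y0 = 0"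
    and lip: "\<And>k y y'. y \<in> A k \<Longrightarrow> y' \<in> A k \<Longrightarrow>
        dist y y' \<le> K * dist (\<psi> k y) (\<psi> k y') \<and> dist (\<psi> k y) (\<psi> k y') \<le> K * dist y y'"
    and surj: "\<And>z. z \<in> integer_lattice \<Longrightarrow> eventually (\<lambda>k. z \<in> \<psi> k ` A k) sequentially"
    and y0: "\<And>k. y0 \<in> A k"
  shows "lattice_bilipschitz Y"
proof -
  \<comment> \<open>Divided by a bound for \<open>\<psi> k y\<close>, the family is bounded by 1,
    the uniform bound from which a convergent subsequence is extracted. The filler 0 outside
    \<open>A k\<close> disappears for large \<open>k\<close>.\<close>
  define f where "f = (\<lambda>k y. if y \<in> A k then (1 / (1 + K * dist y y0)) *\<^sub>R \<psi> k y else 0)"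
  have pos: "0 < 1 + K * dist y y0" for y using K by (simp add: add_pos_nonneg)
  have "norm (f k y) \<le> 1" for k y
  proof (cases "y \<in> A k")
    case True
    have "norm (\<psi> k y) \<le> K * dist y y0" using lip[OF True y0] \<psi>(2) by simp
    then show ?thesis using True pos[of y] by (simp add: f_def divide_simps)
  qed (simp add: f_def)
  then obtain \<kappa> where \<kappa>: "strict_mono (\<kappa> :: nat \<Rightarrow> nat)" and lf: "\<And>y. y \<in> Y \<Longrightarrow> \<exists>l. (\<lambda>n. f (\<kappa> n) y) \<longlonglongrightarrow> l"
    using function_convergent_subsequence[of Y f 1, OF Y(1)] by blast
  have sub: "eventually (\<lambda>n. P (\<kappa> n)) sequentially" if "eventually P sequentially" for P
    using that filterlim_subseq[OF \<kappa>] by (simp add: filterlim_iff)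
  have "\<exists>l. (\<lambda>n. \<psi> (\<kappa> n) y) \<longlonglongrightarrow> l" if y: "y \<in> Y" for y
  proof -
    obtain l where "(\<lambda>n. f (\<kappa> n) y) \<longlonglongrightarrow> l" using lf[OF y] by blast
    then have "(\<lambda>n. (1 + K * dist y y0) *\<^sub>R f (\<kappa> n) y) \<longlonglongrightarrow> (1 + K * dist y y0) *\<^sub>R l"
      by (intro tendsto_intros)
    moreover have "eventually (\<lambda>n. (1 + K * dist y y0) *\<^sub>R f (\<kappa> n) y = \<psi> (\<kappa> n) y) sequentially"
      using sub[OF A(1)[OF y]] by eventually_elim (use pos[of y] in \<open>simp add: f_def\<close>)
    ultimately show ?thesis by (blast intro: Lim_transform_eventually)
  qed
  then obtain \<Phi> where \<Phi>: "\<And>y. y \<in> Y \<Longrightarrow> (\<lambda>n. \<psi> (\<kappa> n) y) \<longlonglongrightarrow> \<Phi> y" by metis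
  have lim: "dist y y' \<le> K * dist (\<Phi> y) (\<Phi> y') \<and> dist (\<Phi> y) (\<Phi> y') \<le> K * dist y y'"
    if y: "y \<in> Y" "y' \<in> Y" for y y'
  proof -
    have ev: "eventually (\<lambda>n. y \<in> A (\<kappa> n) \<and> y' \<in> A (\<kappa> n)) sequentially"
      using sub[OF A(1)[OF y(1)]] sub[OF A(1)[OF y(2)]] by eventually_elim simp
    have t: "(\<lambda>n. dist (\<psi> (\<kappa> n) y) (\<psi> (\<kappa> n) y')) \<longlonglongrightarrow> dist (\<Phi> y) (\<Phi> y')"
      by (intro tendsto_dist \<Phi> y)
    have "dist y y' \<le> K * dist (\<Phi> y) (\<Phi> y')"
      using ev lip by (intro tendsto_lowerbound[OF tendsto_mult_left[OF t]]) (auto elim: eventually_mono)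
    moreover have "dist (\<Phi> y) (\<Phi> y') \<le> K * dist y y'"
      using ev lip by (intro tendsto_upperbound[OF t]) (auto elim: eventually_mono)
    ultimately show ?thesis by simp
  qed
  have "inj_on \<Phi> Y"
    using lim by (intro inj_onI) (metis dist_eq_0_iff dist_le_zero_iff mult_zero_right)
  moreover have "\<Phi> y \<in> integer_lattice" if y: "y \<in> Y" for y
    by (rule Lim_in_closed_set[OF closed_integer_lattice _ _ \<Phi>[OF y]])
       (use sub[OF A(1)[OF y]] \<psi>(1) in \<open>auto elim: eventually_mono\<close>)
  moreover have "z \<in> \<Phi> ` Y" if z: "z \<in> integer_lattice" for z
  proof (rule ccontr)
    assume no: "z \<notin> \<Phi> ` Y"
    \<comment> \<open>Every preimage of \<open>z\<close> under every \<open>\<psi> k\<close> lies in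
      this finite set, so preimages cannot escape to infinity along the subsequence.\<close>
    let ?W = "Y \<inter> cball y0 (K * norm z)"
    have "\<forall>w\<in>?W. eventually (\<lambda>n. \<psi> (\<kappa> n) w \<noteq> z) sequentially"
    proof
      fix w assume w: "w \<in> ?W"
      then have "\<Phi> w \<noteq> z" using no by blast
      then show "eventually (\<lambda>n. \<psi> (\<kappa> n) w \<noteq> z) sequentially"
        using \<Phi>[of w] w by (intro tendsto_imp_eventually_ne) auto
    qed
    then have "eventually (\<lambda>n. \<forall>w\<in>?W. \<psi> (\<kappa> n) w \<noteq> z) sequentially"
      by (intro eventually_ball_finite fin)
    moreover have "eventually (\<lambda>n. \<exists>w\<in>?W. \<psi> (\<kappa> n) w = z) sequentially"
      using sub[OF surj[OF z]]
    proof eventually_elim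
      case (elim n)
      then obtain w where w: "w \<in> A (\<kappa> n)" "\<psi> (\<kappa> n) w = z" by blast
      have "dist y0 w \<le> K * norm z" using lip[OF y0 w(1)] w(2) \<psi>(2) by simp
      then show ?case using w A(2)[of "\<kappa> n"] by (intro bexI[of _ w]) auto
    qed
    ultimately have "eventually (\<lambda>n. False) sequentially" by eventually_elim blast
    then show False by simp
  qed
  ultimately have "bij_betw \<Phi> Y integer_lattice" by (auto simp: bij_betw_def)
  then show ?thesis unfolding lattice_bilipschitz_def using lim K by (intro exI[of _ \<Phi>] exI[of _ K] conjI ballI) auto
qed

lemma prod_le_exp_suminf:
  fixes e :: "nat \<Rightarrow> real"
  assumes "summable e" "\<And>k. 0 \<le> e k" "0 \<le> c"
  shows "(\<Prod>j<k::nat. 1 + c * e j) \<le> exp (c * suminf e)"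
proof -
  have "(\<Prod>j<k. 1 + c * e j) \<le> (\<Prod>j<k. exp (c * e j))"
  proof (rule prod_mono)
    fix j show "0 \<le> 1 + c * e j \<and> 1 + c * e j \<le> exp (c * e j)"
      using assms(2)[of j] assms(3) exp_ge_add_one_self[of "c * e j"] by simp
  qed
  also have "\<dots> = exp (c * (\<Sum>j<k. e j))" by (simp add: exp_sum sum_distrib_left)
  also have "\<dots> \<le> exp (c * suminf e)"
    using assms by (auto intro!: mult_left_mono sum_le_suminf)
  finally show ?thesis .
qed

text \<open>The matchings of the squares of side \<open>h * 2 ^ k\<close> satisfy estimates uniform
  in \<open>k\<close>: summability of \<open>e\<close> bounds the equalizing maps, the density
  bounds confine the lattice scale, and minimal distances absorb the additive error of the
  matching.\<close>

lemma balanced_bilipschitz_lattice: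
  fixes Y :: "(real^2) set"
  assumes bal: "halves_balanced Y h e" and h: "0 < h"
    and e: "\<And>k. 0 \<le> e k" "\<And>k. e k \<le> 1/40" "summable e"
    and r: "0 < r" "\<And>y y'. y \<in> Y \<Longrightarrow> y' \<in> Y \<Longrightarrow> y \<noteq> y' \<Longrightarrow> r \<le> dist y y'"
    and dens: "0 < \<alpha>1" "\<And>k i a b. dyadic_box h k i a b \<Longrightarrow>
        \<alpha>1 \<le> leb (hbox a b) / pts Y (hbox a b) \<and>
        leb (hbox a b) / pts Y (hbox a b) \<le> \<alpha>2"
  shows "lattice_bilipschitz Y"
proof -
  define \<Lambda> where "\<Lambda> = exp (36 * suminf e)"
  have \<Lambda>: "0 < \<Lambda>" by (simp add: \<Lambda>_def)
  define R where "R = (\<lambda>k::nat. h * 2 ^ k / 2)"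
  define B where "B = (\<lambda>k. hbox (\<chi> i. - R k) (\<chi> i. R k) :: (real^2) set)"
  define s where "s = (\<lambda>k. sqrt (leb (B k) / pts Y (B k)))"
  define s1 s2 where "s1 = sqrt \<alpha>1" and "s2 = sqrt \<alpha>2"
  define D where "D = \<Lambda> * (2 * h) + 2 * s2"
  have dy: "dyadic_box h (2 * k) 1 (\<chi> i. - R k) (\<chi> i. R k)" for k
    by (simp add: dyadic_box_def R_def)
  have Rpos: "0 < R k" for k using h by (simp add: R_def)
  have s12: "s1 \<le> s k" "s k \<le> s2" for k
    using dens(2)[OF dy[of k]] unfolding s_def s1_def s2_def B_def by auto
  have s1: "0 < s1" using dens(1) by (simp add: s1_def)
  have D0: "0 < D" using \<Lambda> h s1 s12[of 0] unfolding D_def by (intro add_pos_pos) auto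
  have npos: "0 < pts Y (B k)" for k using bal dy[of k] unfolding halves_balanced_def B_def by blast
  have fin: "finite (Y \<inter> hbox a b)" for a b using bal by (simp add: halves_balanced_def)
  define good where "good = (\<lambda>k F G \<phi>. bilip \<Lambda> F G \<and> (\<forall>z. z \<notin> B k \<longrightarrow> F z = z) \<and> inj_on \<phi> (Y \<inter> B k) \<and>
     (\<forall>y\<in>Y \<inter> B k. \<phi> y \<in> integer_lattice \<and> dist (F y) (s k *\<^sub>R \<phi> y) \<le> D) \<and>
     {z \<in> integer_lattice. lattice_cell (s k) z \<subseteq> B k} \<subseteq> \<phi> ` (Y \<inter> B k))"
  have "\<exists>F G \<phi>. good k F G \<phi>" for k
  proof -
    let ?L = "\<Prod>j<2 * k. 1 + 36 * e j"
    obtain F G C where F: "bilip ?L F G" and C: "equalizes Y (2 * h) F (\<chi> i. - R k) (\<chi> i. R k) C"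
      using equalizing_map_exists[OF bal h e(1,2) dy[of k]] by blast
    have L: "?L \<le> \<Lambda>" unfolding \<Lambda>_def by (rule prod_le_exp_suminf) (use e in auto)
    have F\<Lambda>: "bilip \<Lambda> F G" using F L by (rule bilip_mono)
    have Bk: "hbox (\<chi> i. - R k) (\<chi> i. R k) = B k" by (simp add: B_def)
    have mpos: "0 < leb (B k)"
      using Rpos[of k] unfolding B_def by (subst measure_hbox2[where i = 1]) auto
    have sk: "s k = sqrt (leb (B k) / pts Y (B k))" by (simp add: s_def)
    have finB: "finite (Y \<inter> B k)" unfolding B_def by (rule fin)
    from matching_from_equalizing_map[OF F\<Lambda> C, unfolded Bk, OF finB npos mpos sk]
    obtain \<phi> where \<phi>: "inj_on \<phi> (Y \<inter> B k) \<and>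
      (\<forall>y\<in>Y \<inter> B k. \<phi> y \<in> integer_lattice \<and> dist (F y) (s k *\<^sub>R \<phi> y) \<le> \<Lambda> * (2 * h) + 2 * s k) \<and>
      {z \<in> integer_lattice. lattice_cell (s k) z \<subseteq> B k} \<subseteq> \<phi> ` (Y \<inter> B k)" ..
    have "F z = z" if "z \<notin> B k" for z
    proof -
      have "z \<notin> box (\<chi> i. - R k) (\<chi> i. R k)"
        using that subsetD[OF box_sub_hbox, of z "\<chi> i. - R k" "\<chi> i. R k"] unfolding Bk by blast
      then show ?thesis using C unfolding equalizes_def by simp
    qed
    moreover have "\<phi> y \<in> integer_lattice \<and> dist (F y) (s k *\<^sub>R \<phi> y) \<le> D" if "y \<in> Y \<inter> B k" for y
      using conjunct1[OF conjunct2[OF \<phi>], THEN bspec, OF that] s12(2)[of k] by (auto simp: D_def)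
    ultimately have "good k F G \<phi>"
      unfolding good_def using F\<Lambda> conjunct1[OF \<phi>] conjunct2[OF conjunct2[OF \<phi>]] by simp
    then show ?thesis by blast
  qed
  then have "\<forall>k. \<exists>F G \<phi>. good k F G \<phi>" by blast
  from choice[OF this] obtain F where "\<forall>k. \<exists>G \<phi>. good k (F k) G \<phi>" ..
  from choice[OF this] obtain G where "\<forall>k. \<exists>\<phi>. good k (F k) (G k) \<phi>" ..
  from choice[OF this] obtain \<phi> where "\<forall>k. good k (F k) (G k) (\<phi> k)" ..
  then have good: "good k (F k) (G k) (\<phi> k)" for k ..
  note good' = good[unfolded good_def]
  have bl: "bilip \<Lambda> (F k) (G k)" for k using good'[of k] by simp
  have inj: "inj_on (\<phi> k) (Y \<inter> B k)" for k using good'[of k] by simp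
  have out: "F k z = z" if "z \<notin> B k" for k z using good'[of k] that by simp
  have \<phi>: "\<phi> k y \<in> integer_lattice" "dist (F k y) (s k *\<^sub>R \<phi> k y) \<le> D" if "y \<in> Y \<inter> B k" for k y
    using good'[of k] that by simp_all
  have onto: "z \<in> \<phi> k ` (Y \<inter> B k)" if "z \<in> integer_lattice" "lattice_cell (s k) z \<subseteq> B k" for k z
  proof -
    have "{z \<in> integer_lattice. lattice_cell (s k) z \<subseteq> B k} \<subseteq> \<phi> k ` (Y \<inter> B k)" using good'[of k] by simp
    then show ?thesis using that by blast
  qed
  have lipF: "dist (F k x) (F k y) \<le> \<Lambda> * dist x y" "dist x y \<le> \<Lambda> * dist (F k x) (F k y)" for k x y
  proof -
    show "dist (F k x) (F k y) \<le> \<Lambda> * dist x y"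
      using bl[of k] lipschitz_onD unfolding bilip_def by blast
    have "dist (G k (F k x)) (G k (F k y)) \<le> \<Lambda> * dist (F k x) (F k y)"
      using bl[of k] lipschitz_onD unfolding bilip_def by blast
    then show "dist x y \<le> \<Lambda> * dist (F k x) (F k y)" using bl[of k] by (simp add: bilip_def)
  qed
  \<comment> \<open>The additive error \<open>2 * D\<close> is absorbed in the first summand by the
    distance of at least 1 between distinct lattice points, in the second by the separation
    \<open>r\<close> of \<open>Y\<close>.\<close>
  define K where "K = \<Lambda> * (s2 + 2 * D) + (\<Lambda> + 2 * D / r) / s1"
  have s2: "0 < s2" using s1 s12[of 0] by linarith
  have K1: "0 < \<Lambda> * (s2 + 2 * D)" and K2: "0 < (\<Lambda> + 2 * D / r) / s1"
    using \<Lambda> D0 s2 s1 r(1) by (simp_all add: add_pos_pos)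
  then have K: "0 < K" by (simp add: K_def)
  have lip: "dist y y' \<le> K * dist (\<phi> k y) (\<phi> k y') \<and> dist (\<phi> k y) (\<phi> k y') \<le> K * dist y y'"
    if y: "y \<in> Y \<inter> B k" "y' \<in> Y \<inter> B k" for k y y'
  proof (cases "y = y'")
    case False
    let ?d = "dist (\<phi> k y) (\<phi> k y')"
    have sd: "dist (s k *\<^sub>R \<phi> k y) (s k *\<^sub>R \<phi> k y') = s k * ?d"
      using s1 s12[of k] by (simp add: dist_norm scaleR_diff_right[symmetric])
    have close: "dist (F k y) (s k *\<^sub>R \<phi> k y) \<le> D" "dist (F k y') (s k *\<^sub>R \<phi> k y') \<le> D"
      using \<phi>(2) y by auto
    have "\<phi> k y - \<phi> k y' \<noteq> 0" using False inj[of k] y by (auto dest: inj_onD)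
    then have d1: "1 \<le> ?d" unfolding dist_norm
      using \<phi>(1) y by (intro integer_lattice_norm_ge_1 integer_lattice_diff) auto
    have "dist (F k y) (F k y') \<le> s k * ?d + 2 * D"
      using close dist_triangle[of "F k y" "F k y'" "s k *\<^sub>R \<phi> k y"]
        dist_triangle[of "s k *\<^sub>R \<phi> k y" "F k y'" "s k *\<^sub>R \<phi> k y'"] sd by (simp add: dist_commute)
    also have "\<dots> \<le> s2 * ?d + 2 * D * ?d"
      using s12[of k] d1 D0 by (intro add_mono mult_right_mono) auto
    finally have "dist (F k y) (F k y') \<le> (s2 + 2 * D) * ?d" by (simp add: algebra_simps)
    then have "\<Lambda> * dist (F k y) (F k y') \<le> \<Lambda> * ((s2 + 2 * D) * ?d)"
      using \<Lambda> by (intro mult_left_mono) auto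
    then have 1: "dist y y' \<le> \<Lambda> * (s2 + 2 * D) * ?d"
      using lipF(2)[of y y' k] by (simp add: mult.assoc)
    have rd: "r \<le> dist y y'" using r(2) y False by blast
    have "s1 * ?d \<le> s k * ?d" using s12[of k] by (intro mult_right_mono) auto
    also have "\<dots> \<le> dist (F k y) (F k y') + 2 * D"
      using close dist_triangle[of "s k *\<^sub>R \<phi> k y" "s k *\<^sub>R \<phi> k y'" "F k y"]
        dist_triangle[of "F k y" "s k *\<^sub>R \<phi> k y'" "F k y'"] sd by (simp add: dist_commute)
    also have "\<dots> \<le> \<Lambda> * dist y y' + (2 * D / r) * dist y y'"
    proof -
      have "2 * D / r * r \<le> (2 * D / r) * dist y y'"
        using rd r(1) D0 by (intro mult_left_mono) auto
      then show ?thesis using lipF(1)[of k y y'] r(1) by simp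
    qed
    finally have 2: "?d \<le> (\<Lambda> + 2 * D / r) / s1 * dist y y'"
      using s1 by (simp add: field_simps)
    have "\<Lambda> * (s2 + 2 * D) * ?d \<le> K * ?d" "(\<Lambda> + 2 * D / r) / s1 * dist y y' \<le> K * dist y y'"
      using K1 K2 by (intro mult_right_mono; simp add: K_def)+
    then show ?thesis using 1 2 by linarith
  qed simp
  have "0 < pts Y (B 0)" by (rule npos)
  then obtain y0 where y0: "y0 \<in> Y" unfolding pts_def by (metis Int_iff card.empty card_gt_0_iff ex_in_conv of_nat_0_less_iff)
  have inB: "x \<in> B k" if "norm x < R k" for x k
  proof -
    have "- R k \<le> x $ i \<and> x $ i < R k" for i using component_le_norm_cart[of x i] that by linarith
    then show ?thesis by (simp add: B_def hbox_def)
  qed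
  have Rinf: "eventually (\<lambda>k. M < R k) sequentially" for M
  proof -
    obtain N :: nat where N: "M < real N * (h / 2)" using reals_Archimedean3[of "h / 2"] h by auto
    show ?thesis
    proof (rule eventually_sequentiallyI)
      fix k assume "N \<le> k"
      have "real N \<le> 2 ^ k" using of_nat_less_two_power[of k] \<open>N \<le> k\<close> by (metis less_eq_real_def of_nat_mono order_trans)
      then have "real N * (h / 2) \<le> 2 ^ k * (h / 2)" using h by (intro mult_right_mono) auto
      then show "M < R k" using N by (simp add: R_def mult.commute)
    qed
  qed
  have evB: "eventually (\<lambda>k. y \<in> B k) sequentially" for y
    using Rinf[of "norm y"] by eventually_elim (rule inB)
  then obtain k0 where k0: "\<And>k. k0 \<le> k \<Longrightarrow> y0 \<in> B k" by (metis eventually_sequentially)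
  \<comment> \<open>Discarding the first \<open>k0\<close> squares puts \<open>y0\<close> into all
    that remain, and subtracting a lattice vector sends it to the origin.\<close>
  define A where "A = (\<lambda>k. Y \<inter> B (k + k0))"
  define \<psi> where "\<psi> = (\<lambda>k y. \<phi> (k + k0) y - \<phi> (k + k0) y0)"
  have y0A: "y0 \<in> A k" for k using k0 y0 by (auto simp: A_def)
  show ?thesis
  proof (rule bilipschitz_limit[OF _ y0 K, where A = A and \<psi> = \<psi>])
    have "Y \<subseteq> (\<Union>k. Y \<inter> B k)"
    proof
      fix y assume "y \<in> Y"
      then show "y \<in> (\<Union>k. Y \<inter> B k)" using eventually_happens[OF evB[of y]] by auto
    qed
    moreover have "countable (\<Union>k. Y \<inter> B k)"
      using fin unfolding B_def by (intro countable_UN) (auto intro: countable_finite)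
    ultimately show "countable Y" by (rule countable_subset)
    show "finite (Y \<inter> cball y0 \<rho>)" for \<rho>
    proof -
      obtain k where k: "norm y0 + \<rho> < R k" using eventually_happens[OF Rinf] by auto
      have "cball y0 \<rho> \<subseteq> B k"
      proof
        fix x assume "x \<in> cball y0 \<rho>"
        then have "norm x \<le> norm y0 + \<rho>"
          using norm_triangle_sub[of x y0] by (simp add: dist_norm norm_minus_commute)
        then show "x \<in> B k" using k by (intro inB) simp
      qed
      then show ?thesis using fin unfolding B_def by (metis finite_subset inf_mono order_refl)
    qed
    show "eventually (\<lambda>k. y \<in> A k) sequentially" if "y \<in> Y" for y
      using evB[of y] that unfolding A_def by (simp add: eventually_sequentially_seg[of "\<lambda>k. y \<in> B k" k0])
    show "A k \<subseteq> Y" for k by (simp add: A_def)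
    show "\<psi> k y \<in> integer_lattice" if "y \<in> A k" for k y
      using that y0A[of k] \<phi>(1) unfolding \<psi>_def A_def by (intro integer_lattice_diff) auto
    show "\<psi> k y0 = 0" for k by (simp add: \<psi>_def)
    show "dist y y' \<le> K * dist (\<psi> k y) (\<psi> k y') \<and> dist (\<psi> k y) (\<psi> k y') \<le> K * dist y y'"
      if "y \<in> A k" "y' \<in> A k" for k y y'
      using lip[of y "k + k0" y'] that by (simp add: A_def \<psi>_def dist_norm)
    show "y0 \<in> A k" for k by (rule y0A)
    fix z :: "real^2" assume z: "z \<in> integer_lattice"
    have "eventually (\<lambda>k. norm y0 + \<Lambda> * (2 * s2 + s2 * norm z + D + 1) < R (k + k0)) sequentially"
      using Rinf[of "norm y0 + \<Lambda> * (2 * s2 + s2 * norm z + D + 1)"]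
      by (simp add: eventually_sequentially_seg[of "\<lambda>k. norm y0 + \<Lambda> * (2 * s2 + s2 * norm z + D + 1) < R k" k0])
    then show "eventually (\<lambda>k. z \<in> \<psi> k ` A k) sequentially"
    proof eventually_elim
      case (elim k)
      let ?k = "k + k0"
      have y0k: "y0 \<in> Y \<inter> B ?k" using y0A[of k] by (simp add: A_def)
      define u where "u = z + \<phi> ?k y0"
      have sk: "0 < s ?k" using s1 s12[of ?k] by linarith
      \<comment> \<open>Outside the square \<open>F\<close> is the identity. A point of this cell
        outside the square would therefore have bounded distance to \<open>y0\<close>, contrary to
        the size of the square.\<close>
      have "lattice_cell (s ?k) u \<subseteq> B ?k"
      proof
        fix p assume p: "p \<in> lattice_cell (s ?k) u"
        show "p \<in> B ?k"
        proof (rule ccontr)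
          assume out': "p \<notin> B ?k"
          have "R ?k \<le> norm p" using out' inB[of p ?k] by force
          then have "R ?k - norm y0 \<le> dist y0 p"
            using norm_triangle_sub[of p y0] by (simp add: dist_norm norm_minus_commute)
          also have "\<dots> \<le> \<Lambda> * dist (F ?k y0) p"
            using lipF(2)[of y0 p ?k] out[OF out'] by simp
          also have "dist (F ?k y0) p \<le> D + s2 * norm z + 2 * s2"
          proof -
            have "dist (F ?k y0) (s ?k *\<^sub>R \<phi> ?k y0) \<le> D" by (rule \<phi>(2)[OF y0k])
            moreover have "dist (s ?k *\<^sub>R \<phi> ?k y0) (s ?k *\<^sub>R u) = s ?k * norm z"
              using sk by (simp add: u_def dist_norm scaleR_add_right)
            moreover have "s ?k * norm z \<le> s2 * norm z" using s12[of ?k] by (intro mult_right_mono) auto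
            moreover have "dist (s ?k *\<^sub>R u) p \<le> 2 * s2"
              using lattice_cell_dist[OF sk p] s12[of ?k] by (simp add: dist_commute)
            ultimately show ?thesis
              using dist_triangle[of "F ?k y0" p "s ?k *\<^sub>R \<phi> ?k y0"]
                dist_triangle[of "s ?k *\<^sub>R \<phi> ?k y0" p "s ?k *\<^sub>R u"] by linarith
          qed
          then have "\<Lambda> * dist (F ?k y0) p \<le> \<Lambda> * (2 * s2 + s2 * norm z + D + 1)"
            using \<Lambda> by (intro mult_left_mono) auto
          finally show False using elim by linarith
        qed
      qed
      moreover have "u \<in> integer_lattice"
        unfolding u_def using z \<phi>(1)[OF y0k] by (rule integer_lattice_add)
      ultimately have "u \<in> \<phi> ?k ` (Y \<inter> B ?k)" by (intro onto)
      then obtain y where "y \<in> A k" "\<phi> ?k y = u" by (auto simp: A_def)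
      then show ?case unfolding u_def \<psi>_def by (intro image_eqI[of _ _ y]) auto
    qed
  qed
qed

section \<open>From small discrepancy to balanced halves\<close>

text \<open>The halves of a dyadic box have equal area, so their counts differ by at most twice the
  discrepancy. Scales run through powers of \<open>sqrt 2\<close> because two successive halvings
  are needed to halve both sides.\<close>

lemma discrepancy_bilipschitz:
  fixes Y :: "(real^2) set"
  assumes \<rho>: "0 < \<rho>" and E: "\<And>k. 0 \<le> E k" "summable E"
    and disc: "\<And>k a b. k0 \<le> k \<Longrightarrow> (\<forall>i. sqrt 2 ^ k \<le> b $ i - a $ i) \<Longrightarrow>
        \<bar>pts Y (hbox a b) - \<rho> * leb (hbox a b)\<bar> \<le> E k * (\<rho> * leb (hbox a b))"
    and fin: "\<And>a b. finite (Y \<inter> hbox a b)"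
    and r: "0 < r" "\<And>y y'. y \<in> Y \<Longrightarrow> y' \<in> Y \<Longrightarrow> y \<noteq> y' \<Longrightarrow> r \<le> dist y y'"
  shows "lattice_bilipschitz Y"
proof -
  let ?m = "leb"
  have "E \<longlonglongrightarrow> 0" using E(2) by (rule summable_LIMSEQ_zero)
  then have "eventually (\<lambda>k. E k < 1/80) sequentially" by (rule order_tendstoD) simp
  then obtain n1 where n1: "\<And>k. n1 \<le> k \<Longrightarrow> E k < 1/80" by (auto simp: eventually_sequentially)
  define N where "N = n1 + k0 + 1"
  define h where "h = (2::real) ^ N"
  \<comment> \<open>A box of level \<open>j\<close> has sides at least
    \<open>h * 2 ^ (j div 2)\<close>; the \<open>- 1\<close> pays for the rounding in
    \<open>j div 2\<close>.\<close>
  define f where "f = (\<lambda>j. 2 * N + j - 1)"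
  have f: "n1 \<le> f j" "k0 \<le> f j" for j by (auto simp: f_def N_def)
  have E1: "E (f j) < 1/80" for j using n1[OF f(1)] .
  have h: "0 < h" by (simp add: h_def)
  have s2: "(2::real) ^ n = sqrt 2 ^ (2 * n)" for n by (simp add: power_mult)
  have side: "sqrt 2 ^ f j \<le> h * 2 ^ (j div 2)" for j
  proof -
    have "sqrt 2 ^ f j \<le> sqrt 2 ^ (2 * (N + j div 2))"
      by (intro power_increasing) (auto simp: f_def)
    also have "\<dots> = 2 ^ (N + j div 2)" by (rule s2[symmetric])
    finally show ?thesis by (simp add: h_def power_add)
  qed
  have mpos: "0 < ?m (hbox a b)" "(\<forall>i. sqrt 2 ^ f j \<le> b $ i - a $ i)" if "dyadic_box h j i a b" for i j a b
  proof -
    have d: "b $ i - a $ i = h * 2 ^ (Suc j div 2)" "b $ (i + 1) - a $ (i + 1) = h * 2 ^ (j div 2)"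
      using that by (auto simp: dyadic_box_def)
    have "0 < b $ i - a $ i" "0 < b $ (i + 1) - a $ (i + 1)" unfolding d using h by simp_all
    then show "0 < ?m (hbox a b)" by (subst measure_hbox2[where i = i]) auto
    have "h * 2 ^ (j div 2) \<le> h * 2 ^ (Suc j div 2)" using h by (intro mult_left_mono power_increasing) auto
    then show "\<forall>i. sqrt 2 ^ f j \<le> b $ i - a $ i"
      unfolding all_axes[of _ i] using d side[of j] by simp
  qed
  have box: "\<bar>pts Y (hbox a b) - \<rho> * ?m (hbox a b)\<bar> \<le> E (f j) * (\<rho> * ?m (hbox a b))"
    if "dyadic_box h j i a b" for i j a b
    using disc[OF f(2) mpos(2)[OF that]] .
  have dens: "pts Y (hbox a b) \<le> 2 * \<rho> * ?m (hbox a b) \<and> \<rho> * ?m (hbox a b) / 2 \<le> pts Y (hbox a b)"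
    if "dyadic_box h j i a b" for i j a b
  proof -
    have p: "0 < \<rho> * ?m (hbox a b)" using \<rho> mpos(1)[OF that] by simp
    have "E (f j) * (\<rho> * ?m (hbox a b)) \<le> (1/80) * (\<rho> * ?m (hbox a b))"
      using E1[of j] p by (intro mult_right_mono) auto
    then show ?thesis using box[OF that] p unfolding abs_le_iff by linarith
  qed
  have npos: "0 < pts Y (hbox a b)" if "dyadic_box h j i a b" for i j a b
    using dens[OF that] mult_pos_pos[OF \<rho> mpos(1)[OF that]] by linarith
  have "halves_balanced Y h (\<lambda>j. 2 * E (f j))"
    unfolding halves_balanced_def
  proof (intro conjI allI impI fin)
    show "0 < pts Y (hbox a b)" if "dyadic_box h k i a b" for k i a b using npos[OF that] .
    fix k i and a b :: "real^2" assume dy: "dyadic_box h (Suc k) i a b"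
    define c where "c = (a $ i + b $ i) / 2"
    define b1 where "b1 = (\<chi> j. if j = i then c else b $ j)"
    define a2 where "a2 = (\<chi> j. if j = i then c else a $ j)"
    have dims: "b $ i - a $ i = 2 * (h * 2 ^ (k div 2))" "b $ (i + 1) - a $ (i + 1) = h * 2 ^ (Suc k div 2)"
      using dy by (simp_all add: dyadic_box_def)
    have "0 < 2 * (h * 2 ^ (k div 2))" "0 < h * 2 ^ (Suc k div 2)" using h by simp_all
    then have pos: "0 < b $ i - a $ i" "0 < b $ (i + 1) - a $ (i + 1)" unfolding dims .
    have ab: "a $ i < b $ i" "a $ (i + 1) < b $ (i + 1)" using pos by simp_all
    note bis = bisect_box[of a i b c b1 a2, OF ab c_def b1_def a2_def]
    have d1: "dyadic_box h k (i + 1) a b1" and d2: "dyadic_box h k (i + 1) a2 b"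
      using bis(6)[OF dy] by simp_all
    note sub = bis(1,2) and nadd = bis(5)[OF fin]
    have meq: "?m (hbox a2 b) = ?m (hbox a b1)" using bis(3,4) by simp
    define X where "X = \<rho> * ?m (hbox a b1)"
    have X: "0 < X" using \<rho> mpos(1)[OF d1] by (simp add: X_def)
    have 1: "\<bar>pts Y (hbox a b1) - X\<bar> \<le> E (f k) * X" "\<bar>pts Y (hbox a2 b) - X\<bar> \<le> E (f k) * X"
      using box[OF d1] box[OF d2] unfolding meq X_def by simp_all
    have "E (f k) * X \<le> (1/80) * X" using E1[of k] X by (intro mult_right_mono) auto
    then have "X \<le> pts Y (hbox a b)" using 1 nadd X unfolding abs_le_iff by linarith
    then have "2 * E (f k) * X \<le> 2 * E (f k) * pts Y (hbox a b)" using E(1)[of "f k"] by (intro mult_left_mono) auto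
    moreover have "\<bar>pts Y (hbox a b1) - pts Y (hbox a2 b)\<bar> \<le> 2 * E (f k) * X" using 1 by linarith
    ultimately have "\<bar>pts Y (hbox a b1) - pts Y (hbox a2 b)\<bar> \<le> 2 * E (f k) * pts Y (hbox a b)" by linarith
    then show "\<bar>pts Y (hbox a b \<inter> {z. z $ i < (a $ i + b $ i) / 2}) -
         pts Y (hbox a b \<inter> {z. (a $ i + b $ i) / 2 \<le> z $ i})\<bar> \<le> 2 * E (f k) * pts Y (hbox a b)"
      unfolding sub c_def .
  qed
  then show ?thesis
  proof (rule balanced_bilipschitz_lattice[OF _ h _ _ _ r, where ?\<alpha>1.0 = "1 / (2 * \<rho>)" and ?\<alpha>2.0 = "2 / \<rho>"])
    show "0 \<le> 2 * E (f k)" for k using E(1) by simp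
    show "2 * E (f k) \<le> 1/40" for k using E1[of k] by simp
    have "(\<lambda>j. E (j + (2 * N - 1))) = (\<lambda>j. E (f j))" by (rule ext) (simp add: f_def N_def add.commute)
    then have "summable (\<lambda>j. E (f j))" using summable_ignore_initial_segment[OF E(2), of "2 * N - 1"] by simp
    then show "summable (\<lambda>j. 2 * E (f j))" by (rule summable_mult)
    show "0 < 1 / (2 * \<rho>)" using \<rho> by simp
    fix k i and a b :: "real^2" assume dy: "dyadic_box h k i a b"
    have "?m (hbox a b) / pts Y (hbox a b) \<le> 2 / \<rho>"
      using dens[OF dy] npos[OF dy] \<rho> by (simp add: field_simps)
    moreover have "1 / (2 * \<rho>) \<le> ?m (hbox a b) / pts Y (hbox a b)"
      using dens[OF dy] npos[OF dy] \<rho> by (simp add: field_simps)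
    ultimately show "1 / (2 * \<rho>) \<le> ?m (hbox a b) / pts Y (hbox a b) \<and> ?m (hbox a b) / pts Y (hbox a b) \<le> 2 / \<rho>"
      by simp
  qed
qed

text \<open>Each power is repeated \<open>q\<close> times, so the terms decay like powers of the
  \<open>q\<close>-th root of \<open>\<theta>\<close>.\<close>

lemma summable_power_div:
  fixes \<theta> :: real
  assumes "0 < \<theta>" "\<theta> < 1" "0 < q"
  shows "summable (\<lambda>k. \<theta> ^ (k div q))"
proof (rule summable_comparison_test')
  define \<eta> where "\<eta> = root q \<theta>"
  have \<eta>: "0 < \<eta>" "\<eta> < 1" "\<eta> ^ q = \<theta>" using assms by (simp_all add: \<eta>_def)
  show "summable (\<lambda>k. \<eta> ^ k / \<theta>)" using \<eta> by (intro summable_divide summable_geometric) simp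
  show "norm (\<theta> ^ (k div q)) \<le> \<eta> ^ k / \<theta>" if "0 \<le> k" for k
  proof -
    have "k \<le> q * (k div q + 1)" using assms(3) by (simp add: dividend_less_times_div less_imp_le)
    then have "\<eta> ^ (q * (k div q + 1)) \<le> \<eta> ^ k" using \<eta> by (intro power_decreasing) auto
    then have "\<theta> ^ (k div q + 1) \<le> \<eta> ^ k" by (simp only: power_mult \<eta>(3))
    then show ?thesis using assms(1) by (simp add: field_simps)
  qed
qed

section \<open>Subdivision of tiles\<close>

text \<open>A substitution in labelled form: \<open>D i\<close> lists position and type of the
  prototiles that make up the inflated \<open>S i\<close>. Counting then concerns pairs, with no
  question of which sets coincide.\<close>

locale tile_system =
  fixes \<xi> :: real and S :: "'k::finite \<Rightarrow> (real^2) set" and D :: "'k \<Rightarrow> ((real^2) \<times> 'k) set"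
  assumes \<xi>: "1 < \<xi>"
    and compact_S: "\<And>i. compact (S i)"
    and interior_S: "\<And>i. interior (S i) \<noteq> {}"
    and D_cover: "\<And>i. (\<lambda>x. \<xi> *\<^sub>R x) ` S i = (\<Union>(d, j)\<in>D i. (+) d ` S j)"
    and D_disjoint: "\<And>i d j d' j'. (d, j) \<in> D i \<Longrightarrow> (d', j') \<in> D i \<Longrightarrow> (d, j) \<noteq> (d', j') \<Longrightarrow>
        interior ((+) d ` S j) \<inter> interior ((+) d' ` S j') = {}"
begin

text \<open>A pair \<open>(x, i)\<close> stands for the tile \<open>x + S i\<close>; \<open>K l i\<close> is the patch obtained from \<open>S i\<close> by
  \<open>l\<close> rounds of inflation and subdivision, and \<open>G l t\<close> is the one obtained from the tile \<open>t\<close>.\<close>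

definition T :: "(real^2) \<times> 'k \<Rightarrow> (real^2) set" where
  "T t = (+) (fst t) ` S (snd t)"

definition shift :: "real^2 \<Rightarrow> (real^2) \<times> 'k \<Rightarrow> (real^2) \<times> 'k" where
  "shift c t = (c + fst t, snd t)"

definition subdiv :: "((real^2) \<times> 'k) set \<Rightarrow> ((real^2) \<times> 'k) set" where
  "subdiv P = (\<Union>t\<in>P. shift (\<xi> *\<^sub>R fst t) ` D (snd t))"

definition K :: "nat \<Rightarrow> 'k \<Rightarrow> ((real^2) \<times> 'k) set" where
  "K l i = (subdiv ^^ l) {(0, i)}"

definition G :: "nat \<Rightarrow> (real^2) \<times> 'k \<Rightarrow> ((real^2) \<times> 'k) set" where
  "G l t = shift (\<xi> ^ l *\<^sub>R fst t) ` K l (snd t)"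

definition packed :: "((real^2) \<times> 'k) set \<Rightarrow> bool" where
  "packed P \<longleftrightarrow> (\<forall>t\<in>P. \<forall>t'\<in>P. t \<noteq> t' \<longrightarrow> interior (T t) \<inter> interior (T t') = {})"

text \<open>Two areas for each prototile, without and with its frontier. Interiors of packed tiles
  have total area at most that of the region, full tiles of a covering at least that much. The two
  estimates meet only after \<open>area'_eq_area\<close>.\<close>

definition area :: "'k \<Rightarrow> real" where "area i = leb (interior (S i))"
definition area' :: "'k \<Rightarrow> real" where "area' i = leb (S i)"

abbreviation scale :: "nat \<Rightarrow> real^2 \<Rightarrow> real^2" where "scale l \<equiv> (\<lambda>x. \<xi> ^ l *\<^sub>R x)"

section \<open>Areas and iterated patches of labelled tiles\<close>

lemma T_shift: "T (shift c t) = (+) c ` T t"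
  by (auto simp: T_def shift_def image_image add.assoc)

lemma shift_shift: "shift c (shift d t) = shift (c + d) t"
  by (simp add: shift_def add.assoc)

lemma inj_shift: "inj (shift c)"
  by (auto simp: inj_def shift_def prod_eq_iff)

lemma interior_scale: "interior (scale l ` X) = scale l ` interior X"
  using \<xi> by (intro interior_injective_linear_image) (auto simp: inj_def linear_scaleR)

lemma measure_scale: "leb (scale l ` X) = \<xi> ^ (2 * l) * leb X"
  using measure_lebesgue_affine[of "\<xi> ^ l" 0 X] \<xi>
  by (simp add: power_mult[symmetric] mult.commute)

lemma compact_T: "compact (T t)"
  unfolding T_def using compact_S by (rule compact_translation)

lemma T_lmeasurable: "T t \<in> lmeasurable" "interior (T t) \<in> lmeasurable"
  using compact_T[of t] by (auto intro: lmeasurable_compact lmeasurable_interior compact_imp_bounded)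

lemma measure_T: "leb (T t) = area' (snd t)" "leb (interior (T t)) = area (snd t)"
  by (simp_all add: T_def area_def area'_def interior_translation measure_translation)

lemma area_pos: "0 < area i"
proof -
  have "\<not> negligible (interior (S i))" using interior_S by (intro open_not_negligible) auto
  moreover have "interior (S i) \<in> lmeasurable"
    using compact_S[of i] by (intro lmeasurable_interior compact_imp_bounded)
  ultimately show ?thesis unfolding area_def by (metis negligible_iff_measure zero_less_measure_iff)
qed

lemma area_le: "area i \<le> area' i"
  unfolding area_def area'_def using compact_S[of i]
  by (intro measure_mono_fmeasurable interior_subset)
     (auto intro: lmeasurable_compact lmeasurable_interior compact_imp_bounded fmeasurableD)

lemma packed_area_le:
  assumes "finite P" "packed P" "(\<Union>t\<in>P. interior (T t)) \<subseteq> U" "U \<in> lmeasurable"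
  shows "(\<Sum>t\<in>P. area (snd t)) \<le> leb U"
proof -
  have "leb (\<Union>t\<in>P. interior (T t)) = (\<Sum>t\<in>P. leb (interior (T t)))"
  proof (rule measure_UNION'[OF assms(1) T_lmeasurable(2)])
    show "pairwise (\<lambda>i j. disjnt (interior (T i)) (interior (T j))) P"
      using assms(2) unfolding packed_def pairwise_def disjnt_def by blast
  qed
  then have "(\<Sum>t\<in>P. area (snd t)) = leb (\<Union>t\<in>P. interior (T t))"
    by (simp add: measure_T)
  also have "\<dots> \<le> leb U"
    using assms by (intro measure_mono_fmeasurable) auto
  finally show ?thesis .
qed

lemma cover_area_ge:
  assumes "finite P" "U \<subseteq> (\<Union>t\<in>P. T t)" "U \<in> lmeasurable"
  shows "leb U \<le> (\<Sum>t\<in>P. area' (snd t))"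
proof -
  have "leb U \<le> leb (\<Union>t\<in>P. T t)"
    using assms T_lmeasurable(1) by (intro measure_mono_fmeasurable fmeasurable.finite_UN) (auto dest: fmeasurableD)
  also have "\<dots> \<le> (\<Sum>t\<in>P. leb (T t))"
    using assms T_lmeasurable(1) by (intro measure_UNION_le) (auto dest: fmeasurableD)
  finally show ?thesis by (simp add: measure_T)
qed

lemma scale1: "scale 1 ` T t = (\<Union>t'\<in>shift (\<xi> *\<^sub>R fst t) ` D (snd t). T t')"
proof -
  have "scale 1 ` T t = (+) (\<xi> *\<^sub>R fst t) ` ((\<lambda>x. \<xi> *\<^sub>R x) ` S (snd t))"
    by (simp add: T_def image_image scaleR_add_right)
  also have "\<dots> = (\<Union>t'\<in>D (snd t). (+) (\<xi> *\<^sub>R fst t) ` T t')"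
    unfolding D_cover image_UN by (auto simp: T_def split_def)
  finally show ?thesis by (simp add: T_shift)
qed

lemma subdiv_cover: "(\<Union>t\<in>subdiv P. T t) = scale 1 ` (\<Union>t\<in>P. T t)"
proof -
  have "scale 1 ` (\<Union>t\<in>P. T t) = (\<Union>t\<in>P. scale 1 ` T t)" by blast
  then show ?thesis unfolding scale1 by (simp add: subdiv_def)
qed

lemma K_cover: "(\<Union>t\<in>K l i. T t) = scale l ` S i"
proof (induction l)
  case 0 then show ?case by (simp add: K_def T_def)
next
  case (Suc l)
  have "(\<Union>t\<in>K (Suc l) i. T t) = scale 1 ` (\<Union>t\<in>K l i. T t)"
    using subdiv_cover[of "K l i"] by (simp add: K_def)
  then show ?case using Suc by (simp add: image_image)
qed

lemma packed_shift:
  assumes "packed P" shows "packed (shift c ` P)"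
  unfolding packed_def
proof (intro ballI impI)
  fix \<mu> \<mu>' assume "\<mu> \<in> shift c ` P" "\<mu>' \<in> shift c ` P" "\<mu> \<noteq> \<mu>'"
  then obtain t t' where "\<mu> = shift c t" "\<mu>' = shift c t'" "t \<in> P" "t' \<in> P" "t \<noteq> t'" by blast
  moreover from this have "interior (T t) \<inter> interior (T t') = {}" using assms by (simp add: packed_def)
  then have "(+) c ` interior (T t) \<inter> (+) c ` interior (T t') = {}" by auto
  ultimately show "interior (T \<mu>) \<inter> interior (T \<mu>') = {}"
    by (simp add: T_shift interior_translation)
qed

lemma packed_D: "packed (D i)"
  unfolding packed_def T_def
proof (intro ballI impI)
  fix t t' assume "t \<in> D i" "t' \<in> D i" "t \<noteq> t'"
  then show "interior ((+) (fst t) ` S (snd t)) \<inter> interior ((+) (fst t') ` S (snd t')) = {}"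
    using D_disjoint[of "fst t" "snd t" i "fst t'" "snd t'"] by simp
qed

lemma packed_subdiv:
  assumes "packed P" shows "packed (subdiv P)"
  unfolding packed_def
proof (intro ballI impI)
  fix \<mu> \<mu>' assume \<mu>: "\<mu> \<in> subdiv P" "\<mu>' \<in> subdiv P" "\<mu> \<noteq> \<mu>'"
  obtain t where t: "t \<in> P" "\<mu> \<in> shift (\<xi> *\<^sub>R fst t) ` D (snd t)" using \<mu>(1) by (auto simp: subdiv_def)
  obtain t' where t': "t' \<in> P" "\<mu>' \<in> shift (\<xi> *\<^sub>R fst t') ` D (snd t')" using \<mu>(2) by (auto simp: subdiv_def)
  show "interior (T \<mu>) \<inter> interior (T \<mu>') = {}"
  proof (cases "t = t'")
    case True
    then show ?thesis using packed_shift[OF packed_D] t t' \<mu>(3) unfolding packed_def by blast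
  next
    case False
    have "T \<mu> \<subseteq> scale 1 ` T t" "T \<mu>' \<subseteq> scale 1 ` T t'" using t(2) t'(2) unfolding scale1 by blast+
    then have sub: "interior (T \<mu>) \<subseteq> scale 1 ` interior (T t)" "interior (T \<mu>') \<subseteq> scale 1 ` interior (T t')"
      unfolding interior_scale[symmetric] by (simp_all only: interior_mono)
    have "interior (T t) \<inter> interior (T t') = {}" using assms t(1) t'(1) False unfolding packed_def by blast
    then have "scale 1 ` interior (T t) \<inter> scale 1 ` interior (T t') = {}" using \<xi> by auto
    then show ?thesis using sub by blast
  qed
qed

text \<open>Disjoint interiors with areas bounded below by \<open>\<alpha>\<close> fit only finitely
  often into the compact inflated prototile.\<close>

lemma finite_D: "finite (D i)"
proof -
  let ?U = "scale 1 ` S i"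
  have U: "?U \<in> lmeasurable"
    using compact_S[of i] by (intro lmeasurable_compact compact_scaling)
  define \<alpha> where "\<alpha> = Min (range area)"
  have \<alpha>: "0 < \<alpha>" "\<And>j. \<alpha> \<le> area j" using area_pos by (auto simp: \<alpha>_def)
  have "finite (D i) \<and> card (D i) \<le> nat \<lceil>leb ?U / \<alpha>\<rceil>"
  proof (rule finite_if_finite_subsets_card_bdd)
    fix P assume P: "P \<subseteq> D i" "finite P"
    have "real (card P) * \<alpha> = (\<Sum>t\<in>P. \<alpha>)" by simp
    also have "\<dots> \<le> (\<Sum>t\<in>P. area (snd t))" using \<alpha> by (intro sum_mono)
    also have "\<dots> \<le> leb ?U"
    proof (rule packed_area_le[OF P(2) _ _ U])
      show "packed P" using packed_D[of i] P(1) unfolding packed_def by blast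
      have "(\<Union>t\<in>D i. T t) = ?U" using D_cover[of i] by (auto simp: T_def)
      then show "(\<Union>t\<in>P. interior (T t)) \<subseteq> ?U" using P(1) interior_subset by blast
    qed
    finally have "real (card P) \<le> leb ?U / \<alpha>" using \<alpha> by (simp add: field_simps)
    then show "card P \<le> nat \<lceil>leb ?U / \<alpha>\<rceil>" by linarith
  qed
  then show ?thesis ..
qed

lemma finite_packed_K: "finite (K l i)" "packed (K l i)"
proof (induction l)
  case 0
  show "finite (K 0 i)" "packed (K 0 i)" by (simp_all add: K_def packed_def)
next
  case (Suc l)
  have "K (Suc l) i = subdiv (K l i)" by (simp add: K_def)
  then show "finite (K (Suc l) i)" "packed (K (Suc l) i)"
    using Suc packed_subdiv finite_D by (auto simp: subdiv_def)
qed

lemma scale_lmeasurable: "scale l ` S i \<in> lmeasurable" "scale l ` interior (S i) \<in> lmeasurable"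
proof -
  have "compact (scale l ` S i)" using compact_S by (rule compact_scaling)
  then show "scale l ` S i \<in> lmeasurable" "scale l ` interior (S i) \<in> lmeasurable"
    unfolding interior_scale[symmetric]
    by (auto intro: lmeasurable_compact lmeasurable_interior compact_imp_bounded)
qed

lemma interior_K_subset: "(\<Union>t\<in>K l i. interior (T t)) \<subseteq> scale l ` interior (S i)"
  unfolding interior_scale[symmetric] K_cover[symmetric]
  by (intro interior_maximal open_UN ballI open_interior UN_mono interior_subset order_refl)

lemma sum_area_K_le: "(\<Sum>t\<in>K l i. area (snd t)) \<le> \<xi> ^ (2 * l) * area i"
  using packed_area_le[OF finite_packed_K interior_K_subset scale_lmeasurable(2)]
  by (simp add: measure_scale area_def)

lemma sum_area'_K_ge: "\<xi> ^ (2 * l) * area' i \<le> (\<Sum>t\<in>K l i. area' (snd t))"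
  using cover_area_ge[OF finite_packed_K(1) _ scale_lmeasurable(1), of l i l i] K_cover[of l i]
  by (simp add: measure_scale area'_def)

section \<open>Frontiers of tiles are null sets\<close>

lemma diameter_bound: "\<exists>d>0. \<forall>t. \<forall>x\<in>T t. \<forall>y\<in>T t. dist x y \<le> d"
proof -
  have "bounded (\<Union>i. S i)" using compact_S compact_imp_bounded by (intro bounded_UN) auto
  then obtain b where b: "0 < b" "\<And>i x. x \<in> S i \<Longrightarrow> norm x \<le> b" unfolding bounded_pos by blast
  have "dist x y \<le> 2 * b" if "x \<in> T t" "y \<in> T t" for x y t
  proof -
    obtain u v where "u \<in> S (snd t)" "v \<in> S (snd t)" "x = fst t + u" "y = fst t + v"
      using \<open>x \<in> T t\<close> \<open>y \<in> T t\<close> by (auto simp: T_def)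
    then show ?thesis using b(2)[of u] b(2)[of v] norm_triangle_ineq4[of u v] by (simp add: dist_norm) force
  qed
  then show ?thesis using b(1) by (intro exI[of _ "2 * b"]) auto
qed

lemma interior_T_nonempty: "interior (T t) \<noteq> {}"
  by (simp add: T_def interior_translation interior_S)

text \<open>Inclusion-exclusion for \<open>T t0\<close> and the union of the other tiles: the area
  of the overlap is at most the excess of the sum of areas over the area of the union.\<close>

lemma overlap_null:
  assumes "finite P" "t0 \<in> P" "(\<Sum>t\<in>P. area' (snd t)) \<le> leb (\<Union>t\<in>P. T t)"
  shows "leb (T t0 \<inter> (\<Union>t\<in>P - {t0}. T t)) = 0"
proof -
  let ?m = "leb"
  define W where "W = (\<Union>t\<in>P - {t0}. T t)"
  have W: "W \<in> lmeasurable" unfolding W_def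
    using assms(1) T_lmeasurable(1) by (intro fmeasurable.finite_UN) auto
  have "(\<Union>t\<in>P. T t) = T t0 \<union> W" using assms(2) by (auto simp: W_def)
  moreover have "?m (T t0 \<union> W) = ?m (T t0) + ?m W - ?m (T t0 \<inter> W)"
    by (rule measure_Un3[OF T_lmeasurable(1) W])
  moreover have "?m W \<le> (\<Sum>t\<in>P - {t0}. area' (snd t))"
    by (rule cover_area_ge) (use assms(1) W in \<open>auto simp: W_def\<close>)
  moreover have "(\<Sum>t\<in>P. area' (snd t)) = ?m (T t0) + (\<Sum>t\<in>P - {t0}. area' (snd t))"
    using assms(1,2) by (simp add: sum.remove measure_T)
  ultimately have "?m (T t0 \<inter> W) \<le> 0" using assms(3) by simp
  then show ?thesis unfolding W_def using measure_nonneg[of lebesgue] by (meson antisym)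
qed

text \<open>Subdividing a prototile that maximises the ratio of total to interior area must be
  lossless in both areas. Hence any subtile in the interior of that prototile has a null frontier,
  so the maximal ratio is 1.\<close>

lemma area'_eq_area: "area' i = area i"
proof -
  let ?m = "leb"
  define \<rho> where "\<rho> = Max (range (\<lambda>i. area' i / area i))"
  have "\<rho> \<in> range (\<lambda>i. area' i / area i)" unfolding \<rho>_def by (intro Max_in) auto
  then obtain j where j: "\<rho> = area' j / area j" by auto
  have t_ub: "area' i \<le> \<rho> * area i" for i
  proof -
    have "area' i / area i \<le> \<rho>" unfolding \<rho>_def by (intro Max_ge) auto
    then show ?thesis using area_pos[of i] by (simp add: divide_le_eq)
  qed
  have tj: "area' j = \<rho> * area j" using j area_pos[of j] by simp
  have rpos: "0 < \<rho>" using j area_pos[of j] area_le[of j] by simp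
  have eqs: "(\<Sum>t\<in>K l j. area (snd t)) = \<xi> ^ (2 * l) * area j"
      "(\<Sum>t\<in>K l j. area' (snd t)) = \<xi> ^ (2 * l) * area' j"
      "(\<Sum>t\<in>K l j. area' (snd t)) = (\<Sum>t\<in>K l j. \<rho> * area (snd t))" for l
  proof -
    \<comment> \<open>The chain from \<open>sum_area'_K_ge\<close> through 1 to 4 begins and ends
      with \<open>\<xi> ^ (2 * l) * area' j\<close>, so every link is an equality.\<close>
    have 1: "(\<Sum>t\<in>K l j. area' (snd t)) \<le> (\<Sum>t\<in>K l j. \<rho> * area (snd t))"
      by (intro sum_mono t_ub)
    have 2: "(\<Sum>t\<in>K l j. \<rho> * area (snd t)) = \<rho> * (\<Sum>t\<in>K l j. area (snd t))"
      by (simp add: sum_distrib_left)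
    have 3: "\<rho> * (\<Sum>t\<in>K l j. area (snd t)) \<le> \<rho> * (\<xi> ^ (2 * l) * area j)"
      using rpos sum_area_K_le by (intro mult_left_mono) auto
    have 4: "\<rho> * (\<xi> ^ (2 * l) * area j) = \<xi> ^ (2 * l) * area' j" by (simp add: tj)
    have "\<rho> * (\<Sum>t\<in>K l j. area (snd t)) = \<rho> * (\<xi> ^ (2 * l) * area j)"
      using 1 2 3 4 sum_area'_K_ge[of l j] by linarith
    then show "(\<Sum>t\<in>K l j. area (snd t)) = \<xi> ^ (2 * l) * area j" using rpos by simp
    show "(\<Sum>t\<in>K l j. area' (snd t)) = \<xi> ^ (2 * l) * area' j"
      "(\<Sum>t\<in>K l j. area' (snd t)) = (\<Sum>t\<in>K l j. \<rho> * area (snd t))"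
      using 1 2 3 4 sum_area'_K_ge[of l j] by linarith+
  qed
  have "\<rho> \<le> 1"
  proof -
    obtain d where d: "0 < d" "\<And>t x y. x \<in> T t \<Longrightarrow> y \<in> T t \<Longrightarrow> dist x y \<le> d"
      using diameter_bound by blast
    obtain x0 where "x0 \<in> interior (S j)" using interior_S by blast
    then obtain r where r: "0 < r" "ball x0 r \<subseteq> interior (S j)"
      using open_contains_ball open_interior by blast
    obtain l where l: "d / r < \<xi> ^ l" using real_arch_pow[OF \<xi>] by blast
    have "x0 \<in> S j" using r interior_subset by (metis centre_in_ball subsetD)
    then have "scale l x0 \<in> (\<Union>t\<in>K l j. T t)" unfolding K_cover by blast
    then obtain t0 where t0: "t0 \<in> K l j" "scale l x0 \<in> T t0" by blast
    define O' where "O' = scale l ` interior (S j)"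
    define V where "V = (\<Union>t\<in>K l j. interior (T t))"
    define W where "W = (\<Union>t\<in>K l j - {t0}. T t)"
    have \<xi>l: "0 < \<xi> ^ l" using \<xi> by simp
    have inO: "T t0 \<subseteq> O'"
    proof
      fix y assume y: "y \<in> T t0"
      define x where "x = (1 / \<xi> ^ l) *\<^sub>R y"
      have yx: "y = scale l x" using \<xi> by (simp add: x_def)
      have "\<xi> ^ l * dist x0 x = dist (scale l x0) y"
        using \<xi>l by (simp add: yx dist_norm scaleR_diff_right[symmetric])
      also have "\<dots> \<le> d" using d(2)[OF t0(2) y] .
      also have "d < \<xi> ^ l * r" using l r(1) by (simp add: divide_less_eq)
      finally have "dist x0 x < r" using \<xi>l by simp
      then show "y \<in> O'" using r(2) yx by (auto simp: O'_def)
    qed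
    have Vm: "V \<in> lmeasurable" unfolding V_def
      using finite_packed_K(1) T_lmeasurable(2) by (intro fmeasurable.finite_UN) auto
    have Om: "O' \<in> lmeasurable" unfolding O'_def by (rule scale_lmeasurable)
    have VO: "V \<subseteq> O'" unfolding V_def O'_def by (rule interior_K_subset)
    \<comment> \<open>By the first equality of \<open>eqs\<close> the packed interiors fill the
      interior of the inflated prototile up to a null set.\<close>
    have "?m O' = (\<Sum>t\<in>K l j. area (snd t))" using eqs(1)[of l] by (simp add: O'_def measure_scale area_def)
    also have "\<dots> \<le> ?m V"
      unfolding V_def by (rule packed_area_le[OF finite_packed_K]) (use Vm in \<open>auto simp: V_def\<close>)
    finally have "?m (O' - V) = 0"
      using measurable_measure_Diff[OF Om _ VO] Vm measure_nonneg[of lebesgue "O' - V"] by (simp add: fmeasurableD)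
    then have N1: "negligible (O' - V)"
      using Om Vm by (simp add: negligible_iff_measure fmeasurable_Diff fmeasurableD)
    have "?m (T t0 \<inter> W) = 0" unfolding W_def
    proof (rule overlap_null[OF finite_packed_K(1) t0(1)])
      show "(\<Sum>t\<in>K l j. area' (snd t)) \<le> ?m (\<Union>t\<in>K l j. T t)"
        using eqs(2)[of l] by (simp add: K_cover measure_scale area'_def)
    qed
    moreover have "W \<in> lmeasurable" unfolding W_def
      using finite_packed_K(1) T_lmeasurable(1) by (intro fmeasurable.finite_UN) auto
    ultimately have N2: "negligible (T t0 \<inter> W)"
      using T_lmeasurable(1) by (simp add: negligible_iff_measure fmeasurable_Int_fmeasurable fmeasurableD)
    \<comment> \<open>A frontier point of \<open>t0\<close> is either interior to another tile,
      hence in a null overlap, or interior to none, hence in the null set left uncovered by the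
      interiors.\<close>
    have "T t0 - interior (T t0) \<subseteq> (O' - V) \<union> (T t0 \<inter> W)"
    proof
      fix x assume x: "x \<in> T t0 - interior (T t0)"
      show "x \<in> (O' - V) \<union> (T t0 \<inter> W)"
      proof (cases "x \<in> V")
        case True
        then obtain t where t: "t \<in> K l j" "x \<in> interior (T t)" by (auto simp: V_def)
        then have "t \<noteq> t0" using x by blast
        then have "x \<in> W" using t interior_subset unfolding W_def by blast
        then show ?thesis using x by blast
      next
        case False
        then show ?thesis using x inO by blast
      qed
    qed
    then have N: "negligible (T t0 - interior (T t0))"
      using N1 N2 negligible_subset negligible_Un by blast
    have "?m (T t0) = ?m (interior (T t0) \<union> (T t0 - interior (T t0)))"
      using interior_subset[of "T t0"] by (simp add: Un_absorb1)
    also have "\<dots> \<le> ?m (interior (T t0)) + ?m (T t0 - interior (T t0))"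
      using N T_lmeasurable(2)[of t0] by (intro measure_Un_le) (auto simp: fmeasurableD negligible_imp_sets)
    also have "?m (T t0 - interior (T t0)) = 0" using N by (rule negligible_imp_measure0)
    finally have "?m (T t0) = ?m (interior (T t0))"
      using area_le[of "snd t0"] by (simp add: measure_T)
    then have 1: "area' (snd t0) = area (snd t0)" by (simp add: measure_T)
    \<comment> \<open>The termwise bounds by \<open>\<rho>\<close> sum up to an equality, so each
      tile attains its bound.\<close>
    have "area' (snd t0) = \<rho> * area (snd t0)"
    proof (rule ccontr)
      assume "area' (snd t0) \<noteq> \<rho> * area (snd t0)"
      then have "area' (snd t0) < \<rho> * area (snd t0)" using t_ub[of "snd t0"] by simp
      then have "(\<Sum>t\<in>K l j. area' (snd t)) < (\<Sum>t\<in>K l j. \<rho> * area (snd t))"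
        using t0(1) t_ub finite_packed_K(1) by (intro sum_strict_mono_ex1) auto
      then show False using eqs(3)[of l] by simp
    qed
    then show ?thesis using 1 area_pos[of "snd t0"] by simp
  qed
  then have "\<rho> * area i \<le> area i" using area_pos[of i] by simp
  then show ?thesis using t_ub[of i] area_le[of i] by linarith
qed

lemma sum_area_K: "(\<Sum>t\<in>K l i. area (snd t)) = \<xi> ^ (2 * l) * area i"
  using sum_area_K_le[of l i] sum_area'_K_ge[of l i] unfolding area'_eq_area by linarith

section \<open>Supertiles and the density of tiles in them\<close>

lemma subdiv_UN: "subdiv (\<Union>x\<in>A. P x) = (\<Union>x\<in>A. subdiv (P x))"
  by (simp add: subdiv_def)

lemma subdiv_shift: "subdiv (shift c ` P) = shift (\<xi> *\<^sub>R c) ` subdiv P"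
  by (simp add: subdiv_def image_UN image_image shift_shift)
     (simp add: shift_def scaleR_add_right)

text \<open>The first \<open>n\<close> rounds fix the arrangement of supertiles and the last
  \<open>l\<close> rounds fill each of them, so the patch is a union of supertiles of level
  \<open>l\<close>.\<close>

lemma K_add: "K (l + n) i = (\<Union>t\<in>K n i. G l t)"
proof (induction l)
  case 0
  have "G 0 t = {t}" for t by (simp add: G_def K_def shift_def)
  then show ?case by simp
next
  case (Suc l)
  have "K (Suc l + n) i = subdiv (K (l + n) i)" by (simp add: K_def)
  also have "\<dots> = (\<Union>t\<in>K n i. subdiv (G l t))" unfolding Suc by (rule subdiv_UN)
  also have "\<dots> = (\<Union>t\<in>K n i. G (Suc l) t)"
    unfolding G_def subdiv_shift by (simp add: K_def)
  finally show ?case .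
qed

lemma G_cover: "(\<Union>\<mu>\<in>G l t. T \<mu>) = scale l ` T t"
proof -
  have "(\<Union>\<mu>\<in>G l t. T \<mu>) = (+) (scale l (fst t)) ` (\<Union>\<mu>\<in>K l (snd t). T \<mu>)"
    by (simp add: G_def T_shift image_UN)
  then show ?thesis unfolding K_cover by (simp add: T_def image_image scaleR_add_right)
qed

lemma card_G: "card (G l t) = card (K l (snd t))" and finite_G: "finite (G l t)"
proof -
  show "card (G l t) = card (K l (snd t))"
    unfolding G_def by (rule card_image[OF inj_on_subset[OF inj_shift]]) simp
  show "finite (G l t)" unfolding G_def using finite_packed_K(1) by simp
qed

text \<open>A common tile would have its nonempty interior inside the inflated interiors of both
  \<open>t\<close> and \<open>t'\<close>.\<close>

lemma G_disjoint:
  assumes "packed P" "t \<in> P" "t' \<in> P" "t \<noteq> t'"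
  shows "G l t \<inter> G l t' = {}"
proof (rule ccontr)
  assume "G l t \<inter> G l t' \<noteq> {}"
  then obtain \<mu> where "\<mu> \<in> G l t" "\<mu> \<in> G l t'" by blast
  then have "T \<mu> \<subseteq> scale l ` T t" "T \<mu> \<subseteq> scale l ` T t'" unfolding G_cover[symmetric] by blast+
  then have "interior (T \<mu>) \<subseteq> scale l ` interior (T t)" "interior (T \<mu>) \<subseteq> scale l ` interior (T t')"
    unfolding interior_scale[symmetric] by (simp_all only: interior_mono)
  moreover have "interior (T t) \<inter> interior (T t') = {}" using assms unfolding packed_def by blast
  then have "scale l ` interior (T t) \<inter> scale l ` interior (T t') = {}" using \<xi> by auto
  ultimately show False using interior_T_nonempty[of \<mu>] by blast
qed

lemma card_UN_G:
  assumes "P \<subseteq> K n i" shows "card (\<Union>t\<in>P. G l t) = (\<Sum>t\<in>P. card (K l (snd t)))"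
proof -
  have "card (\<Union>t\<in>P. G l t) = (\<Sum>t\<in>P. card (G l t))"
  proof (rule card_UN_disjoint)
    show "finite P" using assms finite_packed_K(1) finite_subset by blast
    show "\<forall>t\<in>P. finite (G l t)" by (simp add: finite_G)
    show "\<forall>t\<in>P. \<forall>t'\<in>P. t \<noteq> t' \<longrightarrow> G l t \<inter> G l t' = {}"
      using assms G_disjoint[OF finite_packed_K(2)] by blast
  qed
  then show ?thesis by (simp add: card_G)
qed

text \<open>The density of tiles in the supertile of level \<open>l\<close> and type
  \<open>j\<close>, whose area is \<open>area j * \<xi> ^ (2 * l)\<close>.\<close>

definition count_ratio :: "nat \<Rightarrow> 'k \<Rightarrow> real" where
  "count_ratio l j = real (card (K l j)) / (area j * \<xi> ^ (2 * l))"

text \<open>Cutting the large supertile into supertiles of level \<open>l\<close> makes its density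
  the mean of theirs, weighted by their shares of the area.\<close>

lemma count_ratio_add:
  "count_ratio (l + m) j = (\<Sum>t\<in>K m j. area (snd t) / (area j * \<xi> ^ (2 * m)) * count_ratio l (snd t))"
proof -
  have "real (card (K (l + m) j)) = (\<Sum>t\<in>K m j. real (card (K l (snd t))))"
    unfolding K_add by (simp add: card_UN_G[OF order_refl])
  then have "count_ratio (l + m) j = (\<Sum>t\<in>K m j. real (card (K l (snd t))) / (area j * \<xi> ^ (2 * (l + m))))"
    by (simp add: count_ratio_def sum_divide_distrib)
  also have "\<dots> = (\<Sum>t\<in>K m j. area (snd t) / (area j * \<xi> ^ (2 * m)) * count_ratio l (snd t))"
  proof (rule sum.cong[OF refl])
    fix t
    have "0 < area (snd t)" "0 < area j" "0 < \<xi>" using area_pos \<xi> by auto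
    then show "real (card (K l (snd t))) / (area j * \<xi> ^ (2 * (l + m))) =
        area (snd t) / (area j * \<xi> ^ (2 * m)) * count_ratio l (snd t)"
      by (simp add: count_ratio_def power_add distrib_left)
  qed
  finally show ?thesis .
qed

lemma weights_sum: "(\<Sum>t\<in>K m j. area (snd t) / (area j * \<xi> ^ (2 * m))) = 1"
  using sum_area_K[of m j] area_pos[of j] \<xi> by (simp add: sum_divide_distrib[symmetric])

text \<open>Passing from level \<open>l\<close> to level \<open>l + m\<close> replaces the count ratios by averages with uniformly
  positive weights, so their oscillation contracts.\<close>

lemma count_ratio_converges:
  assumes prim: "\<And>i j. \<exists>d. (d, i) \<in> K m j"
  shows "\<exists>\<rho> C \<theta>. 0 < \<rho> \<and> 0 \<le> C \<and> 0 < \<theta> \<and> \<theta> < 1 \<and> (\<forall>k j. \<bar>count_ratio (k * m) j - \<rho>\<bar> \<le> C * \<theta> ^ k)"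
proof -
  let ?w = "\<lambda>t j. area (snd t) / (area j * \<xi> ^ (2 * m))"
  define x where "x = (\<lambda>k. count_ratio (k * m))"
  define Lo where "Lo = (\<lambda>k. Min (range (x k)))"
  define Hi where "Hi = (\<lambda>k. Max (range (x k)))"
  have lohi: "Lo k \<le> x k j" "x k j \<le> Hi k" for k j by (simp_all add: Lo_def Hi_def)
  have w0: "0 < ?w t j" for t j using area_pos \<xi> by simp
  \<comment> \<open>Half of the smallest weight, which keeps the contraction factor
    \<open>1 - \<epsilon>\<close> strictly positive.\<close>
  define \<epsilon> where "\<epsilon> = Min (range (\<lambda>(i, j). area i / (area j * \<xi> ^ (2 * m)))) / 2"
  have \<epsilon>: "0 < \<epsilon>" "2 * \<epsilon> \<le> area i / (area j * \<xi> ^ (2 * m))" for i j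
  proof -
    have "\<forall>y\<in>range (\<lambda>(i, j). area i / (area j * \<xi> ^ (2 * m))). 0 < y" using area_pos \<xi> by auto
    then show "0 < \<epsilon>" unfolding \<epsilon>_def by (subst zero_less_divide_iff) (auto simp: Min_gr_iff)
    have "Min (range (\<lambda>(i, j). area i / (area j * \<xi> ^ (2 * m)))) \<le> area i / (area j * \<xi> ^ (2 * m))"
      by (rule Min_le) (auto intro!: image_eqI[of _ _ "(i, j)"])
    then show "2 * \<epsilon> \<le> area i / (area j * \<xi> ^ (2 * m))" by (simp add: \<epsilon>_def)
  qed
  have step: "x (Suc k) j = (\<Sum>t\<in>K m j. ?w t j * x k (snd t))" for k j
    using count_ratio_add[of "k * m" m j] by (simp add: x_def add.commute)
  have lo_step: "Lo k \<le> x (Suc k) j" for k j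
  proof -
    have "Lo k = (\<Sum>t\<in>K m j. ?w t j * Lo k)"
      using weights_sum[where j = j and m = m] by (simp only: sum_distrib_right[symmetric] mult_1)
    also have "\<dots> \<le> x (Suc k) j" unfolding step
      by (intro sum_mono mult_left_mono lohi less_imp_le[OF w0])
    finally show ?thesis .
  qed
  \<comment> \<open>By primitivity the type with the smallest ratio occurs in every
    \<open>K m j\<close>, with weight at least \<open>2 * \<epsilon>\<close>, and pulls each new
    ratio away from the old maximum.\<close>
  have hi_step: "x (Suc k) j \<le> Hi k - \<epsilon> * (Hi k - Lo k)" for k j
  proof -
    have "Lo k \<in> range (x k)" unfolding Lo_def by (intro Min_in) auto
    then obtain i where i: "Lo k = x k i" by auto
    obtain d where d: "(d, i) \<in> K m j" using prim by blast
    have "Hi k - x (Suc k) j = (\<Sum>t\<in>K m j. ?w t j * (Hi k - x k (snd t)))"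
      using weights_sum[of j m] by (simp add: step right_diff_distrib sum_subtractf sum_distrib_right[symmetric] del: times_divide_eq_left)
    also have "\<dots> \<ge> (\<Sum>t\<in>{(d, i)}. ?w t j * (Hi k - x k (snd t)))"
    proof (rule sum_mono2[OF finite_packed_K(1)])
      show "0 \<le> ?w t j * (Hi k - x k (snd t))" for t
        using lohi by (intro mult_nonneg_nonneg less_imp_le[OF w0]) simp
    qed (use d in simp)
    finally have "?w (d, i) j * (Hi k - Lo k) \<le> Hi k - x (Suc k) j" using i by simp
    moreover have "\<epsilon> * (Hi k - Lo k) \<le> ?w (d, i) j * (Hi k - Lo k)"
      using \<epsilon>(2)[of i j] \<epsilon>(1) lohi[of k i] by (intro mult_right_mono) auto
    ultimately show ?thesis by linarith
  qed
  have Lo_mono: "Lo k \<le> Lo (Suc k)" for k unfolding Lo_def[of ] using lo_step by (auto simp: Lo_def)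
  have Hi_step: "Hi (Suc k) \<le> Hi k - \<epsilon> * (Hi k - Lo k)" for k using hi_step by (auto simp: Hi_def)
  have LH: "Lo k \<le> Hi k" for k using lohi[of k undefined] by linarith
  have Hi_mono: "Hi (Suc k) \<le> Hi k" for k
    using Hi_step[of k] mult_nonneg_nonneg[of \<epsilon> "Hi k - Lo k"] \<epsilon>(1) LH[of k] by linarith
  have inc: "incseq Lo" and dec: "decseq Hi"
    using Lo_mono Hi_mono by (auto intro: incseq_SucI decseq_SucI)
  have cross: "Lo n \<le> Hi k" for n k
  proof -
    have "Lo n \<le> Lo (max n k)" "Hi (max n k) \<le> Hi k"
      using incseqD[OF inc] decseqD[OF dec] by auto
    then show ?thesis using LH[of "max n k"] by linarith
  qed
  define \<rho> where "\<rho> = (SUP k. Lo k)"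
  have bdd: "bdd_above (range Lo)" using cross[of _ 0] by (intro bdd_aboveI[of _ "Hi 0"]) auto
  have \<rho>: "Lo k \<le> \<rho>" "\<rho> \<le> Hi k" for k
    unfolding \<rho>_def using bdd cross by (auto intro: cSUP_upper cSUP_least)
  have "2 * \<epsilon> \<le> 1"
  proof -
    obtain d where d: "(d, undefined) \<in> K m undefined" using prim by blast
    have "(\<Sum>t\<in>{(d, undefined)}. ?w t undefined) \<le> (\<Sum>t\<in>K m undefined. ?w t undefined)"
      using d w0 finite_packed_K(1) by (intro sum_mono2) (auto intro: less_imp_le[OF w0])
    then show ?thesis using weights_sum[of undefined m] \<epsilon>(2)[of undefined undefined] by simp
  qed
  then have \<epsilon>1: "\<epsilon> \<le> 1/2" by simp
  have osc: "Hi k - Lo k \<le> (Hi 0 - Lo 0) * (1 - \<epsilon>) ^ k" for k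
  proof (induction k)
    case (Suc k)
    have "Hi (Suc k) - Lo (Suc k) \<le> (1 - \<epsilon>) * (Hi k - Lo k)"
      using Hi_step[of k] Lo_mono[of k] by (simp add: algebra_simps)
    also have "\<dots> \<le> (1 - \<epsilon>) * ((Hi 0 - Lo 0) * (1 - \<epsilon>) ^ k)"
      using Suc \<epsilon>1 by (intro mult_left_mono) auto
    finally show ?case by (simp add: mult.left_commute)
  qed simp
  have "0 < Lo 0"
  proof -
    have "0 < y" if "y \<in> range (x 0)" for y
      using that area_pos by (auto simp: x_def count_ratio_def K_def)
    then show ?thesis unfolding Lo_def by (subst Min_gr_iff) auto
  qed
  then have "0 < \<rho>" using \<rho>(1)[of 0] by linarith
  moreover have "\<bar>count_ratio (k * m) j - \<rho>\<bar> \<le> (Hi 0 - Lo 0) * (1 - \<epsilon>) ^ k" for k j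
    using osc[of k] lohi[of k j] \<rho>[of k] unfolding x_def by linarith
  ultimately show ?thesis
    using LH[of 0] \<epsilon>(1) \<epsilon>1 by (intro exI[of _ \<rho>] exI[of _ "Hi 0 - Lo 0"] exI[of _ "1 - \<epsilon>"]) auto
qed

section \<open>Counting tiles in a region by supertiles\<close>

text \<open>Tiles that meet \<open>R\<close> lie in supertiles of level \<open>l\<close> that meet
  \<open>R\<close>, and these stay in \<open>U\<close>, which contains all points within
  \<open>\<xi> ^ l * d\<close> of \<open>R\<close>. Areas are compared after shrinking by
  \<open>\<xi> ^ l\<close>, when the supertiles become packed tiles.\<close>

lemma count_upper:
  assumes ratio: "\<And>j. count_ratio l j \<le> \<beta>" and U: "U \<in> lmeasurable" and M: "l \<le> M"
    and d: "\<And>t x y. x \<in> T t \<Longrightarrow> y \<in> T t \<Longrightarrow> dist x y \<le> d"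
    and RU: "\<And>x y. x \<in> R \<Longrightarrow> dist x y \<le> \<xi> ^ l * d \<Longrightarrow> y \<in> U"
  shows "real (card {\<mu> \<in> K M i. T \<mu> \<inter> R \<noteq> {}}) \<le> \<beta> * leb U"
proof -
  define n where "n = M - l"
  have KM: "K M i = (\<Union>t\<in>K n i. G l t)" using K_add[of l n i] M by (simp add: n_def)
  define P where "P = {t \<in> K n i. scale l ` T t \<inter> R \<noteq> {}}"
  have P: "P \<subseteq> K n i" "finite P" using finite_packed_K(1)[of n i] by (auto simp: P_def)
  have pP: "packed P" using finite_packed_K(2)[of n i] P(1) unfolding packed_def by blast
  have \<xi>l: "0 < \<xi> ^ l" using \<xi> by simp
  have "{\<mu> \<in> K M i. T \<mu> \<inter> R \<noteq> {}} \<subseteq> (\<Union>t\<in>P. G l t)"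
  proof
    fix \<mu> assume \<mu>: "\<mu> \<in> {\<mu> \<in> K M i. T \<mu> \<inter> R \<noteq> {}}"
    then obtain t where t: "t \<in> K n i" "\<mu> \<in> G l t" unfolding KM by blast
    have "T \<mu> \<subseteq> scale l ` T t" using t(2) unfolding G_cover[symmetric] by blast
    then have "t \<in> P" using t(1) \<mu> unfolding P_def by blast
    then show "\<mu> \<in> (\<Union>t\<in>P. G l t)" using t(2) by blast
  qed
  then have "card {\<mu> \<in> K M i. T \<mu> \<inter> R \<noteq> {}} \<le> card (\<Union>t\<in>P. G l t)"
    using P(2) finite_G by (intro card_mono) auto
  also have "\<dots> = (\<Sum>t\<in>P. card (K l (snd t)))" by (rule card_UN_G[OF P(1)])
  finally have "real (card {\<mu> \<in> K M i. T \<mu> \<inter> R \<noteq> {}}) \<le> (\<Sum>t\<in>P. real (card (K l (snd t))))"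
    by (simp flip: of_nat_sum)
  also have "\<dots> \<le> (\<Sum>t\<in>P. \<beta> * (area (snd t) * \<xi> ^ (2 * l)))"
  proof (rule sum_mono)
    fix t
    have "0 < area (snd t) * \<xi> ^ (2 * l)" using area_pos \<xi> by simp
    then show "real (card (K l (snd t))) \<le> \<beta> * (area (snd t) * \<xi> ^ (2 * l))"
      using ratio[of "snd t"] by (simp add: count_ratio_def divide_le_eq)
  qed
  also have "\<dots> = \<beta> * (\<xi> ^ (2 * l) * (\<Sum>t\<in>P. area (snd t)))"
    by (simp add: sum_distrib_left sum_distrib_right mult_ac)
  also have "\<dots> \<le> \<beta> * leb U"
  proof (rule mult_left_mono)
    have "0 \<le> count_ratio l i" using area_pos[of i] \<xi> by (simp add: count_ratio_def)
    then show "0 \<le> \<beta>" using ratio[of i] by linarith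
    define U' where "U' = (\<lambda>x. (1 / \<xi> ^ l) *\<^sub>R x) ` U"
    have UU': "scale l ` U' = U" using \<xi> by (simp add: U'_def image_image)
    have U': "U' \<in> lmeasurable" unfolding U'_def using measurable_linear_image[of "\<lambda>x. (1 / \<xi> ^ l) *\<^sub>R x" U] U
      by (simp add: linear_scaleR)
    have "(\<Union>t\<in>P. interior (T t)) \<subseteq> U'"
    proof
      fix x assume "x \<in> (\<Union>t\<in>P. interior (T t))"
      then obtain t where t: "t \<in> P" "x \<in> T t" using interior_subset by blast
      then obtain y where y: "y \<in> T t" "scale l y \<in> R" by (auto simp: P_def)
      have "dist (scale l y) (scale l x) = \<xi> ^ l * dist y x"
        using \<xi>l by (simp add: dist_norm scaleR_diff_right[symmetric])
      also have "\<dots> \<le> \<xi> ^ l * d" using d[OF y(1) t(2)] \<xi>l by (intro mult_left_mono) auto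
      finally have "scale l x \<in> U" by (rule RU[OF y(2)])
      then show "x \<in> U'" using \<xi> unfolding U'_def by (intro image_eqI[of _ _ "scale l x"]) auto
    qed
    from packed_area_le[OF P(2) pP this U']
    have "\<xi> ^ (2 * l) * (\<Sum>t\<in>P. area (snd t)) \<le> \<xi> ^ (2 * l) * leb U'"
      using \<xi> by (intro mult_left_mono) auto
    also have "\<dots> = leb U" using measure_scale[of l U'] UU' by simp
    finally show "\<xi> ^ (2 * l) * (\<Sum>t\<in>P. area (snd t)) \<le> leb U" .
  qed
  finally show ?thesis .
qed

text \<open>Dual to the upper count: the supertiles that meet \<open>U\<close> cover it and stay in
  \<open>R\<close>. A covering is controlled by full areas, and \<open>area'_eq_area\<close> turns
  them into the interior areas of \<open>count_ratio\<close>.\<close>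

lemma count_lower:
  assumes ratio: "\<And>j. \<beta> \<le> count_ratio l j" and U: "U \<in> lmeasurable" and M: "l \<le> M"
    and d: "\<And>t x y. x \<in> T t \<Longrightarrow> y \<in> T t \<Longrightarrow> dist x y \<le> d"
    and UR: "\<And>x y. x \<in> U \<Longrightarrow> dist x y \<le> \<xi> ^ l * d \<Longrightarrow> y \<in> R"
    and cov: "U \<subseteq> (\<Union>\<mu>\<in>K M i. T \<mu>)"
  shows "\<beta> * leb U \<le> real (card {\<mu> \<in> K M i. T \<mu> \<subseteq> R})"
proof (cases "0 \<le> \<beta>")
  case False
  then have "\<beta> * leb U \<le> 0" by (simp add: mult_nonpos_nonneg)
  then show ?thesis by linarith
next
  case True
  define n where "n = M - l"
  have KM: "K M i = (\<Union>t\<in>K n i. G l t)" using K_add[of l n i] M by (simp add: n_def)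
  define P where "P = {t \<in> K n i. scale l ` T t \<inter> U \<noteq> {}}"
  have P: "P \<subseteq> K n i" "finite P" using finite_packed_K(1)[of n i] by (auto simp: P_def)
  have \<xi>l: "0 < \<xi> ^ l" using \<xi> by simp
  define U' where "U' = (\<lambda>x. (1 / \<xi> ^ l) *\<^sub>R x) ` U"
  have UU': "scale l ` U' = U" using \<xi> by (simp add: U'_def image_image)
  have U': "U' \<in> lmeasurable" unfolding U'_def using measurable_linear_image[of "\<lambda>x. (1 / \<xi> ^ l) *\<^sub>R x" U] U
    by (simp add: linear_scaleR)
  have "U' \<subseteq> (\<Union>t\<in>P. T t)"
  proof
    fix x assume x: "x \<in> U'"
    then have sx: "scale l x \<in> U" using UU' by blast
    then obtain \<mu> where \<mu>: "\<mu> \<in> K M i" "scale l x \<in> T \<mu>" using cov by blast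
    then obtain t where t: "t \<in> K n i" "\<mu> \<in> G l t" unfolding KM by blast
    then have "scale l x \<in> scale l ` T t" using \<mu>(2) unfolding G_cover[symmetric] by blast
    then have "x \<in> T t" using \<xi> by auto
    then show "x \<in> (\<Union>t\<in>P. T t)" using t(1) sx unfolding P_def by blast
  qed
  from cover_area_ge[OF P(2) this U']
  have a: "leb U' \<le> (\<Sum>t\<in>P. area (snd t))" by (simp add: area'_eq_area)
  have "\<beta> * leb U = \<beta> * (\<xi> ^ (2 * l) * leb U')"
    using measure_scale[of l U'] UU' by simp
  also have "\<dots> \<le> \<beta> * (\<xi> ^ (2 * l) * (\<Sum>t\<in>P. area (snd t)))"
    using a \<xi> True by (intro mult_left_mono) auto
  also have "\<dots> = (\<Sum>t\<in>P. \<beta> * (area (snd t) * \<xi> ^ (2 * l)))"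
    by (simp add: sum_distrib_left sum_distrib_right mult_ac)
  also have "\<dots> \<le> (\<Sum>t\<in>P. real (card (K l (snd t))))"
  proof (rule sum_mono)
    fix t
    have "0 < area (snd t) * \<xi> ^ (2 * l)" using area_pos \<xi> by simp
    then show "\<beta> * (area (snd t) * \<xi> ^ (2 * l)) \<le> real (card (K l (snd t)))"
      using ratio[of "snd t"] by (simp add: count_ratio_def le_divide_eq)
  qed
  also have "\<dots> = real (card (\<Union>t\<in>P. G l t))" by (simp add: card_UN_G[OF P(1)])
  also have "\<dots> \<le> real (card {\<mu> \<in> K M i. T \<mu> \<subseteq> R})"
  proof -
    have "(\<Union>t\<in>P. G l t) \<subseteq> {\<mu> \<in> K M i. T \<mu> \<subseteq> R}"
    proof
      fix \<mu> assume "\<mu> \<in> (\<Union>t\<in>P. G l t)"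
      then obtain t where t: "t \<in> P" "\<mu> \<in> G l t" by blast
      then obtain y where y: "y \<in> T t" "scale l y \<in> U" by (auto simp: P_def)
      have "scale l x \<in> R" if "x \<in> T t" for x
      proof (rule UR[OF y(2)])
        have "dist (scale l y) (scale l x) = \<xi> ^ l * dist y x"
          using \<xi>l by (simp add: dist_norm scaleR_diff_right[symmetric])
        also have "\<dots> \<le> \<xi> ^ l * d" using d[OF y(1) that] \<xi>l by (intro mult_left_mono) auto
        finally show "dist (scale l y) (scale l x) \<le> \<xi> ^ l * d" .
      qed
      moreover have "T \<mu> \<subseteq> scale l ` T t" using t(2) unfolding G_cover[symmetric] by blast
      ultimately have "T \<mu> \<subseteq> R" by blast
      moreover have "\<mu> \<in> K M i" using t P(1) unfolding KM by blast
      ultimately show "\<mu> \<in> {\<mu> \<in> K M i. T \<mu> \<subseteq> R}" by blast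
    qed
    then show ?thesis using finite_packed_K(1)[of M i] by (simp add: card_mono)
  qed
  finally show ?thesis .
qed

end

section \<open>Discrepancy of the net in boxes\<close>

context tile_system begin

text \<open>The interface between net and tile system. Each box gets its own \<open>M\<close>,
  \<open>i\<close> and \<open>c\<close>, because a substitution tiling relates only its finite
  patches to iterated prototiles, each up to a translation.\<close>

definition counted_by_tiles :: "(real^2) set \<Rightarrow> bool" where
  "counted_by_tiles Y \<longleftrightarrow> (\<forall>a b. \<exists>M i c.
     (+) c ` hbox a b \<subseteq> (\<Union>\<mu>\<in>K M i. T \<mu>) \<and> finite (Y \<inter> hbox a b) \<and>
     card {\<mu> \<in> K M i. T \<mu> \<subseteq> (+) c ` hbox a b} \<le> card (Y \<inter> hbox a b) \<and>
     card (Y \<inter> hbox a b) \<le> card {\<mu> \<in> K M i. T \<mu> \<inter> (+) c ` hbox a b \<noteq> {}})"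

text \<open>Moving every side of the box inwards or outwards by the diameter bound of a
  level-\<open>l\<close> supertile gives the regions for the lower and the upper count.\<close>

lemma box_count:
  assumes Y: "counted_by_tiles Y" and d: "0 < d" "\<And>t x y. x \<in> T t \<Longrightarrow> y \<in> T t \<Longrightarrow> dist x y \<le> d"
    and ratio: "\<And>j. \<bar>count_ratio l j - \<rho>\<bar> \<le> \<eta>"
    and side: "\<And>i. 2 * (\<xi> ^ l * d) \<le> b $ i - a $ i"
  shows "(\<rho> - \<eta>) * ((b $ 1 - a $ 1 - 2 * (\<xi> ^ l * d)) * (b $ 2 - a $ 2 - 2 * (\<xi> ^ l * d))) \<le> pts Y (hbox a b)"
    and "pts Y (hbox a b) \<le> (\<rho> + \<eta>) * ((b $ 1 - a $ 1 + 2 * (\<xi> ^ l * d)) * (b $ 2 - a $ 2 + 2 * (\<xi> ^ l * d)))"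
proof -
  define \<delta> where "\<delta> = \<xi> ^ l * d"
  have \<delta>: "0 < \<delta>" using d(1) \<xi> by (simp add: \<delta>_def)
  obtain M i c where c: "(+) c ` hbox a b \<subseteq> (\<Union>\<mu>\<in>K M i. T \<mu>)"
    and lo: "card {\<mu> \<in> K M i. T \<mu> \<subseteq> (+) c ` hbox a b} \<le> card (Y \<inter> hbox a b)"
    and up: "card (Y \<inter> hbox a b) \<le> card {\<mu> \<in> K M i. T \<mu> \<inter> (+) c ` hbox a b \<noteq> {}}"
    using Y unfolding counted_by_tiles_def by blast
  define a' where "a' = c + a" define b' where "b' = c + b"
  define R where "R = hbox a' b'"
  have R: "(+) c ` hbox a b = R" by (simp add: R_def a'_def b'_def hbox_translate)
  have sd: "2 * \<delta> \<le> b' $ i - a' $ i" for i using side[of i] by (simp add: a'_def b'_def \<delta>_def)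
  have diff: "b' $ i - a' $ i = b $ i - a $ i" for i by (simp add: a'_def b'_def)
  \<comment> \<open>The inflated prototile of level \<open>M\<close> covers the box, so
    \<open>M < l\<close> would make it too small. The witnesses \<open>p\<close> and
    \<open>q\<close> differ by 3/2 of the diameter bound in each coordinate, which is more than that
    bound and still less than a side.\<close>
  have M: "l \<le> M"
  proof (rule ccontr)
    assume "\<not> l \<le> M"
    then have "\<xi> ^ M \<le> \<xi> ^ l" using \<xi> by (intro power_increasing) auto
    define p where "p = a'" define q where "q = (\<chi> i. a' $ i + (3/2) * \<delta>)"
    have "a' $ i + (3/2) * \<delta> < b' $ i \<and> a' $ i < b' $ i" for i using sd[of i] \<delta> by simp
    then have pq: "p \<in> R" "q \<in> R" using \<delta> by (simp_all add: R_def hbox_def p_def q_def less_imp_le)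
    then have "p \<in> scale M ` S i" "q \<in> scale M ` S i" using c R K_cover by auto
    then obtain u v where uv: "u \<in> S i" "v \<in> S i" "p = scale M u" "q = scale M v" by blast
    have "T (0, i) = S i" by (simp add: T_def)
    then have "dist u v \<le> d" using d(2)[of u "(0, i)" v] uv by simp
    have "dist p q = \<xi> ^ M * dist u v"
      using \<xi> by (simp add: uv dist_norm scaleR_diff_right[symmetric])
    also have "\<dots> \<le> \<xi> ^ l * d" using \<open>\<xi> ^ M \<le> \<xi> ^ l\<close> \<open>dist u v \<le> d\<close> \<xi> by (intro mult_mono) auto
    finally have "dist p q \<le> \<delta>" by (simp add: \<delta>_def)
    moreover have "\<bar>(p - q) $ 1\<bar> \<le> dist p q" unfolding dist_norm by (rule component_le_norm_cart)
    ultimately show False using \<delta> by (simp add: p_def q_def)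
  qed
  have near: "\<bar>x $ i - y $ i\<bar> \<le> \<delta>" if "dist x y \<le> \<xi> ^ l * d" for x y :: "real^2" and i
    using component_le_norm_cart[of "x - y" i] that by (simp add: dist_norm \<delta>_def)
  let ?e = "(\<chi> i. \<delta>) :: real^2"
  have ax: "(1::2) + 1 = 2" by simp
  show "(\<rho> - \<eta>) * ((b $ 1 - a $ 1 - 2 * (\<xi> ^ l * d)) * (b $ 2 - a $ 2 - 2 * (\<xi> ^ l * d))) \<le> pts Y (hbox a b)"
  proof -
    have "(\<rho> - \<eta>) * leb (hbox (a' + ?e) (b' - ?e)) \<le> real (card {\<mu> \<in> K M i. T \<mu> \<subseteq> R})"
    proof (rule count_lower[OF _ _ M d(2)])
      show "\<rho> - \<eta> \<le> count_ratio l j" for j using ratio[of j] by (simp add: abs_le_iff)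
      show "hbox (a' + ?e) (b' - ?e) \<in> lmeasurable" by (intro lmeasurable_borel) auto
      show "y \<in> R" if "x \<in> hbox (a' + ?e) (b' - ?e)" "dist x y \<le> \<xi> ^ l * d" for x y
        unfolding R_def hbox_def
      proof (intro CollectI allI)
        fix i
        have "a' $ i + \<delta> \<le> x $ i" "x $ i < b' $ i - \<delta>" using that(1) by (auto simp: hbox_def)
        then show "a' $ i \<le> y $ i \<and> y $ i < b' $ i" using near[OF that(2), of i] by (simp add: abs_le_iff)
      qed
      have "hbox (a' + ?e) (b' - ?e) \<subseteq> R"
      proof
        fix x assume "x \<in> hbox (a' + ?e) (b' - ?e)"
        then have x: "a' $ i + \<delta> \<le> x $ i" "x $ i < b' $ i - \<delta>" for i by (auto simp: hbox_def)
        have "a' $ i \<le> x $ i \<and> x $ i < b' $ i" for i using x[of i] \<delta> by linarith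
        then show "x \<in> R" by (simp add: R_def hbox_def)
      qed
      then show "hbox (a' + ?e) (b' - ?e) \<subseteq> (\<Union>\<mu>\<in>K M i. T \<mu>)" using c R by blast
    qed simp
    also have "\<dots> \<le> pts Y (hbox a b)" using lo unfolding R pts_def by simp
    also have "leb (hbox (a' + ?e) (b' - ?e)) = (b $ 1 - a $ 1 - 2 * \<delta>) * (b $ 2 - a $ 2 - 2 * \<delta>)"
    proof -
      have w: "(b' - ?e) $ i - (a' + ?e) $ i = b $ i - a $ i - 2 * \<delta>" for i using diff[of i] by simp
      have "(a' + ?e) $ i \<le> (b' - ?e) $ i" for i using sd[of i] by simp
      then show ?thesis using measure_hbox2[of "a' + ?e" 1 "b' - ?e"] unfolding ax w by blast
    qed
    finally show ?thesis by (simp add: \<delta>_def)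
  qed
  show "pts Y (hbox a b) \<le> (\<rho> + \<eta>) * ((b $ 1 - a $ 1 + 2 * (\<xi> ^ l * d)) * (b $ 2 - a $ 2 + 2 * (\<xi> ^ l * d)))"
  proof -
    have "pts Y (hbox a b) \<le> real (card {\<mu> \<in> K M i. T \<mu> \<inter> R \<noteq> {}})" using up unfolding R pts_def by simp
    also have "\<dots> \<le> (\<rho> + \<eta>) * leb (hbox (a' - ?e) (b' + ?e))"
    proof (rule count_upper[OF _ _ M d(2)])
      show "count_ratio l j \<le> \<rho> + \<eta>" for j using ratio[of j] by (simp add: abs_le_iff)
      show "hbox (a' - ?e) (b' + ?e) \<in> lmeasurable" by (intro lmeasurable_borel) auto
      show "y \<in> hbox (a' - ?e) (b' + ?e)" if "x \<in> R" "dist x y \<le> \<xi> ^ l * d" for x y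
        unfolding hbox_def
      proof (intro CollectI allI)
        fix i
        have "a' $ i \<le> x $ i" "x $ i < b' $ i" using that(1) by (auto simp: hbox_def R_def)
        then show "(a' - ?e) $ i \<le> y $ i \<and> y $ i < (b' + ?e) $ i" using near[OF that(2), of i] by (simp add: abs_le_iff)
      qed
    qed simp
    also have "leb (hbox (a' - ?e) (b' + ?e)) = (b $ 1 - a $ 1 + 2 * \<delta>) * (b $ 2 - a $ 2 + 2 * \<delta>)"
    proof -
      have w: "(b' + ?e) $ i - (a' - ?e) $ i = b $ i - a $ i + 2 * \<delta>" for i using diff[of i] by simp
      have "(a' - ?e) $ i \<le> (b' + ?e) $ i" for i using sd[of i] \<delta> by simp
      then show ?thesis using measure_hbox2[of "a' - ?e" 1 "b' + ?e"] unfolding ax w by blast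
    qed
    finally show ?thesis by (simp add: \<delta>_def)
  qed
qed

text \<open>Two relative errors compete: the deviation of the supertile densities improves with the
  level, the share of the area near the boundary worsens. The level grows linearly with
  \<open>k\<close> while the supertiles stay below a multiple of the square root of the side, so
  both errors decay exponentially.\<close>

lemma counted_by_tiles_bilipschitz:
  assumes Y: "counted_by_tiles Y" and prim: "\<And>i j. \<exists>d. (d, i) \<in> K m j"
    and r: "0 < r" "\<And>y y'. y \<in> Y \<Longrightarrow> y' \<in> Y \<Longrightarrow> y \<noteq> y' \<Longrightarrow> r \<le> dist y y'"
  shows "lattice_bilipschitz Y"
proof -
  obtain \<rho> C \<theta> where \<rho>: "0 < \<rho>" "0 \<le> C" and \<theta>: "0 < \<theta>" "\<theta> < 1"
    and conv: "\<And>k j. \<bar>count_ratio (k * m) j - \<rho>\<bar> \<le> C * \<theta> ^ k"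
    using count_ratio_converges[OF prim] by blast
  obtain d where d: "0 < d" "\<And>t x y. x \<in> T t \<Longrightarrow> y \<in> T t \<Longrightarrow> dist x y \<le> d"
    using diameter_bound by blast
  \<comment> \<open>The fourth root of 2: \<open>\<gamma> ^ k\<close> is the square root of the side
    \<open>sqrt 2 ^ k\<close>.\<close>
  define \<gamma> where "\<gamma> = sqrt (sqrt (2::real))"
  have \<gamma>: "1 < \<gamma>" "\<gamma>\<^sup>2 = sqrt 2" by (simp_all add: \<gamma>_def)
  obtain q0 where "\<xi> ^ m < \<gamma> ^ q0" using real_arch_pow[OF \<gamma>(1)] by blast
  then have q0: "\<xi> ^ m \<le> \<gamma> ^ Suc q0" using power_increasing[of q0 "Suc q0" \<gamma>] \<gamma>(1) by linarith
  \<comment> \<open>\<open>q\<close> converts powers of \<open>\<gamma>\<close> into rounds of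
    subdivision: the level \<open>(k div q) * m\<close> inflates by at most
    \<open>\<gamma> ^ k\<close>. The successor keeps the divisor positive.\<close>
  define q where "q = Suc q0"
  obtain k0 where k0: "2 * d < \<gamma> ^ k0" using real_arch_pow[OF \<gamma>(1)] by blast
  \<comment> \<open>In terms of \<open>\<eta>\<close> and \<open>\<tau>\<close> below this is
    \<open>4 * \<eta> / \<rho> + 3 * \<tau>\<close>, where \<open>\<tau>\<close> bounds the width of
    the boundary strips relative to the sides. The 4 collects \<open>\<eta>\<close> and the mixed
    term \<open>3 * \<eta> * \<tau>\<close>, and \<open>k0\<close> ensures that
    \<open>\<tau>\<close> is at most 1.\<close>
  define E where "E = (\<lambda>k. 4 * (C / \<rho>) * \<theta> ^ (k div q) + 6 * d * (1 / \<gamma>) ^ k)"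
  show ?thesis
  proof (rule discrepancy_bilipschitz[OF \<rho>(1) _ _ _ _ r, where E = E and ?k0.0 = k0])
    show "0 \<le> E k" for k using \<rho> \<theta> d(1) \<gamma>(1) by (simp add: E_def)
    have "summable (\<lambda>k. \<theta> ^ (k div q))" using \<theta> by (intro summable_power_div) (auto simp: q_def)
    moreover have "summable (\<lambda>k. (1 / \<gamma>) ^ k)" using \<gamma>(1) by (intro summable_geometric) simp
    ultimately show "summable E" unfolding E_def by (intro summable_add summable_mult)
    show "finite (Y \<inter> hbox a b)" for a b using Y unfolding counted_by_tiles_def by blast
    fix k and a b :: "real^2" assume k: "k0 \<le> k" and side: "\<forall>i. sqrt 2 ^ k \<le> b $ i - a $ i"
    define l where "l = (k div q) * m"
    define \<eta> where "\<eta> = C * \<theta> ^ (k div q)"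
    have \<eta>: "0 \<le> \<eta>" using \<rho> \<theta> by (simp add: \<eta>_def)
    define \<tau> where "\<tau> = 2 * d * (1 / \<gamma>) ^ k"
    define A where "A = b $ 1 - a $ 1" define B where "B = b $ 2 - a $ 2"
    have \<gamma>k: "0 < \<gamma> ^ k" using \<gamma>(1) by simp
    have \<tau>: "0 \<le> \<tau>" "\<tau> \<le> 1"
    proof -
      show "0 \<le> \<tau>" using d(1) \<gamma>(1) by (simp add: \<tau>_def)
      have "\<gamma> ^ k0 \<le> \<gamma> ^ k" using \<gamma>(1) k by (intro power_increasing) auto
      then show "\<tau> \<le> 1" using k0 \<gamma>k by (simp add: \<tau>_def power_one_over field_simps)
    qed
    have "\<xi> ^ l = (\<xi> ^ m) ^ (k div q)" by (simp add: l_def power_mult mult.commute)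
    also have "\<dots> \<le> (\<gamma> ^ q) ^ (k div q)" using q0 \<xi> unfolding q_def by (intro power_mono) auto
    also have "\<dots> = \<gamma> ^ (q * (k div q))" by (simp add: power_mult)
    also have "\<dots> \<le> \<gamma> ^ k" using \<gamma>(1) by (intro power_increasing) auto
    finally have \<xi>l: "\<xi> ^ l \<le> \<gamma> ^ k" .
    have sm: "2 * (\<xi> ^ l * d) \<le> \<tau> * sqrt 2 ^ k"
    proof -
      have "\<tau> * sqrt 2 ^ k = 2 * d * \<gamma> ^ k"
        using \<gamma>k unfolding \<gamma>(2)[symmetric] \<tau>_def
        by (simp add: power_one_over power_mult[symmetric] mult.commute[of 2] power2_eq_square power_mult_distrib)
      then show ?thesis using \<xi>l d(1) by (simp add: mult.commute)
    qed
    have \<delta>: "2 * (\<xi> ^ l * d) \<le> \<tau> * (b $ i - a $ i)" for i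
      using sm mult_left_mono[OF side[rule_format, of i] \<tau>(1)] by linarith
    have bpos: "0 < b $ i - a $ i" for i
      by (rule less_le_trans[OF _ side[rule_format, of i]]) simp
    have "\<tau> * (b $ i - a $ i) \<le> b $ i - a $ i" for i using \<tau> bpos[of i] by (simp add: mult_left_le_one_le)
    then have side': "2 * (\<xi> ^ l * d) \<le> b $ i - a $ i" for i using \<delta>[of i] order_trans by blast
    have AB: "0 < A" "0 < B" using bpos[of 1] bpos[of 2] by (simp_all add: A_def B_def)
    have meas: "leb (hbox a b) = A * B"
      using AB unfolding A_def B_def by (subst measure_hbox2[where i = 1]) auto
    have ratio: "\<bar>count_ratio l j - \<rho>\<bar> \<le> \<eta>" for j unfolding l_def \<eta>_def by (rule conv)
    note bc = box_count[OF Y d ratio side']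
    define e where "e = 2 * (\<xi> ^ l * d)"
    have e: "0 \<le> e" "e \<le> \<tau> * A" "e \<le> \<tau> * B" using \<delta>[of 1] \<delta>[of 2] d(1) \<xi> by (simp_all add: e_def A_def B_def)
    have AB2: "0 < A * B" using AB by simp
    have upper: "pts Y (hbox a b) \<le> \<rho> * (A * B) + E k * (\<rho> * (A * B))"
    proof -
      have "pts Y (hbox a b) \<le> (\<rho> + \<eta>) * ((A + e) * (B + e))" using bc(2) by (simp add: A_def B_def e_def)
      also have "\<dots> \<le> (\<rho> + \<eta>) * ((A + \<tau> * A) * (B + \<tau> * B))"
        using e AB \<rho>(1) \<eta> by (intro mult_left_mono mult_mono) auto
      also have "(A + \<tau> * A) * (B + \<tau> * B) = (1 + \<tau>)\<^sup>2 * (A * B)" by (simp add: power2_eq_square algebra_simps)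
      also have "(1 + \<tau>)\<^sup>2 \<le> 1 + 3 * \<tau>"
        using mult_left_mono[OF \<tau>(2) \<tau>(1)] by (simp add: power2_eq_square algebra_simps)
      then have "(\<rho> + \<eta>) * ((1 + \<tau>)\<^sup>2 * (A * B)) \<le> (\<rho> + \<eta>) * ((1 + 3 * \<tau>) * (A * B))"
        using AB2 \<rho>(1) \<eta> by (intro mult_left_mono mult_right_mono) auto
      also have "\<dots> = (\<rho> + \<eta> + 3 * \<rho> * \<tau> + 3 * (\<eta> * \<tau>)) * (A * B)" by (simp add: algebra_simps)
      also have "\<dots> \<le> (\<rho> + \<eta> + 3 * \<rho> * \<tau> + 3 * \<eta>) * (A * B)"
        using AB2 mult_left_mono[OF \<tau>(2) \<eta>] by (intro mult_right_mono) auto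
      also have "\<dots> = \<rho> * (A * B) + E k * (\<rho> * (A * B))"
        using \<rho>(1) by (simp add: E_def \<eta>_def \<tau>_def field_simps)
      finally show ?thesis .
    qed
    have lower: "\<rho> * (A * B) - E k * (\<rho> * (A * B)) \<le> pts Y (hbox a b)"
    proof (cases "\<eta> \<le> \<rho>")
      case True
      have "\<rho> * (A * B) - E k * (\<rho> * (A * B)) = (\<rho> - 4 * \<eta> - 3 * \<rho> * \<tau>) * (A * B)"
        using \<rho>(1) by (simp add: E_def \<eta>_def \<tau>_def field_simps)
      also have "\<dots> \<le> ((\<rho> - \<eta>) * (1 - 2 * \<tau>)) * (A * B)"
      proof (rule mult_right_mono)
        have "0 \<le> \<rho> * \<tau>" "0 \<le> \<eta> * \<tau>" using \<rho> \<eta> \<tau> by auto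
        then show "\<rho> - 4 * \<eta> - 3 * \<rho> * \<tau> \<le> (\<rho> - \<eta>) * (1 - 2 * \<tau>)" using \<eta> by (simp add: algebra_simps)
      qed (use AB2 in simp)
      also have "\<dots> \<le> (\<rho> - \<eta>) * ((1 - \<tau>)\<^sup>2 * (A * B))"
        using True AB2 unfolding mult.assoc by (intro mult_left_mono mult_right_mono) (auto simp: power2_eq_square algebra_simps)
      also have "(1 - \<tau>)\<^sup>2 * (A * B) = (A - \<tau> * A) * (B - \<tau> * B)" by (simp add: power2_eq_square algebra_simps)
      also have "(\<rho> - \<eta>) * \<dots> \<le> (\<rho> - \<eta>) * ((A - e) * (B - e))"
        using e AB True \<tau> by (intro mult_left_mono mult_mono) (auto simp: mult_left_le_one_le order_trans[OF e(2)])
      also have "\<dots> \<le> pts Y (hbox a b)" using bc(1) by (simp add: A_def B_def e_def)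
      finally show ?thesis .
    next
      case False
      \<comment> \<open>When the deviation exceeds \<open>\<rho>\<close>, \<open>E k\<close> is at
        least 1 and the lower bound is not positive.\<close>
      then have "1 \<le> C / \<rho> * \<theta> ^ (k div q)" using \<rho>(1) by (simp add: \<eta>_def field_simps)
      then have "1 \<le> E k" using \<tau>(1) unfolding E_def \<tau>_def by linarith
      then have "1 * (\<rho> * (A * B)) \<le> E k * (\<rho> * (A * B))" using \<rho>(1) AB2 by (intro mult_right_mono) auto
      moreover have "0 \<le> pts Y (hbox a b)" by (simp add: pts_def)
      ultimately show ?thesis by simp
    qed
    show "\<bar>pts Y (hbox a b) - \<rho> * leb (hbox a b)\<bar> \<le> E k * (\<rho> * leb (hbox a b))"
      using upper lower unfolding meas by (simp add: abs_le_iff)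
  qed
qed

end

section \<open>Substitution tilings\<close>

text \<open>Expansion in the basis gives the upper bound, which makes \<open>N\<close> continuous;
  its minimum on the compact unit sphere is the lower bound.\<close>

lemma is_norm_equivalent:
  fixes N :: "'a::euclidean_space \<Rightarrow> real"
  assumes N: "is_norm N"
  shows "\<exists>\<alpha> \<beta>. 0 < \<alpha> \<and> 0 < \<beta> \<and> (\<forall>x. \<alpha> * norm x \<le> N x \<and> N x \<le> \<beta> * norm x)"
proof -
  have N0: "0 \<le> N x" "N x = 0 \<longleftrightarrow> x = 0" "N (c *\<^sub>R x) = \<bar>c\<bar> * N x" "N (x + y) \<le> N x + N y" for x y c
    using N unfolding is_norm_def by blast+
  define \<beta> where "\<beta> = (\<Sum>b\<in>Basis. N b) + 1"
  have \<beta>: "0 < \<beta>" using N0(1) by (auto simp: \<beta>_def intro!: add_nonneg_pos sum_nonneg)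
  have sum: "N (\<Sum>b\<in>A. f b) \<le> (\<Sum>b\<in>A. N (f b))" if "finite A" for f and A :: "'a set"
    using that
  proof (induction A)
    case empty then show ?case using N0(2)[of 0] by simp
  next
    case (insert b A) then show ?case using N0(4)[of "f b" "sum f A"] by simp
  qed
  have upper: "N x \<le> \<beta> * norm x" for x
  proof -
    have "N x = N (\<Sum>b\<in>Basis. (x \<bullet> b) *\<^sub>R b)" by (simp add: euclidean_representation)
    also have "\<dots> \<le> (\<Sum>b\<in>Basis. N ((x \<bullet> b) *\<^sub>R b))" by (rule sum) simp
    also have "\<dots> \<le> (\<Sum>b\<in>Basis. norm x * N b)"
      unfolding N0(3) using N0(1) by (intro sum_mono mult_right_mono Basis_le_norm)
    also have "\<dots> = norm x * (\<Sum>b\<in>Basis. N b)" by (simp only: sum_distrib_left)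
    also have "\<dots> \<le> \<beta> * norm x" by (simp add: \<beta>_def algebra_simps)
    finally show ?thesis .
  qed
  have "continuous_on (sphere 0 1) N"
  proof (rule lipschitz_on_continuous_on[of \<beta>], rule lipschitz_onI)
    fix x y
    have "N x \<le> N (x - y) + N y" using N0(4)[of "x - y" y] by simp
    moreover have "N y \<le> N (y - x) + N x" using N0(4)[of "y - x" x] by simp
    moreover have "N (x - y) \<le> \<beta> * dist x y" "N (y - x) \<le> \<beta> * dist x y"
      using upper[of "x - y"] upper[of "y - x"] by (simp_all add: dist_norm norm_minus_commute)
    ultimately show "dist (N x) (N y) \<le> \<beta> * dist x y" by (simp add: dist_real_def abs_le_iff)
  qed (use \<beta> in simp)
  moreover have "sphere (0::'a) 1 \<noteq> {}" by simp
  ultimately obtain x0 where x0: "x0 \<in> sphere 0 1" "\<And>y. y \<in> sphere 0 1 \<Longrightarrow> N x0 \<le> N y"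
    using continuous_attains_inf[OF compact_sphere, of 0 1 N] by blast
  have "x0 \<noteq> 0" using x0(1) by auto
  then have pos: "0 < N x0" using N0(1)[of x0] N0(2)[of x0] by linarith
  have "N x0 * norm x \<le> N x" for x
  proof (cases "x = 0")
    case False
    have "N x0 \<le> N ((1 / norm x) *\<^sub>R x)" using False by (intro x0(2)) simp
    then show ?thesis using False by (simp add: N0(3) field_simps)
  qed (use N0(2)[of x] in simp)
  then show ?thesis using pos \<beta> upper by blast
qed

lemma tile_compact:
  assumes "tile T" shows "compact T"
  using homeomorphic_compactness[OF assms[unfolded tile_def]] by (simp only: compact_cball)

text \<open>Invariance of domain: the homeomorphism sends the open ball to an open subset of the
  whole space.\<close>

lemma tile_interior:
  fixes T :: "'a::euclidean_space set"
  assumes "tile T" shows "interior T \<noteq> {}"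
proof -
  have "cball (0::'a) 1 homeomorphic T" using assms unfolding tile_def by (rule homeomorphic_sym[THEN iffD1])
  then obtain f g where hom: "homeomorphism (cball (0::'a) 1) T f g" unfolding homeomorphic_def by blast
  have sub: "ball (0::'a) 1 \<subseteq> cball 0 1" by (rule ball_subset_cball)
  have "open (f ` ball 0 1)"
  proof (rule invariance_of_domain)
    show "continuous_on (ball 0 1) f" using homeomorphism_cont1[OF hom] sub by (rule continuous_on_subset)
    show "inj_on f (ball 0 1)"
      using homeomorphism_apply1[OF hom] sub by (intro inj_on_inverseI[where g = g]) blast
  qed simp
  moreover have "f ` ball 0 1 \<subseteq> T" using homeomorphism_image1[OF hom] sub by blast
  ultimately have "f ` ball 0 1 \<subseteq> interior T" by (simp add: interior_maximal)
  moreover have "f 0 \<in> f ` ball 0 1" by simp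
  ultimately show ?thesis by blast
qed

text \<open>A point of \<open>X\<close> that maximises the inner product with \<open>c\<close>
  cannot be moved further in direction \<open>c\<close>.\<close>

lemma translate_self_compact:
  fixes X :: "'a::euclidean_space set"
  assumes "compact X" "X \<noteq> {}" "(+) c ` X \<subseteq> X"
  shows "c = 0"
proof -
  have "continuous_on X (\<lambda>y. c \<bullet> y)" by (intro continuous_intros)
  then obtain x where x: "x \<in> X" "\<And>y. y \<in> X \<Longrightarrow> c \<bullet> y \<le> c \<bullet> x"
    using continuous_attains_sup[OF assms(1,2)] by blast
  have "c \<bullet> (c + x) \<le> c \<bullet> x" using x assms(3) by blast
  then have "c \<bullet> c = 0" using inner_ge_zero[of c] by (simp add: inner_add_right del: inner_ge_zero)
  then show ?thesis by simp
qed

lemma translate_translate: "translate x (translate y T) = translate (x + y) T"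
  by (auto simp: translate_def image_image add.assoc)

lemma dilate_translate: "dilate c (translate x T) = translate (c *\<^sub>R x) (dilate c T)"
  by (auto simp: translate_def dilate_def image_image scaleR_add_right)

text \<open>This makes labels and tiles interchangeable: a tile determines its position and its
  type.\<close>

lemma prototile_translates_inj:
  fixes S :: "'k::finite \<Rightarrow> 'a::euclidean_space set"
  assumes sub: "substitution \<xi> S H" and eq: "translate x (S i) = translate x' (S i')"
  shows "x = x' \<and> i = i'"
proof -
  have e: "translate (x - x') (S i) = S i'"
  proof -
    have "translate (- x') (translate x (S i)) = translate (- x') (translate x' (S i'))" using eq by simp
    then show ?thesis by (simp add: translate_translate) (simp add: translate_def)
  qed
  then have "i = i'" using sub unfolding substitution_def translation_equivalent_def by metis
  moreover have "x - x' = 0"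
  proof (rule translate_self_compact)
    have t: "tile (S i)" using sub by (simp add: substitution_def)
    show "compact (S i)" using t by (rule tile_compact)
    show "S i \<noteq> {}" using tile_interior[OF t] interior_subset by blast
    show "(+) (x - x') ` S i \<subseteq> S i" using e \<open>i = i'\<close> by (simp add: translate_def)
  qed
  ultimately show ?thesis by simp
qed

definition placed_children :: "real \<Rightarrow> ('k \<Rightarrow> (real^2) set) \<Rightarrow> ('k \<Rightarrow> (real^2) set set) \<Rightarrow> 'k \<Rightarrow> ((real^2) \<times> 'k) set" where
  "placed_children \<xi> S H i = {(d, j). translate d (S j) \<in> dilate \<xi> ` H i}"

lemma dilated_children:
  assumes sub: "substitution \<xi> S H"
  shows "dilate \<xi> ` H i = (\<lambda>(d, j). translate d (S j)) ` placed_children \<xi> S H i"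
proof
  have \<xi>: "1 < \<xi>" using sub by (simp add: substitution_def)
  show "dilate \<xi> ` H i \<subseteq> (\<lambda>(d, j). translate d (S j)) ` placed_children \<xi> S H i"
  proof
    fix A assume A: "A \<in> dilate \<xi> ` H i"
    then obtain B where B: "B \<in> H i" "A = dilate \<xi> B" by blast
    then obtain j x where "B = translate x (dilate (inverse \<xi>) (S j))"
      using sub unfolding substitution_def by blast
    then have "A = translate (\<xi> *\<^sub>R x) (S j)"
      using B(2) \<xi> by (simp add: dilate_translate) (simp add: dilate_def image_image)
    then show "A \<in> (\<lambda>(d, j). translate d (S j)) ` placed_children \<xi> S H i"
      using A by (intro image_eqI[of _ _ "(\<xi> *\<^sub>R x, j)"]) (auto simp: placed_children_def)
  qed
qed (auto simp: placed_children_def)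

lemma tile_system_substitution:
  fixes S :: "'k::finite \<Rightarrow> (real^2) set"
  assumes sub: "substitution \<xi> S H"
  shows "tile_system \<xi> S (placed_children \<xi> S H)"
proof
  have \<xi>: "1 < \<xi>" and tile: "tile (S i)" and til: "tiling_of (H i) (S i)" for i
    using sub by (auto simp: substitution_def)
  show "1 < \<xi>" by (rule \<xi>)
  show "compact (S i)" for i by (rule tile_compact[OF tile])
  show "interior (S i) \<noteq> {}" for i by (rule tile_interior[OF tile])
  show "(\<lambda>x. \<xi> *\<^sub>R x) ` S i = (\<Union>(d, j)\<in>placed_children \<xi> S H i. (+) d ` S j)" for i
  proof -
    have "S i = \<Union>(H i)" using til[of i] by (simp add: tiling_of_def)
    then have "(\<lambda>x. \<xi> *\<^sub>R x) ` S i = (\<lambda>x. \<xi> *\<^sub>R x) ` \<Union>(H i)" by (rule arg_cong)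
    also have "\<dots> = \<Union>(dilate \<xi> ` H i)" by (simp add: image_Union dilate_def)
    finally have "(\<lambda>x. \<xi> *\<^sub>R x) ` S i = \<Union>(dilate \<xi> ` H i)" .
    then show ?thesis unfolding dilated_children[OF sub] by (simp add: translate_def case_prod_beta)
  qed
  fix i d j d' j'
  assume D: "(d, j) \<in> placed_children \<xi> S H i" "(d', j') \<in> placed_children \<xi> S H i" "(d, j) \<noteq> (d', j')"
  then obtain A A' where A: "A \<in> H i" "A' \<in> H i" "translate d (S j) = dilate \<xi> A" "translate d' (S j') = dilate \<xi> A'"
    by (auto simp: placed_children_def)
  \<comment> \<open>Distinct labels name distinct sets, so disjointness of interiors in the patch
    applies.\<close>
  have "A \<noteq> A'" using A D(3) prototile_translates_inj[OF sub, of d j d' j'] by auto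
  then have "interior A \<inter> interior A' = {}" using til[of i] A unfolding tiling_of_def by blast
  then have "dilate \<xi> (interior A) \<inter> dilate \<xi> (interior A') = {}" using \<xi> by (auto simp: dilate_def)
  moreover have "interior (dilate \<xi> B) = dilate \<xi> (interior B)" for B :: "(real^2) set"
    unfolding dilate_def using \<xi> by (intro interior_injective_linear_image) (auto simp: inj_def linear_scaleR)
  ultimately have "interior (translate d (S j)) \<inter> interior (translate d' (S j')) = {}"
    unfolding A(3,4) by simp
  then show "interior ((+) d ` S j) \<inter> interior ((+) d' ` S j') = {}" by (simp add: translate_def)
qed

section \<open>Substitution tilings as labelled tiles\<close>

locale substitution_system =
  fixes \<xi> :: real and S :: "'k::finite \<Rightarrow> (real^2) set" and H :: "'k \<Rightarrow> (real^2) set set"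
  assumes sub: "substitution \<xi> S H"
begin

sublocale tile_system \<xi> S "placed_children \<xi> S H"
  by (rule tile_system_substitution[OF sub])

lemma T_translate: "T t = translate (fst t) (S (snd t))"
  by (simp add: T_def translate_def)

lemma inj_T: "inj T"
  using prototile_translates_inj[OF sub] by (intro injI) (auto simp: T_translate prod_eq_iff)

text \<open>The bridge from the substitution on sets to \<open>subdiv\<close> on labels. Injectivity
  of \<open>T\<close> ensures that the union in \<open>extend_subst\<close> runs over exactly the
  labels in \<open>P\<close>.\<close>

lemma inflate_T: "inflate_subst \<xi> S H (T ` P) = T ` subdiv P"
proof -
  have "extend_subst S H (T ` P) = (\<Union>t\<in>P. translate_patch (fst t) (H (snd t)))"
  proof -
    have "translate x (S i) \<in> T ` P \<longleftrightarrow> (x, i) \<in> P" for x i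
      using inj_image_mem_iff[OF inj_T, of "(x, i)" P] by (simp add: T_translate)
    then show ?thesis unfolding extend_subst_def by fastforce
  qed
  then have "inflate_subst \<xi> S H (T ` P) = (\<Union>t\<in>P. dilate \<xi> ` translate (fst t) ` H (snd t))"
    by (simp add: inflate_subst_def dilate_patch_def translate_patch_def image_UN)
  also have "\<dots> = (\<Union>t\<in>P. translate (\<xi> *\<^sub>R fst t) ` dilate \<xi> ` H (snd t))"
    by (simp add: image_image dilate_translate)
  also have "\<dots> = (\<Union>t\<in>P. T ` shift (\<xi> *\<^sub>R fst t) ` placed_children \<xi> S H (snd t))"
    unfolding dilated_children[OF sub]
    by (simp add: image_image case_prod_beta translate_translate T_translate shift_def)
  finally show ?thesis by (simp add: subdiv_def image_UN)
qed

lemma inflate_K: "(inflate_subst \<xi> S H ^^ m) {S i} = T ` K m i"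
proof (induction m)
  case 0 then show ?case by (simp add: K_def T_def)
next
  case (Suc m) then show ?case using inflate_T[of "K m i"] by (simp add: K_def)
qed

text \<open>A matrix factor on the left corresponds to one more round at the end. A positive entry
  of the product has a nonzero summand, hence a tile of some type \<open>k\<close> in
  \<open>K m j\<close> whose subdivision contains a tile of type \<open>i\<close>.\<close>

lemma matrix_power_pos:
  "0 < matrix_power (subst_matrix \<xi> S H) m $ i $ j \<Longrightarrow> \<exists>d. (d, i) \<in> K m j"
proof (induction m arbitrary: i)
  case 0
  then have "i = j" by (auto simp: matrix_power_def mat_def split: if_splits)
  then show ?case by (auto simp: K_def)
next
  case (Suc m)
  let ?B = "subst_matrix \<xi> S H"
  have eq: "matrix_power ?B (Suc m) $ i $ j = (\<Sum>k\<in>UNIV. ?B $ i $ k * matrix_power ?B m $ k $ j)"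
    by (simp add: matrix_power_def matrix_matrix_mult_def)
  have "(\<Sum>k\<in>UNIV. ?B $ i $ k * matrix_power ?B m $ k $ j) \<noteq> 0"
    using Suc.prems unfolding eq by (rule gr_implies_not0)
  then obtain k where k: "?B $ i $ k * matrix_power ?B m $ k $ j \<noteq> 0" by (meson sum.neutral)
  then obtain d where d: "(d, k) \<in> K m j" using Suc.IH[of k] by auto
  have "card {A \<in> inflate_subst \<xi> S H {S k}. translation_equivalent (S i) A} \<noteq> 0"
    using k by (simp add: subst_matrix_def)
  then obtain A where A: "A \<in> inflate_subst \<xi> S H {S k}" "translation_equivalent (S i) A"
    by (metis (mono_tags, lifting) card.empty empty_Collect_eq)
  have "{S k} = T ` {(0, k)}" by (simp add: T_def)
  then have "inflate_subst \<xi> S H {S k} = T ` subdiv {(0, k)}" using inflate_T[of "{(0, k)}"] by simp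
  also have "subdiv {(0, k)} = placed_children \<xi> S H k" by (simp add: subdiv_def shift_def)
  finally have "A \<in> T ` placed_children \<xi> S H k" using A(1) by simp
  then obtain t where t: "t \<in> placed_children \<xi> S H k" "A = T t" by blast
  obtain x where "A = translate x (S i)" using A(2) by (auto simp: translation_equivalent_def)
  then have "T t = T (x, i)" using t(2) by (simp add: T_translate)
  then have "t = (x, i)" using inj_T by (simp add: inj_eq)
  then have "shift (\<xi> *\<^sub>R d) (x, i) \<in> K (Suc m) j"
    using d t(1) by (force simp: K_def subdiv_def)
  then show ?case by (auto simp: shift_def)
qed

lemma negligible_frontier_T: "negligible (T t - interior (T t))"
proof -
  have "leb (T t - interior (T t)) = 0"
    using measurable_measure_Diff[OF T_lmeasurable(1) fmeasurableD[OF T_lmeasurable(2)] interior_subset, of t]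
    by (simp add: measure_T area'_eq_area)
  then show ?thesis
    using T_lmeasurable[of t] by (simp add: negligible_iff_measure fmeasurable_Diff fmeasurableD)
qed

text \<open>Otherwise the interior of the tile would be covered by the null frontiers of the tiles in \<open>P\<close>.\<close>

lemma covered_tile_mem:
  assumes "packed Q" "\<mu> \<in> Q" "P \<subseteq> Q" "finite P" "T \<mu> \<subseteq> (\<Union>t\<in>P. T t)"
  shows "\<mu> \<in> P"
proof (rule ccontr)
  assume no: "\<mu> \<notin> P"
  have "interior (T \<mu>) \<subseteq> (\<Union>t\<in>P. T t - interior (T t))"
  proof
    fix x assume x: "x \<in> interior (T \<mu>)"
    then obtain t where t: "t \<in> P" "x \<in> T t" using assms(5) interior_subset by blast
    then have "t \<in> Q" "\<mu> \<noteq> t" using assms(3) no by auto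
    then have "interior (T \<mu>) \<inter> interior (T t) = {}"
      using assms(1,2) by (simp add: packed_def)
    then show "x \<in> (\<Union>t\<in>P. T t - interior (T t))" using x t by blast
  qed
  moreover have "negligible (\<Union>t\<in>P. T t - interior (T t))"
    using assms(4) negligible_frontier_T by (intro negligible_Union) auto
  ultimately have "negligible (interior (T \<mu>))" by (rule negligible_subset[rotated])
  then show False using open_not_negligible[OF open_interior interior_T_nonempty] by blast
qed

text \<open>Points in the box belong to tiles meeting it, and tiles inside the box have their points
  in it. The patch \<open>P\<close> of tiles meeting the box has a translate inside some
  \<open>K m i\<close>, which may contain further tiles. Those inside the translated box all come
  from \<open>P\<close> by \<open>covered_tile_mem\<close>, since \<open>P\<close> already covers
  the box.\<close>

lemma counted_by_tiles_net:
  assumes \<tau>: "\<tau> \<in> substitution_tilings \<xi> S H" and Y: "net_corresponds Y \<tau>"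
  shows "counted_by_tiles Y"
  unfolding counted_by_tiles_def
proof (intro allI)
  fix a b :: "real^2"
  define R where "R = hbox a b"
  have til: "tiling_of \<tau> UNIV" and teq: "\<And>A. A \<in> \<tau> \<Longrightarrow> \<exists>i. translation_equivalent (S i) A"
    using \<tau> by (simp_all add: substitution_tilings_def)
  have leg: "\<exists>x m i. translate_patch x P \<subseteq> (inflate_subst \<xi> S H ^^ m) {S i}"
    if "P \<subseteq> \<tau>" "patch P" for P
    using \<tau> that by (simp add: substitution_tilings_def)
  obtain y where y: "bij_betw y \<tau> Y" "\<And>A. A \<in> \<tau> \<Longrightarrow> y A \<in> A"
    using Y unfolding net_corresponds_def by blast
  define P where "P = {A \<in> \<tau>. A \<inter> R \<noteq> {}}"
  obtain d where d: "0 < d" "\<And>t x y. x \<in> T t \<Longrightarrow> y \<in> T t \<Longrightarrow> dist x y \<le> d"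
    using diameter_bound by blast
  have "patch P"
  proof -
    obtain c e where ce: "\<And>x. x \<in> R \<Longrightarrow> dist c x \<le> e"
      using bounded_hbox[of a b] unfolding R_def bounded_def by blast
    have "\<Union>P \<subseteq> cball c (e + d)"
    proof
      fix x assume "x \<in> \<Union>P"
      then obtain A z where A: "A \<in> \<tau>" "x \<in> A" "z \<in> A" "z \<in> R" by (auto simp: P_def)
      obtain i u where "A = translate u (S i)" using teq[OF A(1)] by (auto simp: translation_equivalent_def)
      then have "A = T (u, i)" by (simp add: T_translate)
      then have "dist z x \<le> d" using d(2)[of z "(u, i)" x] A by simp
      then show "x \<in> cball c (e + d)" using ce[OF A(4)] dist_triangle[of c x z] by simp
    qed
    then have "bounded (\<Union>P)" using bounded_cball bounded_subset by blast
    moreover have "tiling_of P (\<Union>P)"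
      using til countable_subset[of P \<tau>] unfolding tiling_of_def P_def by auto
    ultimately show ?thesis unfolding patch_def by blast
  qed
  then obtain x m i where "translate_patch x P \<subseteq> (inflate_subst \<xi> S H ^^ m) {S i}"
    using leg[of P] by (auto simp: P_def)
  then have sub': "translate_patch x P \<subseteq> T ` K m i" unfolding inflate_K .
  define P' where "P' = {t \<in> K m i. T t \<in> translate_patch x P}"
  have P': "P' \<subseteq> K m i" "finite P'" using finite_packed_K(1)[of m i] by (auto simp: P'_def)
  have inP: "\<exists>t\<in>P'. translate x A = T t" if "A \<in> P" for A
  proof -
    have "translate x A \<in> translate_patch x P" using that by (simp add: translate_patch_def)
    moreover from this obtain t where "t \<in> K m i" "translate x A = T t" using sub' by blast
    ultimately show ?thesis by (intro bexI[of _ t]) (simp_all add: P'_def)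
  qed
  have RP: "R \<subseteq> \<Union>P"
  proof
    fix u assume u: "u \<in> R"
    have "u \<in> \<Union>\<tau>" using til by (simp add: tiling_of_def)
    then show "u \<in> \<Union>P" using u by (auto simp: P_def)
  qed
  have cov: "(+) x ` R \<subseteq> (\<Union>t\<in>P'. T t)"
  proof
    fix z assume "z \<in> (+) x ` R"
    then obtain u A where u: "u \<in> A" "A \<in> P" "z = x + u" using RP by blast
    obtain t where "t \<in> P'" "translate x A = T t" using inP[OF u(2)] by blast
    then show "z \<in> (\<Union>t\<in>P'. T t)" using u by (auto simp: translate_def)
  qed
  \<comment> \<open>\<open>h\<close> leads from a tile of \<open>K m i\<close> back to the point of
    \<open>Y\<close> in the corresponding tile of \<open>\<tau>\<close>; it is meaningful for tiles
    that come from \<open>P\<close>.\<close>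
  define h where "h = (\<lambda>t. y (translate (- x) (T t)))"
  have untranslate: "translate (- x) (translate x A) = A" for A :: "(real^2) set"
    by (simp add: translate_translate) (simp add: translate_def)
  let ?U = "{\<mu> \<in> K m i. T \<mu> \<inter> (+) x ` R \<noteq> {}}"
  let ?L = "{\<mu> \<in> K m i. T \<mu> \<subseteq> (+) x ` R}"
  have finU: "finite ?U" "finite ?L" using finite_packed_K(1)[of m i] by simp_all
  have up: "Y \<inter> R \<subseteq> h ` ?U"
  proof
    fix v assume v: "v \<in> Y \<inter> R"
    then obtain A where A: "A \<in> \<tau>" "y A = v" using y(1) by (auto simp: bij_betw_def)
    then have "v \<in> A" using y(2) by blast
    then have "A \<in> P" using A v by (auto simp: P_def)
    then obtain t where t: "t \<in> P'" "translate x A = T t" using inP by blast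
    have "x + v \<in> T t" using \<open>v \<in> A\<close> t(2)[symmetric] by (simp add: translate_def)
    then have "t \<in> ?U" using t(1) P'(1) v by auto
    moreover have "h t = v" unfolding h_def t(2)[symmetric] untranslate by (rule A(2))
    ultimately show "v \<in> h ` ?U" by blast
  qed
  have L: "\<exists>A\<in>P. T \<mu> = translate x A \<and> A \<subseteq> R" if "\<mu> \<in> ?L" for \<mu>
  proof -
    have \<mu>: "\<mu> \<in> K m i" "T \<mu> \<subseteq> (+) x ` R" using that by simp_all
    have "\<mu> \<in> P'"
      by (rule covered_tile_mem[OF finite_packed_K(2) \<mu>(1) P' subset_trans[OF \<mu>(2) cov]])
    then obtain A where A: "A \<in> P" "T \<mu> = translate x A" by (auto simp: P'_def translate_patch_def)
    have "A \<subseteq> R"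
    proof
      fix u assume "u \<in> A"
      then have "x + u \<in> (+) x ` R" using that A(2) by (auto simp: translate_def)
      then show "u \<in> R" by auto
    qed
    then show ?thesis using A by blast
  qed
  have lo: "h ` ?L \<subseteq> Y \<inter> R"
  proof clarify
    fix \<mu> assume "\<mu> \<in> K m i" "T \<mu> \<subseteq> (+) x ` R"
    then obtain A where A: "A \<in> P" "T \<mu> = translate x A" "A \<subseteq> R" using L by blast
    have "h \<mu> = y A" unfolding h_def A(2) untranslate ..
    moreover have "A \<in> \<tau>" using A(1) by (simp add: P_def)
    ultimately show "h \<mu> \<in> Y \<inter> R" using y A(3) by (auto simp: bij_betw_def)
  qed
  have inj: "inj_on h ?L"
  proof (rule inj_onI)
    fix \<mu> \<mu>' assume \<mu>: "\<mu> \<in> ?L" "\<mu>' \<in> ?L" "h \<mu> = h \<mu>'"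
    obtain A where A: "A \<in> P" "T \<mu> = translate x A" using L[OF \<mu>(1)] by blast
    obtain A' where A': "A' \<in> P" "T \<mu>' = translate x A'" using L[OF \<mu>(2)] by blast
    have "y A = y A'" using \<mu>(3) unfolding h_def A(2) A'(2) untranslate .
    then have "A = A'" using y(1) A(1) A'(1) by (auto simp: bij_betw_def P_def dest: inj_onD)
    then have "T \<mu> = T \<mu>'" using A A' by simp
    then show "\<mu> = \<mu>'" using inj_T by (simp add: inj_eq)
  qed
  have fin: "finite (Y \<inter> R)" using finite_subset[OF up] finU by blast
  have "card ?L \<le> card (Y \<inter> R)" using card_inj_on_le[OF inj lo fin] .
  moreover have "card (Y \<inter> R) \<le> card ?U" using surj_card_le[OF finU(1) up] .
  moreover have "(+) x ` R \<subseteq> (\<Union>\<mu>\<in>K m i. T \<mu>)" using cov P'(1) by blast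
  ultimately show "\<exists>M i c.
     (+) c ` hbox a b \<subseteq> (\<Union>\<mu>\<in>K M i. T \<mu>) \<and> finite (Y \<inter> hbox a b) \<and>
     card {\<mu> \<in> K M i. T \<mu> \<subseteq> (+) c ` hbox a b} \<le> card (Y \<inter> hbox a b) \<and>
     card (Y \<inter> hbox a b) \<le> card {\<mu> \<in> K M i. T \<mu> \<inter> (+) c ` hbox a b \<noteq> {}}"
    using fin unfolding R_def by (intro exI[of _ m] exI[of _ i] exI[of _ x]) auto
qed

end

theorem theorem1p2:
  fixes N :: "real ^ 2 \<Rightarrow> real"
    and \<xi> :: real
    and S :: "'k::finite \<Rightarrow> (real ^ 2) set"
    and H :: "'k \<Rightarrow> (real ^ 2) set set"
    and \<tau> :: "(real ^ 2) set set"
    and Y :: "(real ^ 2) set"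
  assumes "is_norm N"
    and "substitution \<xi> S H"
    and "primitive_subst \<xi> S H"
    and "\<tau> \<in> substitution_tilings \<xi> S H"
    and "separated_net N Y"
    and "net_corresponds Y \<tau>"
  shows "biLipschitz_equivalent N Y integer_lattice"
proof -
  interpret substitution_system \<xi> S H using assms(2) by unfold_locales
  obtain m where m: "\<And>i j. 0 < matrix_power (subst_matrix \<xi> S H) m $ i $ j"
    using assms(3) unfolding primitive_subst_def by blast
  obtain \<alpha> \<beta> where \<alpha>: "0 < \<alpha>" "\<And>x. \<alpha> * norm x \<le> N x" and \<beta>: "0 < \<beta>" "\<And>x. N x \<le> \<beta> * norm x"
    using is_norm_equivalent[OF assms(1)] by blast
  obtain r where r: "0 < r" "\<And>c y y'. y \<in> norm_ball N c r \<inter> Y \<Longrightarrow> y' \<in> norm_ball N c r \<inter> Y \<Longrightarrow> y = y'"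
    using assms(5) unfolding separated_net_def by blast
  \<comment> \<open>Two closer points would both lie in the \<open>N\<close>-ball of radius
    \<open>r\<close> about the first.\<close>
  have sep: "r / \<beta> \<le> dist y y'" if "y \<in> Y" "y' \<in> Y" "y \<noteq> y'" for y y'
  proof (rule ccontr)
    assume "\<not> r / \<beta> \<le> dist y y'"
    then have "\<beta> * norm (y' - y) \<le> r" using \<beta>(1) by (simp add: dist_norm norm_minus_commute field_simps)
    then have "N (y' - y) \<le> r" using \<beta>(2)[of "y' - y"] by linarith
    moreover have "N (y - y) \<le> r" using \<beta>(2)[of 0] r(1) by simp
    ultimately show False using r(2)[of y y y'] that by (simp add: norm_ball_def)
  qed
  have prim: "\<exists>d. (d, i) \<in> K m j" for i j using m by (rule matrix_power_pos)
  have "0 < r / \<beta>" using r(1) \<beta>(1) by simp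
  have "lattice_bilipschitz Y"
    by (rule counted_by_tiles_bilipschitz[OF counted_by_tiles_net[OF assms(4,6)] prim \<open>0 < r / \<beta>\<close>])
       (rule sep)
  then obtain \<Phi> L where \<Phi>: "bij_betw \<Phi> Y (integer_lattice :: (real^2) set)" and L: "0 < L"
    and lip: "\<forall>y\<in>Y. \<forall>y'\<in>Y. dist y y' \<le> L * dist (\<Phi> y) (\<Phi> y') \<and> dist (\<Phi> y) (\<Phi> y') \<le> L * dist y y'"
    unfolding lattice_bilipschitz_def by (elim exE conjE)
  \<comment> \<open>Passing from the Euclidean norm to \<open>N\<close> multiplies the constant
    \<open>L\<close> by \<open>\<beta> / \<alpha>\<close>.\<close>
  define C where "C = max 1 (\<beta> * L / \<alpha>)"
  have compare: "N u \<le> C * N v" if "norm u \<le> L * norm v" for u v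
  proof -
    have "N u \<le> \<beta> * (L * norm v)"
      using \<beta>(2)[of u] mult_left_mono[OF that, of \<beta>] \<beta>(1) by linarith
    also have "\<dots> = \<beta> * L / \<alpha> * (\<alpha> * norm v)" using \<alpha>(1) by simp
    also have "\<dots> \<le> \<beta> * L / \<alpha> * N v" using \<alpha> \<beta>(1) L by (intro mult_left_mono) auto
    also have "\<dots> \<le> C * N v"
    proof (rule mult_right_mono)
      show "0 \<le> N v" using assms(1) by (simp add: is_norm_def)
    qed (simp add: C_def)
    finally show ?thesis .
  qed
  have C: "1 \<le> C" by (simp add: C_def)
  have "1 / C * N (y - y') \<le> N (\<Phi> y - \<Phi> y') \<and> N (\<Phi> y - \<Phi> y') \<le> C * N (y - y')"
    if "y \<in> Y" "y' \<in> Y" for y y'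
    using compare[of "y - y'" "\<Phi> y - \<Phi> y'"] compare[of "\<Phi> y - \<Phi> y'" "y - y'"] lip[rule_format, OF that] C
    by (simp add: dist_norm field_simps)
  then show ?thesis unfolding biLipschitz_equivalent_def using \<Phi> C by blast
qed

end
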